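(* For each $n$, let $A=(A_{i,j})_{i,j=1}^n$ be a symmetric random matrix with i.i.d. standard Gaussian entries $A_{i,j}$, $1\le i<j\le n$, and let $\tilde A$ be the matrix obtained from $A$ by putting $0$ on the diagonal. Let $k=k_n$ be any sequence of integers with $k\ge 3$ and $k=o(\sqrt{\log n})$. Then, as $n\to\infty$, $$C_{n,k}-\left\{\mathrm{Tr}\left(P_k\left(\tfrac{1}{\sqrt n}\tilde A\right)\right)-\mathrm{E}\left[\mathrm{Tr}\left(P_k\left(\tfrac{1}{\sqrt n}\tilde A\right)\right)\right]\right\}\xrightarrow{p}0.$$
   Context: Signed cycles: for $k\ge 2$, $$C_{n,k}:=\left(\frac{1}{\sqrt n}\right)^k\sum_{i_0,i_1,\ldots,i_{k-1}}A_{i_0,i_1}A_{i_1,i_2}\cdots A_{i_{k-1},i_0},$$ where the sum is over all ordered tuples $(i_0,\ldots,i_{k-1})\in\{1,\ldots,n\}^k$ with all entries distinct. Rescaled Chebyshev polynomials: let $S_m$ be the standard Chebyshev polynomial of degree $m$, defined by $S_m(\cos\theta)=\cos(m\theta)$; then $P_m(x):=2S_m(x/2)$, equivalently $P_m(z+z^{-1})=z^m+z^{-m}$. For a function $f$ and a symmetric $n\times n$ matrix $B$ with eigenvalues $\lambda_1,\ldots,\lambda_n$, $\mathrm{Tr}(f(B))=\sum_{i=1}^nf(\lambda_i)$. $\xrightarrow{p}$ is convergence in probability. *)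

theory Defs
  imports
    "HOL-Probability.Probability"
    "HOL-Library.Landau_Symbols"
    "Jordan_Normal_Form.Char_Poly"
begin

definition cheb :: "nat \<Rightarrow> real poly" where
  "cheb m = (THE p. \<forall>\<theta>. poly p (cos \<theta>) = cos (real m * \<theta>))"

lemma cheb_unique:
  fixes p q :: "real poly"
  assumes "\<forall>\<theta>. poly p (cos \<theta>) = cos (real m * \<theta>)"
    and "\<forall>\<theta>. poly q (cos \<theta>) = cos (real m * \<theta>)"
  shows "p = q"
proof (rule ccontr)
  assume "p \<noteq> q"
  hence fin: "finite {x. poly (p - q) x = 0}"
    by (intro poly_roots_finite) simp
  have "{-1..1} \<subseteq> {x. poly (p - q) x = 0}"
  proof
    fix x :: real assume "x \<in> {-1..1}"
    hence "cos (arccos x) = x" by (simp add: cos_arccos)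
    thus "x \<in> {x. poly (p - q) x = 0}" using assms by (metis (mono_tags) eq_iff_diff_eq_0 mem_Collect_eq poly_diff)
  qed
  with fin have "finite {-1..1::real}" by (rule rev_finite_subset)
  thus False by (simp add: infinite_Icc)
qed

lemma cheb_eqI: "(\<And>\<theta>. poly p (cos \<theta>) = cos (real m * \<theta>)) \<Longrightarrow> cheb m = p"
  unfolding cheb_def by (rule the_equality) (auto intro: cheb_unique)

lemma cheb_0: "cheb 0 = 1"
  by (rule cheb_eqI) simp

lemma cheb_1: "cheb (Suc 0) = [:0, 1:]"
  by (rule cheb_eqI) simp

lemma cos_Suc_Suc: "cos (real (Suc (Suc m)) * t) = 2 * cos t * cos (real (Suc m) * t) - cos (real m * t)"
proof -
  have "cos (real (Suc m) * t + t) + cos (real (Suc m) * t - t) = 2 * cos t * cos (real (Suc m) * t)"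
    by (simp add: cos_add cos_diff)
  moreover have "real (Suc m) * t + t = real (Suc (Suc m)) * t" "real (Suc m) * t - t = real m * t"
    by (simp_all add: algebra_simps)
  ultimately show ?thesis by simp
qed

lemma poly_cheb_cos: "poly (cheb m) (cos \<theta>) = cos (real m * \<theta>)"
proof -
  have "\<exists>p::real poly. \<forall>\<theta>. poly p (cos \<theta>) = cos (real m * \<theta>)"
  proof (induction m rule: induct_nat_012)
    case 0 show ?case by (intro exI[of _ 1]) simp
  next
    case 1 show ?case by (intro exI[of _ "[:0, 1:]"]) simp
  next
    case (ge2 m)
    then obtain p q :: "real poly"
      where "\<forall>\<theta>. poly p (cos \<theta>) = cos (real m * \<theta>)"
        and "\<forall>\<theta>. poly q (cos \<theta>) = cos (real (Suc m) * \<theta>)" by blast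
    thus ?case
      by (intro exI[of _ "[:0, 2:] * q - p"]) (simp add: cos_Suc_Suc del: of_nat_Suc)
  qed
  then obtain p :: "real poly" where p: "\<forall>\<theta>. poly p (cos \<theta>) = cos (real m * \<theta>)" ..
  hence "cheb m = p" by (intro cheb_eqI) blast
  with p show ?thesis by blast
qed

lemma cheb_Suc_Suc: "cheb (Suc (Suc m)) = [:0, 2:] * cheb (Suc m) - cheb m"
  by (rule cheb_eqI) (simp add: poly_cheb_cos cos_Suc_Suc del: of_nat_Suc)

lemma degree_cheb: "degree (cheb m) = m"
proof (induction m rule: induct_nat_012)
  case (ge2 m)
  have nz: "cheb (Suc m) \<noteq> 0" using ge2 by auto
  have d: "degree ([:0, 2:] * cheb (Suc m)) = Suc (Suc m)"
    using ge2 nz by (subst degree_mult_eq) auto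
  have "degree ([:0, 2:] * cheb (Suc m) + (- cheb m)) = degree ([:0, 2:] * cheb (Suc m))"
    by (rule degree_add_eq_left) (use ge2 in \<open>simp only: d degree_minus\<close>)
  thus ?case by (simp only: cheb_Suc_Suc d diff_conv_add_uminus)
qed (simp_all add: cheb_0 cheb_1)

definition rcheb :: "nat \<Rightarrow> real poly" where
  "rcheb m = 2 * pcompose (cheb m) [:0, 1/2:]"

lemma poly_rcheb: "poly (rcheb m) x = 2 * poly (cheb m) (x / 2)"
  by (simp add: rcheb_def poly_pcompose)

lemma poly_rcheb_inverse:
  assumes "z \<noteq> (0::real)"
  shows "poly (rcheb m) (z + inverse z) = z ^ m + inverse z ^ m"
proof (induction m rule: induct_nat_012)
  case (ge2 m)
  have rec: "poly (rcheb (Suc (Suc m))) x = x * poly (rcheb (Suc m)) x - poly (rcheb m) x" for x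
    by (simp add: poly_rcheb cheb_Suc_Suc algebra_simps)
  define w where "w = inverse z"
  have zw: "z * w = 1" using assms by (simp add: w_def)
  have "poly (rcheb (Suc (Suc m))) (z + w) = (z + w) * (z ^ Suc m + w ^ Suc m) - (z ^ m + w ^ m)"
    using ge2 by (simp only: rec w_def)
  also have "\<dots> = z ^ Suc (Suc m) + w ^ Suc (Suc m) + (z * w - 1) * (z ^ m + w ^ m)"
    by (simp add: algebra_simps)
  finally show ?case using assms by (simp add: w_def)
qed (simp_all add: poly_rcheb cheb_0 cheb_1)

text \<open>
  Eigenvalues are counted with algebraic multiplicity. A real symmetric matrix of size \<open>n\<close>
  has only real eigenvalues, so for such \<open>B\<close> the sum has exactly \<open>n\<close> terms.
\<close>
definition spectral_trace :: "(real \<Rightarrow> real) \<Rightarrow> real mat \<Rightarrow> real" where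
  "spectral_trace f B = (\<Sum>x\<in>#proots (char_poly B). f x)"

definition zero_diag :: "real mat \<Rightarrow> real mat" where
  "zero_diag A = mat (dim_row A) (dim_col A) (\<lambda>(i, j). if i = j then 0 else A $$ (i, j))"

definition cheb_trace :: "nat \<Rightarrow> nat \<Rightarrow> real mat \<Rightarrow> real" where
  "cheb_trace n k A =
     spectral_trace (poly (rcheb k)) ((1 / sqrt (real n)) \<cdot>\<^sub>m zero_diag A)"

text \<open>
  The tuples \<open>(i\<^sub>0, \<dots>, i\<^bsub>k-1\<^esub>)\<close> of distinct indices are the injective functions
  from \<open>{0..<k}\<close> to \<open>{0..<n}\<close>; indices start at \<open>0\<close>, as is usual for the type of matrices.
\<close>
definition signed_cycle :: "nat \<Rightarrow> nat \<Rightarrow> real mat \<Rightarrow> real" where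
  "signed_cycle n k A =
     (1 / sqrt (real n)) ^ k *
     (\<Sum>i | i \<in> {0..<k} \<rightarrow>\<^sub>E {0..<n} \<and> inj_on i {0..<k}.
        \<Prod>j<k. A $$ (i j, i (Suc j mod k)))"

text \<open>The \<open>n\<close>-th random variable may live on its own probability space \<open>M n\<close>.\<close>
definition tendsto_in_prob :: "(nat \<Rightarrow> 'a measure) \<Rightarrow> (nat \<Rightarrow> 'a \<Rightarrow> real) \<Rightarrow> real \<Rightarrow> bool" where
  "tendsto_in_prob M X c \<longleftrightarrow>
     (\<forall>\<^sub>F n in sequentially. X n \<in> borel_measurable (M n)) \<and>
     (\<forall>\<epsilon>>0. (\<lambda>n. measure (M n) {\<omega> \<in> space (M n). \<bar>X n \<omega> - c\<bar> > \<epsilon>}) \<longlonglongrightarrow> 0)"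

end

theory Submission
  imports Defs
begin

text \<open>
  Let \<open>B\<close> be the rescaled matrix with zero diagonal and \<open>U\<^sub>a\<close> the Chebyshev polynomials of the second kind in
  \<open>x / 2\<close>, so that \<open>P\<^sub>k = U\<^sub>k - U\<^bsub>k-2\<^esub>\<close>. Let \<open>L\<close> be the Ornstein-Uhlenbeck generator in the Gaussian entries;
  it acts on the homogeneous Wiener chaos of order \<open>r\<close> as \<open>-r\<close>, and \<open>Tr P\<^sub>k(B)\<close> and \<open>C\<^bsub>n,k\<^esub>\<close> are polynomials
  of degree \<open>k\<close>. The quadratic identities between Chebyshev polynomials give
  \<open>(L + k) Tr P\<^sub>k(B) = k / n (\<Sum> Tr U\<^sub>a(B) Tr U\<^sub>b(B) + \<Sum> (Tr U\<^sub>a U\<^sub>b(B) - 2 \<Sum>\<^sub>i U\<^sub>a(B)\<^sub>i\<^sub>i U\<^sub>b(B)\<^sub>i\<^sub>i))\<close>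
  with \<open>a + b = k - 2\<close> and, crucially, \<open>a, b \<ge> 1\<close> in the first sum. For \<open>a \<ge> 1\<close> the trace of \<open>U\<^sub>a(B)\<close> is bounded in
  \<open>L\<^sup>2\<close>, by the Poincare inequality for its variance and by integration by parts for its mean, so that this remainder has
  variance of order \<open>n\<^sup>-\<^sup>1\<^sup>/\<^sup>2\<close>. On the chaoses of order \<open>r < k\<close> the operator \<open>L + k\<close> is multiplication by
  \<open>k - r \<ge> 1\<close>, hence they contribute as little to the variance of \<open>Tr P\<^sub>k(B) - C\<^bsub>n,k\<^esub>\<close>. The chaos of order \<open>k\<close> of
  this difference only comes from closed walks that revisit a vertex, and there are \<open>O(k\<^sup>2 n\<^bsup>k-1\<^esup>)\<close> of those. All
  constants are at most \<open>exp(c k\<^sup>2) = n\<^bsup>o(1)\<^esup>\<close>.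
\<close>

section \<open>The spectral theorem for real symmetric matrices\<close>

text \<open>Moments of a trace of growing degree usually call for a delicate count of pairs of
  closed walks. The operator \<open>L + k\<close> avoids it: it kills the chaos of order
  \<open>k\<close>, and what is left only has to be bounded, with wasteful constants. The
  restriction \<open>a, b \<ge> 1\<close> is decisive since \<open>Tr U_0 = n\<close>. The summands
  with \<open>a = 0\<close> or \<open>b = 0\<close> amount to \<open>2 Tr U_(k-2)\<close>, as large
  as the main term; they cancel against the drift \<open>-(Tr U_k + Tr U_(k-2))\<close> and
  \<open>Tr P_k\<close> itself, exactly because \<open>P_k = U_k - U_(k-2)\<close>. The remaining
  obstacle is the product of two traces: its variance involves fourth moments, while only second
  moments are known to be bounded. Interpolation with a trivial eighth moment bound yields order
  \<open>n^(3/2)\<close>, and division by \<open>n^2\<close> leaves the rate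
  \<open>n^(-1/2)\<close>. Expectation is an abstract functional on polynomial functions, known
  through linearity, positivity and integration by parts; measures appear only when Gaussian
  variables are shown to supply such a functional.\<close>

lemma real_eigenvector_exists:
  fixes C :: "nat \<Rightarrow> nat \<Rightarrow> real"
  assumes n: "n > 0" and sym: "\<And>i j. i < n \<Longrightarrow> j < n \<Longrightarrow> C i j = C j i"
  obtains v \<mu> where "(\<Sum>i<n. (v i)\<^sup>2) = 1" "\<And>i. i < n \<Longrightarrow> (\<Sum>j<n. C i j * v j) = \<mu> * v i"
proof -
  define M where "M = mat n n (\<lambda>(i, j). complex_of_real (C i j))"
  have M: "M \<in> carrier_mat n n" by (simp add: M_def)
  have "degree (char_poly M) = n" using degree_monic_char_poly[OF M] by simp
  hence "\<not> constant (poly (char_poly M))" using n by (simp add: constant_degree)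
  then obtain z where "poly (char_poly M) z = 0"
    using fundamental_theorem_of_algebra by blast
  hence "eigenvalue M z" using eigenvalue_root_char_poly[OF M] by simp
  then obtain x where x: "x \<in> carrier_vec n" "x \<noteq> 0\<^sub>v n" and Mx: "M *\<^sub>v x = z \<cdot>\<^sub>v x"
    unfolding eigenvalue_def eigenvector_def using M by auto
  define w where "w = (\<lambda>i. x $ i)"
  have eig: "(\<Sum>j<n. of_real (C i j) * w j) = z * w i" if "i < n" for i
  proof -
    have "(M *\<^sub>v x) $ i = (z \<cdot>\<^sub>v x) $ i" by (simp add: Mx)
    thus ?thesis using that x(1)
      by (simp add: M_def scalar_prod_def w_def atLeast0LessThan)
  qed
  have nz: "\<exists>i<n. w i \<noteq> 0"
    using x unfolding w_def by (metis carrier_vecD eq_vecI index_zero_vec(1) index_zero_vec(2))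
  define S where "S = (\<Sum>i<n. (cmod (w i))\<^sup>2)"
  have S: "S > 0"
    unfolding S_def using nz by (auto intro!: sum_pos2)
  \<comment> \<open>Up to the squared norm of \<open>w\<close>, the eigenvalue is the Hermitian form
    of \<open>C\<close> at \<open>w\<close>. As \<open>C\<close> is real and symmetric, this form
    equals its own conjugate, so \<open>z\<close> is real.\<close>
  have zS: "z * of_real S = (\<Sum>i<n. cnj (w i) * (\<Sum>j<n. of_real (C i j) * w j))"
    unfolding S_def of_real_sum sum_distrib_left[of z]
    by (intro sum.cong refl) (simp only: lessThan_iff eig complex_norm_square, simp only: mult_ac)
  note zS
  also have "(\<Sum>i<n. cnj (w i) * (\<Sum>j<n. of_real (C i j) * w j)) = (\<Sum>i<n. \<Sum>j<n. of_real (C i j) * w j * cnj (w i))"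
    by (simp add: sum_distrib_left mult_ac)
  also have "\<dots> = (\<Sum>j<n. \<Sum>i<n. of_real (C j i) * w j * cnj (w i))"
    by (subst sum.swap) (intro sum.cong refl, simp add: sym)
  also have "\<dots> = cnj (\<Sum>i<n. \<Sum>j<n. of_real (C i j) * w j * cnj (w i))"
    by (simp add: mult_ac)
  also have "(\<Sum>i<n. \<Sum>j<n. of_real (C i j) * w j * cnj (w i)) = (\<Sum>i<n. cnj (w i) * (\<Sum>j<n. of_real (C i j) * w j))"
    by (simp add: sum_distrib_left mult_ac)
  also note zS[symmetric]
  finally have "z = cnj z" using S by simp
  hence zr: "z = of_real (Re z)" by (simp add: complex_eq_iff)
  \<comment> \<open>With \<open>z\<close> real, the eigenvalue equation splits into real and
    imaginary parts, and at least one of the two vectors is nonzero.\<close>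
  obtain u where u: "\<exists>i<n. u i \<noteq> 0" "\<And>i. i < n \<Longrightarrow> (\<Sum>j<n. C i j * u j) = Re z * u i"
  proof (cases "\<exists>i<n. Re (w i) \<noteq> 0")
    case True
    moreover have "(\<Sum>j<n. C i j * Re (w j)) = Re z * Re (w i)" if "i < n" for i
      using arg_cong[OF eig[OF that], of Re] by (subst (asm) zr) simp
    ultimately show ?thesis by (intro that[of "\<lambda>i. Re (w i)"])
  next
    case False
    with nz have "\<exists>i<n. Im (w i) \<noteq> 0" by (metis complex_eqI zero_complex.sel)
    moreover have "(\<Sum>j<n. C i j * Im (w j)) = Re z * Im (w i)" if "i < n" for i
      using arg_cong[OF eig[OF that], of Im] by (subst (asm) zr) simp
    ultimately show ?thesis by (intro that[of "\<lambda>i. Im (w i)"])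
  qed
  define T where "T = (\<Sum>i<n. (u i)\<^sup>2)"
  have T: "T > 0" unfolding T_def using u(1) by (auto intro!: sum_pos2)
  show ?thesis
  proof (rule that[of "\<lambda>i. u i / sqrt T" "Re z"])
    show "(\<Sum>i<n. (u i / sqrt T)\<^sup>2) = 1"
      using T by (simp add: power_divide T_def flip: sum_divide_distrib)
    show "(\<Sum>j<n. C i j * (u j / sqrt T)) = Re z * (u i / sqrt T)" if "i < n" for i
      using u(2)[OF that] by (simp flip: sum_divide_distrib)
  qed
qed

section \<open>Orthogonal diagonalisation by Householder reflections\<close>

definition \<delta> :: "nat \<Rightarrow> nat \<Rightarrow> real" where "\<delta> i j = (if i = j then 1 else 0)"

lemma sum_delta_mult [simp]:
  assumes "i < (n::nat)"
  shows "(\<Sum>l<n. \<delta> i l * f l) = f i" "(\<Sum>l<n. f l * \<delta> i l) = f i"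
    "(\<Sum>l<n. \<delta> l i * f l) = f i" "(\<Sum>l<n. f l * \<delta> l i) = f i"
  using assms by (simp_all add: \<delta>_def if_distrib[of "\<lambda>x. x * _"] if_distrib[of "\<lambda>x. _ * x"] sum.delta sum.delta' cong: if_cong)

text \<open>\<open>v l\<close> is the eigenvector for \<open>lam l\<close>. Completeness and
  orthonormality are both recorded, so that no argument about inverses is needed: the former makes
  the constant function 1 the identity matrix, the latter makes matrix products pointwise.\<close>

definition is_eigensystem :: "nat \<Rightarrow> (nat \<Rightarrow> nat \<Rightarrow> real) \<Rightarrow> (nat \<Rightarrow> real) \<Rightarrow> (nat \<Rightarrow> nat \<Rightarrow> real) \<Rightarrow> bool" where
  "is_eigensystem n C lam v \<longleftrightarrow>
     (\<forall>i<n. \<forall>j<n. C i j = (\<Sum>l<n. lam l * v l i * v l j)) \<and>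
     (\<forall>i<n. \<forall>j<n. (\<Sum>l<n. v l i * v l j) = \<delta> i j) \<and>
     (\<forall>l<n. \<forall>m<n. (\<Sum>i<n. v l i * v m i) = \<delta> l m)"

text \<open>The identity for \<open>u = 0\<close>, because \<open>2 / 0 = 0\<close>.\<close>
definition householder :: "nat \<Rightarrow> (nat \<Rightarrow> real) \<Rightarrow> nat \<Rightarrow> nat \<Rightarrow> real" where
  "householder n u i j = \<delta> i j - 2 / (\<Sum>l<n. (u l)\<^sup>2) * u i * u j"

lemma householder_sym: "householder n u i j = householder n u j i"
  by (simp add: householder_def \<delta>_def)

lemma householder_involution:
  assumes "i < n" "j < n"
  shows "(\<Sum>l<n. householder n u i l * householder n u l j) = \<delta> i j"
proof -
  define T where "T = (\<Sum>l<n. (u l)\<^sup>2)"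
  have "(\<Sum>l<n. householder n u i l * householder n u l j)
      = (\<Sum>l<n. \<delta> i l * \<delta> l j - 2 / T * u i * (u l * \<delta> l j) - 2 / T * u j * (\<delta> i l * u l) + (2 / T)\<^sup>2 * u i * u j * (u l)\<^sup>2)"
    unfolding householder_def T_def[symmetric] by (intro sum.cong refl) (simp add: algebra_simps power2_eq_square)
  also have "\<dots> = \<delta> i j - 2 / T * u i * u j - 2 / T * u j * u i + (2 / T)\<^sup>2 * u i * u j * T"
    using assms by (simp only: sum.distrib sum_subtractf sum_distrib_left[symmetric] sum_delta_mult T_def[symmetric])
  also have "\<dots> = \<delta> i j" by (cases "T = 0") (simp_all add: power2_eq_square field_simps)
  finally show ?thesis .
qed

text \<open>The reflection along \<open>v - e_0\<close> interchanges the two unit vectors. It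
  completes \<open>v\<close> to an orthonormal basis without a Gram-Schmidt process; if
  \<open>v = e_0\<close>, the matrix is the identity and the claim still holds.\<close>

lemma householder_first_column:
  assumes n: "n > 0" and v: "(\<Sum>i<n. (v i)\<^sup>2) = 1" and i: "i < n"
  shows "householder n (\<lambda>i. v i - \<delta> i 0) i 0 = v i"
proof -
  define u where "u = (\<lambda>i. v i - \<delta> i 0)"
  define T where "T = (\<Sum>l<n. (u l)\<^sup>2)"
  have "T = (\<Sum>l<n. (v l)\<^sup>2 - 2 * (v l * \<delta> l 0) + \<delta> l 0 * \<delta> l 0)"
    unfolding T_def u_def by (intro sum.cong refl) (simp add: algebra_simps power2_eq_square)
  also have "\<dots> = 2 - 2 * v 0"
    using n v by (simp add: sum.distrib sum_subtractf flip: sum_distrib_left) (simp add: \<delta>_def)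
  finally have T: "T = 2 - 2 * v 0" .
  show ?thesis
  proof (cases "T = 0")
    case True
    hence "u i = 0" using i unfolding T_def by (subst (asm) sum_nonneg_eq_0_iff) auto
    with True show ?thesis by (simp add: householder_def u_def)
  next
    case False
    hence "2 / T * u 0 = -1" using T by (simp add: u_def \<delta>_def field_simps)
    hence "2 / T * u i * u 0 = - u i" by (metis mult.commute mult.left_commute mult_minus1_right)
    thus ?thesis by (simp add: householder_def u_def[symmetric] T_def[symmetric]) (simp add: u_def)
  qed
qed

text \<open>A symmetric involution is orthogonal, so it carries eigenvectors of \<open>H C H\<close>
  to eigenvectors of \<open>C\<close> and preserves both orthogonality relations.\<close>

lemma eigensystem_conj:
  assumes H: "\<And>i j. i < n \<Longrightarrow> j < n \<Longrightarrow> (\<Sum>l<n. H i l * H l j) = \<delta> i j" and Hs: "\<And>i j. H i j = H j i"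
    and C': "\<And>i j. i < n \<Longrightarrow> j < n \<Longrightarrow> (\<Sum>p<n. \<Sum>q<n. H i p * C p q * H q j) = (C' i j :: real)"
    and e: "is_eigensystem n C' lam y"
  shows "is_eigensystem n C lam (\<lambda>l i. \<Sum>j<n. H i j * y l j)"
proof -
  have e1: "\<And>i j. i < n \<Longrightarrow> j < n \<Longrightarrow> C' i j = (\<Sum>l<n. lam l * y l i * y l j)"
   and e2: "\<And>i j. i < n \<Longrightarrow> j < n \<Longrightarrow> (\<Sum>l<n. y l i * y l j) = \<delta> i j"
   and e3: "\<And>i j. i < n \<Longrightarrow> j < n \<Longrightarrow> (\<Sum>l<n. y i l * y j l) = \<delta> i j"
    using e unfolding is_eigensystem_def by auto
  have gen: "(\<Sum>l<n. c l * (\<Sum>p<n. H i p * y l p) * (\<Sum>q<n. H j q * y l q))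
     = (\<Sum>p<n. \<Sum>q<n. H i p * (\<Sum>l<n. c l * y l p * y l q) * H j q)" for i j c
  proof -
    have "(\<Sum>l<n. c l * (\<Sum>p<n. H i p * y l p) * (\<Sum>q<n. H j q * y l q))
       = (\<Sum>l<n. \<Sum>p<n. \<Sum>q<n. H i p * (c l * y l p * y l q) * H j q)"
      by (simp add: sum_distrib_left sum_distrib_right mult_ac)
    also have "\<dots> = (\<Sum>p<n. \<Sum>l<n. \<Sum>q<n. H i p * (c l * y l p * y l q) * H j q)"
      by (rule sum.swap)
    also have "\<dots> = (\<Sum>p<n. \<Sum>q<n. \<Sum>l<n. H i p * (c l * y l p * y l q) * H j q)"
      by (intro sum.cong refl sum.swap)
    finally show ?thesis by (simp add: sum_distrib_left sum_distrib_right)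
  qed
  have "C i j = (\<Sum>l<n. lam l * (\<Sum>p<n. H i p * y l p) * (\<Sum>q<n. H j q * y l q))" if "i < n" "j < n" for i j
  proof -
    have "(\<Sum>l<n. lam l * (\<Sum>p<n. H i p * y l p) * (\<Sum>q<n. H j q * y l q))
       = (\<Sum>p<n. \<Sum>q<n. H i p * C' p q * H j q)"
      unfolding gen by (intro sum.cong refl) (simp add: e1)
    also have "\<dots> = (\<Sum>p<n. \<Sum>q<n. H i p * (\<Sum>a<n. \<Sum>b<n. H p a * C a b * H b q) * H j q)"
      by (intro sum.cong refl) (simp add: C')
    also have "\<dots> = (\<Sum>p<n. \<Sum>q<n. \<Sum>a<n. \<Sum>b<n. (H i p * H p a) * (C a b * (H b q * H q j)))"
      by (simp add: sum_distrib_left sum_distrib_right mult_ac Hs[of _ j])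
    also have "\<dots> = (\<Sum>p<n. \<Sum>a<n. \<Sum>b<n. \<Sum>q<n. (H i p * H p a) * (C a b * (H b q * H q j)))"
      by (subst sum.swap, subst (2) sum.swap) (rule refl)
    also have "\<dots> = (\<Sum>p<n. \<Sum>a<n. \<Sum>b<n. (H i p * H p a) * (C a b * \<delta> b j))"
      using that by (simp add: H flip: sum_distrib_left)
    also have "\<dots> = (\<Sum>p<n. \<Sum>a<n. (H i p * H p a) * C a j)"
      using that by (simp flip: sum_distrib_left)
    also have "\<dots> = (\<Sum>a<n. \<Sum>p<n. (H i p * H p a) * C a j)" by (rule sum.swap)
    also have "\<dots> = C i j" using that by (simp add: H flip: sum_distrib_right)
    finally show ?thesis ..
  qed
  moreover have "(\<Sum>l<n. (\<Sum>p<n. H i p * y l p) * (\<Sum>q<n. H j q * y l q)) = \<delta> i j" if "i < n" "j < n" for i j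
  proof -
    have "(\<Sum>l<n. (\<Sum>p<n. H i p * y l p) * (\<Sum>q<n. H j q * y l q)) = (\<Sum>p<n. \<Sum>q<n. H i p * \<delta> p q * H j q)"
      using gen[of "\<lambda>_. 1" i j] by (simp add: e2)
    also have "\<dots> = (\<Sum>p<n. H i p * H p j)"
      by (simp add: mult.assoc Hs[of j] flip: sum_distrib_left)
    finally show ?thesis using that by (simp add: H)
  qed
  moreover have "(\<Sum>i<n. (\<Sum>p<n. H i p * y l p) * (\<Sum>q<n. H i q * y m q)) = \<delta> l m" if "l < n" "m < n" for l m
  proof -
    have "(\<Sum>i<n. (\<Sum>p<n. H i p * y l p) * (\<Sum>q<n. H i q * y m q))
       = (\<Sum>i<n. \<Sum>p<n. \<Sum>q<n. (H p i * H i q) * (y l p * y m q))"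
      unfolding sum_product by (intro sum.cong refl) (subst Hs, simp only: mult_ac)
    also have "\<dots> = (\<Sum>p<n. \<Sum>i<n. \<Sum>q<n. (H p i * H i q) * (y l p * y m q))" by (rule sum.swap)
    also have "\<dots> = (\<Sum>p<n. \<Sum>q<n. \<Sum>i<n. (H p i * H i q) * (y l p * y m q))" by (intro sum.cong refl sum.swap)
    also have "\<dots> = (\<Sum>p<n. \<Sum>q<n. \<delta> p q * (y l p * y m q))"
      by (intro sum.cong refl) (simp add: H flip: sum_distrib_right)
    also have "\<dots> = \<delta> l m" using that by (simp add: e3)
    finally show ?thesis .
  qed
  ultimately show ?thesis unfolding is_eigensystem_def by blast
qed

text \<open>Deflation: in a basis whose first vector is a unit eigenvector, the first row and column
  vanish off the diagonal, and induction applies to the remaining block.\<close>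

lemma eigensystem_exists:
  assumes "\<And>i j. i < n \<Longrightarrow> j < n \<Longrightarrow> C i j = C j i"
  shows "\<exists>lam v. is_eigensystem n C lam v"
  using assms
proof (induction n arbitrary: C)
  case 0
  show ?case by (simp add: is_eigensystem_def)
next
  case (Suc n)
  obtain v \<mu> where v: "(\<Sum>i<Suc n. (v i)\<^sup>2) = 1" 
    and ev: "\<And>i. i < Suc n \<Longrightarrow> (\<Sum>j<Suc n. C i j * v j) = \<mu> * v i"
    using real_eigenvector_exists[of "Suc n" C] Suc.prems by auto
  define H where "H = householder (Suc n) (\<lambda>i. v i - \<delta> i 0)"
  have Hs: "H i j = H j i" for i j unfolding H_def by (rule householder_sym)
  have HH: "(\<Sum>l<Suc n. H i l * H l j) = \<delta> i j" if "i < Suc n" "j < Suc n" for i j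
    unfolding H_def using that by (rule householder_involution)
  have H0: "H i 0 = v i" if "i < Suc n" for i
    unfolding H_def using v that by (intro householder_first_column) auto
  define C' where "C' i j = (\<Sum>p<Suc n. \<Sum>q<Suc n. H i p * C p q * H q j)" for i j
  have C's: "C' i j = C' j i" for i j
  proof -
    have "C' i j = (\<Sum>q<Suc n. \<Sum>p<Suc n. H i p * C p q * H q j)" unfolding C'_def by (rule sum.swap)
    also have "\<dots> = C' j i" unfolding C'_def
      by (intro sum.cong refl) (simp add: Hs[of i] Hs[of _ j] Suc.prems mult_ac)
    finally show ?thesis .
  qed
  have C'0: "C' i 0 = \<mu> * \<delta> i 0" if "i < Suc n" for i
  proof -
    have "C' i 0 = (\<Sum>p<Suc n. H i p * (\<Sum>q<Suc n. C p q * v q))"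
      unfolding C'_def by (simp add: H0 sum_distrib_left mult.assoc del: sum.lessThan_Suc)
    also have "\<dots> = (\<Sum>p<Suc n. \<mu> * (H i p * H p 0))"
      by (intro sum.cong refl) (simp add: ev H0 del: sum.lessThan_Suc)
    also have "\<dots> = \<mu> * \<delta> i 0" using that by (subst sum_distrib_left[symmetric]) (simp add: HH del: sum.lessThan_Suc)
    finally show ?thesis .
  qed
  obtain mu w where w: "is_eigensystem n (\<lambda>i j. C' (Suc i) (Suc j)) mu w"
    using Suc.IH[of "\<lambda>i j. C' (Suc i) (Suc j)"] C's by blast
  \<comment> \<open>Index 0 carries the eigenvector just split off, which is \<open>e_0\<close> in
    the rotated basis; the vectors of the block are padded with a leading 0.\<close>
  define lam where "lam = case_nat \<mu> mu"
  define y where "y = case_nat (\<lambda>i. \<delta> i 0) (\<lambda>l. case_nat 0 (w l))"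
  have "is_eigensystem (Suc n) C' lam y"
    unfolding is_eigensystem_def
  proof (intro conjI allI impI)
    fix i j assume ij: "i < Suc n" "j < Suc n"
    show "C' i j = (\<Sum>l<Suc n. lam l * y l i * y l j)"
      unfolding sum.lessThan_Suc_shift
      using ij w C'0 C's[of 0 j] unfolding lam_def y_def is_eigensystem_def
      by (cases i; cases j) (simp_all add: \<delta>_def)
    show "(\<Sum>l<Suc n. y l i * y l j) = \<delta> i j"
      unfolding sum.lessThan_Suc_shift
      using ij w unfolding y_def is_eigensystem_def by (cases i; cases j) (simp_all add: \<delta>_def)
    show "(\<Sum>l<Suc n. y i l * y j l) = \<delta> i j"
      unfolding sum.lessThan_Suc_shift
      using ij w unfolding y_def is_eigensystem_def by (cases i; cases j) (simp_all add: \<delta>_def)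
  qed
  from eigensystem_conj[OF HH Hs C'_def[symmetric] this] show ?case by blast
qed

text \<open>Similarity to the diagonal matrix of \<open>lam\<close> turns the characteristic
  polynomial into a product of linear factors, whose roots with multiplicity are the values of
  \<open>lam\<close>. From here on spectral traces are sums over \<open>lam\<close>.\<close>

lemma spectral_trace_eigensystem:
  assumes e: "is_eigensystem n C lam v"
  shows "spectral_trace f (mat n n (\<lambda>(i, j). C i j)) = (\<Sum>l<n. f (lam l))"
proof -
  define M where "M = mat n n (\<lambda>(i, j). C i j)"
  define D where "D = mat n n (\<lambda>(i, j). if i = j then lam i else 0)"
  define P where "P = mat n n (\<lambda>(i, l). v l i)"
  define Q where "Q = mat n n (\<lambda>(l, i). v l i)"
  have car: "M \<in> carrier_mat n n" "D \<in> carrier_mat n n" "P \<in> carrier_mat n n" "Q \<in> carrier_mat n n"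
    by (simp_all add: M_def D_def P_def Q_def)
  have PD: "P * D = mat n n (\<lambda>(i, l). lam l * v l i)"
    by (rule eq_matI) (auto simp: P_def D_def scalar_prod_def if_distrib cong: if_cong)
  have "P * Q = 1\<^sub>m n" "Q * P = 1\<^sub>m n" "M = P * D * Q"
    unfolding PD using e by (auto intro!: eq_matI simp: P_def Q_def M_def scalar_prod_def is_eigensystem_def \<delta>_def atLeast0LessThan)
  hence "similar_mat M D"
    using car unfolding similar_mat_def by (intro exI[of _ P] exI[of _ Q] similar_mat_witI[of _ _ n]) auto
  hence "char_poly M = char_poly D" by (rule char_poly_similar)
  also have "\<dots> = (\<Prod>a\<leftarrow>diag_mat D. [:- a, 1:])"
    by (rule char_poly_upper_triangular[OF car(2)]) (auto simp: D_def)
  also have "diag_mat D = map lam [0..<n]" by (auto simp: diag_mat_def D_def)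
  finally have cp: "char_poly M = (\<Prod>a\<leftarrow>map lam [0..<n]. [:- a, 1:])" .
  have "proots (\<Prod>a\<leftarrow>xs. [:- a, 1:]) = mset (xs :: real list)" for xs
  proof (induction xs)
    case (Cons x xs)
    have "(\<Prod>a\<leftarrow>xs. [:- a, 1:]) \<noteq> 0" by (auto simp: prod_list_zero_iff)
    thus ?case using Cons by (simp add: proots_mult del: mult_pCons_left)
  qed simp
  hence "proots (char_poly M) = mset (map lam [0..<n])" unfolding cp .
  thus ?thesis unfolding spectral_trace_def M_def[symmetric]
    by (simp add: image_mset.compositionality comp_def sum_unfold_sum_mset atLeast0LessThan)
qed

section \<open>Polynomials in independent Gaussian variables\<close>

text \<open>The bound is strict, so that \<open>deg_lt E 0\<close> contains only the zero function.\<close>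
inductive deg_lt :: "'e set \<Rightarrow> nat \<Rightarrow> (('e \<Rightarrow> real) \<Rightarrow> real) \<Rightarrow> bool" for E where
  deg_lt_zero: "deg_lt E 0 (\<lambda>x. 0)"
| deg_lt_const: "deg_lt E (Suc d) (\<lambda>x. c)"
| deg_lt_var: "e \<in> E \<Longrightarrow> deg_lt E d f \<Longrightarrow> deg_lt E (Suc d) (\<lambda>x. x e * f x)"
| deg_lt_add: "deg_lt E d f \<Longrightarrow> deg_lt E d g \<Longrightarrow> deg_lt E d (\<lambda>x. f x + g x)"

lemma deg_lt_0D: "deg_lt E 0 f \<Longrightarrow> f = (\<lambda>x. 0)"
  by (induction "0::nat" f rule: deg_lt.induct) auto

lemma deg_lt_0: "deg_lt E d (\<lambda>x. 0)"
  by (cases d) (auto intro: deg_lt_zero deg_lt_const)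

lemma deg_lt_1D: "deg_lt E (Suc 0) f \<Longrightarrow> \<exists>c. f = (\<lambda>x. c)"
  by (induction "Suc 0" f rule: deg_lt.induct) (auto dest!: deg_lt_0D)

lemma deg_lt_Suc: "deg_lt E d f \<Longrightarrow> deg_lt E (Suc d) f"
  by (induction rule: deg_lt.induct) (auto intro: deg_lt.intros)

lemma deg_lt_mono: "deg_lt E d f \<Longrightarrow> d \<le> d' \<Longrightarrow> deg_lt E d' f"
  by (rotate_tac, induction d' rule: dec_induct) (auto intro: deg_lt_Suc)

lemma deg_lt_cmult: "deg_lt E d f \<Longrightarrow> deg_lt E d (\<lambda>x. c * f x)"
proof (induction rule: deg_lt.induct)
  case (deg_lt_var e d f)
  have "(\<lambda>x. c * (x e * f x)) = (\<lambda>x. x e * (c * f x))" by (simp add: mult_ac)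
  thus ?case using deg_lt_var by (simp add: deg_lt.deg_lt_var)
next
  case (deg_lt_add d f g)
  thus ?case by (simp add: distrib_left deg_lt.deg_lt_add)
qed (auto intro: deg_lt.intros)

lemma deg_lt_diff: "deg_lt E d f \<Longrightarrow> deg_lt E d g \<Longrightarrow> deg_lt E d (\<lambda>x. f x - g x)"
  using deg_lt_add[OF _ deg_lt_cmult[of E d g "-1"], of f] by simp

lemma deg_lt_sum: "(\<And>i. i \<in> I \<Longrightarrow> deg_lt E d (f i)) \<Longrightarrow> deg_lt E d (\<lambda>x. \<Sum>i\<in>I. f i x)"
  by (induction I rule: infinite_finite_induct) (auto intro: deg_lt_0 deg_lt_add)

text \<open>Strict bounds \<open>d\<close> and \<open>d' + 1\<close> mean degrees at most
  \<open>d - 1\<close> and \<open>d'\<close>. The asymmetric form also covers \<open>d = 0\<close>,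
  where the product is zero.\<close>

lemma deg_lt_mult:
  "deg_lt E d f \<Longrightarrow> deg_lt E (Suc d') g \<Longrightarrow> deg_lt E (d + d') (\<lambda>x. f x * g x)"
proof (induction rule: deg_lt.induct)
  case (deg_lt_const d c)
  thus ?case by (auto intro: deg_lt_cmult deg_lt_mono)
next
  case (deg_lt_var e d f)
  thus ?case by (simp add: mult.assoc deg_lt.deg_lt_var)
next
  case (deg_lt_add d f g)
  thus ?case by (simp add: distrib_right deg_lt.deg_lt_add)
qed (simp add: deg_lt_0)

definition polyfun :: "'e set \<Rightarrow> (('e \<Rightarrow> real) \<Rightarrow> real) \<Rightarrow> bool" where
  "polyfun E f \<longleftrightarrow> (\<exists>d. deg_lt E d f)"

lemma deg_lt_imp_polyfun: "deg_lt E d f \<Longrightarrow> polyfun E f"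
  by (auto simp: polyfun_def)

lemma polyfun_const: "polyfun E (\<lambda>x. c)"
  unfolding polyfun_def by (blast intro: deg_lt_const)

lemma deg_lt_coord: "e \<in> E \<Longrightarrow> deg_lt E (Suc (Suc 0)) (\<lambda>x. x e)"
  using deg_lt_var[of e E "Suc 0" "\<lambda>x. 1"] by (simp add: deg_lt_const)

lemma polyfun_coord: "e \<in> E \<Longrightarrow> polyfun E (\<lambda>x. x e)"
  by (rule deg_lt_imp_polyfun[OF deg_lt_coord])

lemma polyfun_add: "polyfun E f \<Longrightarrow> polyfun E g \<Longrightarrow> polyfun E (\<lambda>x. f x + g x)"
  unfolding polyfun_def by (elim exE) (rule exI, rule deg_lt_add; erule deg_lt_mono, rule max.cobounded1 max.cobounded2)

lemma polyfun_mult: "polyfun E f \<Longrightarrow> polyfun E g \<Longrightarrow> polyfun E (\<lambda>x. f x * g x)"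
  unfolding polyfun_def by (elim exE) (rule exI, erule deg_lt_mult, erule deg_lt_Suc)

lemma polyfun_uminus: "polyfun E f \<Longrightarrow> polyfun E (\<lambda>x. - f x)"
  using polyfun_mult[OF polyfun_const[of E "-1"], of f] by simp

lemma polyfun_diff: "polyfun E f \<Longrightarrow> polyfun E g \<Longrightarrow> polyfun E (\<lambda>x. f x - g x)"
  using polyfun_add[OF _ polyfun_uminus[of E g], of f] by simp

lemma polyfun_divide: "polyfun E f \<Longrightarrow> polyfun E (\<lambda>x. f x / c)"
  using polyfun_mult[OF _ polyfun_const[of E "1 / c"], of f] by simp

lemma polyfun_power: "polyfun E f \<Longrightarrow> polyfun E (\<lambda>x. f x ^ m)"
  by (induction m) (auto intro: polyfun_const polyfun_mult)

lemma polyfun_sum: "(\<And>i. i \<in> I \<Longrightarrow> polyfun E (f i)) \<Longrightarrow> polyfun E (\<lambda>x. \<Sum>i\<in>I. f i x)"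
  by (induction I rule: infinite_finite_induct) (auto intro: polyfun_const polyfun_add)

lemma polyfun_prod: "(\<And>i. i \<in> I \<Longrightarrow> polyfun E (f i)) \<Longrightarrow> polyfun E (\<lambda>x. \<Prod>i\<in>I. f i x)"
  by (induction I rule: infinite_finite_induct) (auto intro: polyfun_const polyfun_mult)

section \<open>Partial derivatives of polynomial functions\<close>

definition pd :: "'e \<Rightarrow> (('e \<Rightarrow> real) \<Rightarrow> real) \<Rightarrow> ('e \<Rightarrow> real) \<Rightarrow> real" where
  "pd e f x = deriv (\<lambda>t. f (x(e := t))) (x e)"

lemma DERIV_coord: "((\<lambda>t. (x(e := t)) e') has_field_derivative (if e = e' then 1 else 0)) (at t)"
  by (cases "e = e'") (auto intro: derivative_eq_intros)

lemma deg_lt_differentiable: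
  "deg_lt E d f \<Longrightarrow> (\<lambda>t. f (x(e := t))) field_differentiable (at t)"
proof (induction rule: deg_lt.induct)
  case (deg_lt_var e' d f)
  have "(\<lambda>t. (x(e := t)) e') field_differentiable (at t)"
    unfolding field_differentiable_def by (rule exI) (rule DERIV_coord)
  thus ?case using deg_lt_var by (intro field_differentiable_mult)
qed (auto intro: field_differentiable_add)

lemma pd_DERIV:
  "polyfun E f \<Longrightarrow> ((\<lambda>t. f (x(e := t))) has_field_derivative pd e f x) (at (x e))"
  unfolding polyfun_def pd_def by (elim exE) (simp add: DERIV_deriv_iff_field_differentiable deg_lt_differentiable)

lemma pd_eqI: "(\<And>x. ((\<lambda>t. f (x(e := t))) has_field_derivative f' x) (at (x e))) \<Longrightarrow> pd e f = f'"
  unfolding pd_def by (intro ext DERIV_imp_deriv)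

lemma pd_const: "pd e (\<lambda>x. c) = (\<lambda>x. 0)"
  by (rule pd_eqI) simp

lemma pd_coord: "pd e (\<lambda>x. x e') = (\<lambda>x. if e = e' then 1 else 0)"
  by (rule pd_eqI) (rule DERIV_coord)

lemma pd_add: "polyfun E f \<Longrightarrow> polyfun E g \<Longrightarrow> pd e (\<lambda>x. f x + g x) = (\<lambda>x. pd e f x + pd e g x)"
  by (rule pd_eqI) (auto intro!: DERIV_add pd_DERIV)

lemma pd_mult: "polyfun E f \<Longrightarrow> polyfun E g \<Longrightarrow>
    pd e (\<lambda>x. f x * g x) = (\<lambda>x. pd e f x * g x + f x * pd e g x)"
proof (rule pd_eqI)
  fix x assume "polyfun E f" "polyfun E g"
  from DERIV_mult[OF this[THEN pd_DERIV, of x e]]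
  show "((\<lambda>t. f (x(e := t)) * g (x(e := t))) has_field_derivative pd e f x * g x + f x * pd e g x) (at (x e))"
    by (simp add: mult.commute)
qed

lemma pd_cmult: "polyfun E f \<Longrightarrow> pd e (\<lambda>x. c * f x) = (\<lambda>x. c * pd e f x)"
  using pd_mult[OF polyfun_const[of E c], of f e] by (simp add: pd_const)

lemma pd_diff: "polyfun E f \<Longrightarrow> polyfun E g \<Longrightarrow> pd e (\<lambda>x. f x - g x) = (\<lambda>x. pd e f x - pd e g x)"
  by (rule pd_eqI) (auto intro!: DERIV_diff pd_DERIV)

lemma pd_sum: "(\<And>i. i \<in> I \<Longrightarrow> polyfun E (f i)) \<Longrightarrow> pd e (\<lambda>x. \<Sum>i\<in>I. f i x) = (\<lambda>x. \<Sum>i\<in>I. pd e (f i) x)"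
  by (rule pd_eqI) (auto intro!: DERIV_sum pd_DERIV)

text \<open>Truncated subtraction is right here: a function with bound 0 is zero and one with bound
  1 is constant, and both have derivative zero.\<close>

lemma deg_lt_pd: "deg_lt E d f \<Longrightarrow> deg_lt E (d - 1) (pd e f)"
proof (induction rule: deg_lt.induct)
  case (deg_lt_var e' d f)
  have "pd e (\<lambda>x. x e' * f x) = (\<lambda>x. (if e = e' then 1 else 0) * f x + x e' * pd e f x)"
    using deg_lt_var by (subst pd_mult[of E]) (auto intro: polyfun_coord deg_lt_imp_polyfun simp: pd_coord)
  moreover have "deg_lt E d (\<lambda>x. x e' * pd e f x)"
  proof (cases d)
    case 0
    thus ?thesis using deg_lt_0D[of E f] deg_lt_var by (simp add: pd_const deg_lt_0)
  next
    case (Suc d')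
    thus ?thesis using deg_lt_var by (auto intro: deg_lt.deg_lt_var)
  qed
  ultimately show ?case using deg_lt_var by (auto intro!: deg_lt_add deg_lt_cmult)
next
  case (deg_lt_add d f g)
  thus ?case by (subst pd_add[of E]) (auto intro: deg_lt.deg_lt_add deg_lt_imp_polyfun)
qed (auto simp: pd_const deg_lt_0)

lemma polyfun_pd: "polyfun E f \<Longrightarrow> polyfun E (pd e f)"
  unfolding polyfun_def by (elim exE) (rule exI, erule deg_lt_pd)

lemmas polyfun_intros = polyfun_const polyfun_coord polyfun_add polyfun_mult polyfun_uminus
  polyfun_diff polyfun_divide polyfun_power polyfun_sum polyfun_prod polyfun_pd

text \<open>Induction on the construction of the polynomial replaces Schwarz's theorem on mixed
  derivatives.\<close>

lemma pd_commute: "polyfun E f \<Longrightarrow> pd e (pd e' f) = pd e' (pd e f)"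
proof -
  assume "polyfun E f"
  then obtain d where "deg_lt E d f" by (auto simp: polyfun_def)
  thus ?thesis
  proof (induction rule: deg_lt.induct)
    case (deg_lt_var a d f)
    have f: "polyfun E f" using deg_lt_var by (auto simp: polyfun_def)
    have "pd e (\<lambda>x. x a * f x) = (\<lambda>x. (if e = a then 1 else 0) * f x + x a * pd e f x)" for e
      using f deg_lt_var by (subst pd_mult[of E]) (auto intro: polyfun_coord simp: pd_coord)
    moreover have "pd e (\<lambda>x. c * f x + x a * pd e' f x) = (\<lambda>x. c * pd e f x + ((if e = a then 1 else 0) * pd e' f x + x a * pd e (pd e' f) x))" for c e e'
      using f deg_lt_var by (simp add: pd_add[of E] pd_mult[of E _ "pd _ _"] pd_cmult[of E] pd_coord polyfun_intros)
    ultimately show ?case using deg_lt_var by (auto simp: fun_eq_iff)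
  next
    case (deg_lt_add d f g)
    thus ?case by (simp add: pd_add[of E] polyfun_intros deg_lt_imp_polyfun)
  qed (simp_all add: pd_const)
qed

text \<open>The Ornstein-Uhlenbeck generator.\<close>
definition OU :: "'e set \<Rightarrow> (('e \<Rightarrow> real) \<Rightarrow> real) \<Rightarrow> ('e \<Rightarrow> real) \<Rightarrow> real" where
  "OU E f x = (\<Sum>e\<in>E. pd e (pd e f) x - x e * pd e f x)"

lemma OU_const: "OU E (\<lambda>x. c) = (\<lambda>x. 0)"
  by (simp add: OU_def pd_const fun_eq_iff)

lemma OU_add: "polyfun E f \<Longrightarrow> polyfun E g \<Longrightarrow> OU E (\<lambda>x. f x + g x) = (\<lambda>x. OU E f x + OU E g x)"
  by (simp add: OU_def pd_add[of E] polyfun_pd fun_eq_iff sum.distrib[symmetric] algebra_simps)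

lemma OU_cmult: "polyfun E f \<Longrightarrow> OU E (\<lambda>x. c * f x) = (\<lambda>x. c * OU E f x)"
  by (simp add: OU_def pd_cmult[of E] polyfun_pd fun_eq_iff sum_distrib_left algebra_simps)

lemma OU_diff: "polyfun E f \<Longrightarrow> polyfun E g \<Longrightarrow> OU E (\<lambda>x. f x - g x) = (\<lambda>x. OU E f x - OU E g x)"
  using OU_add[of E f "\<lambda>x. -1 * g x"] OU_cmult[of E g "-1"] by (simp add: polyfun_intros)

lemma OU_sum: "(\<And>i. i \<in> I \<Longrightarrow> polyfun E (f i)) \<Longrightarrow> OU E (\<lambda>x. \<Sum>i\<in>I. f i x) = (\<lambda>x. \<Sum>i\<in>I. OU E (f i) x)"
  by (induction I rule: infinite_finite_induct) (simp_all add: OU_const OU_add polyfun_intros)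

text \<open>Product rule for a second order operator: a coordinate is an eigenfunction with
  eigenvalue -1, and the mixed term is twice the inner product of the gradients, here
  \<open>2 * pd a f\<close>.\<close>

lemma OU_coord_mult:
  assumes "finite E" "a \<in> E" "polyfun E f"
  shows "OU E (\<lambda>x. x a * f x) = (\<lambda>x. x a * OU E f x - x a * f x + 2 * pd a f x)"
proof
  fix x
  have p1: "pd e (\<lambda>x. x a * f x) = (\<lambda>x. (if e = a then 1 else 0) * f x + x a * pd e f x)" for e
    using assms by (subst pd_mult[of E]) (auto intro: polyfun_coord simp: pd_coord)
  have p2: "pd e (\<lambda>x. (if e = a then 1 else 0) * f x + x a * pd e f x)
     = (\<lambda>x. 2 * (if e = a then 1 else 0) * pd e f x + x a * pd e (pd e f) x)" for e
    using assms by (subst pd_add[of E]; (subst pd_mult[of E])?) 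
      (auto intro!: polyfun_intros simp: pd_coord pd_cmult[of E] pd_const fun_eq_iff)
  have "OU E (\<lambda>x. x a * f x) x = (\<Sum>e\<in>E. x a * (pd e (pd e f) x - x e * pd e f x) 
       + (if e = a then 2 * pd a f x - x a * f x else 0))"
    unfolding OU_def p1 p2 by (intro sum.cong refl) (auto simp: algebra_simps)
  also have "\<dots> = x a * OU E f x + (2 * pd a f x - x a * f x)"
    using assms by (simp add: sum.distrib OU_def sum_distrib_left)
  finally show "OU E (\<lambda>x. x a * f x) x = x a * OU E f x - x a * f x + 2 * pd a f x" by simp
qed

text \<open>The drift multiplies the homogeneous part of degree \<open>j\<close> by
  \<open>-j\<close>, and second derivatives lower the degree by two. Adding \<open>d - 1\<close>
  therefore removes the leading part.\<close>

lemma deg_lt_OU: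
  assumes "finite E"
  shows "deg_lt E d f \<Longrightarrow> deg_lt E (d - 1) (\<lambda>x. OU E f x + real (d - 1) * f x)"
proof (induction rule: deg_lt.induct)
  case (deg_lt_const d c)
  thus ?case by (cases d) (simp_all add: OU_const deg_lt_0 deg_lt.deg_lt_const)
next
  case (deg_lt_var a d f)
  note f = deg_lt_imp_polyfun[OF deg_lt_var(2)]
  show ?case
  proof (cases d)
    case 0
    thus ?thesis using deg_lt_0D[of E f] deg_lt_var by (simp add: OU_const deg_lt_0)
  next
    case (Suc d')
    have "deg_lt E d (\<lambda>x. x a * (OU E f x + real d' * f x) + 2 * pd a f x)"
      using deg_lt_var Suc deg_lt_pd[OF deg_lt_var(2), of a]
      by (auto intro!: deg_lt_add deg_lt_cmult deg_lt.deg_lt_var intro: deg_lt_Suc)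
    moreover have "(\<lambda>x. OU E (\<lambda>x. x a * f x) x + real (Suc d - 1) * (x a * f x))
      = (\<lambda>x. x a * (OU E f x + real d' * f x) + 2 * pd a f x)"
      by (subst OU_coord_mult[OF assms deg_lt_var(1) f]) (simp add: Suc algebra_simps fun_eq_iff)
    ultimately show ?thesis by simp
  qed
next
  case (deg_lt_add d f g)
  have "(\<lambda>x. OU E (\<lambda>x. f x + g x) x + real (d - 1) * (f x + g x))
     = (\<lambda>x. (OU E f x + real (d - 1) * f x) + (OU E g x + real (d - 1) * g x))"
    using deg_lt_add by (subst OU_add) (auto intro: deg_lt_imp_polyfun simp: algebra_simps)
  thus ?case using deg_lt_add by (auto intro: deg_lt.deg_lt_add)
qed (simp add: OU_const deg_lt_0)

section \<open>Wiener chaos as polynomial eigenspaces\<close>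

definition chaos :: "'e set \<Rightarrow> nat \<Rightarrow> (('e \<Rightarrow> real) \<Rightarrow> real) \<Rightarrow> bool" where
  "chaos E r g \<longleftrightarrow> deg_lt E (Suc r) g \<and> OU E g = (\<lambda>x. - real r * g x)"

lemma chaos_polyfun: "chaos E r g \<Longrightarrow> polyfun E g"
  by (auto simp: chaos_def polyfun_def)

text \<open>No Hermite polynomials are needed: \<open>OU + d\<close> lowers the degree, so its value
  at \<open>f\<close> is decomposed by induction, and inverting \<open>OU + d\<close> on the lower
  eigenspaces gives all components of \<open>f\<close> but the last.\<close>

lemma chaos_decomposition:
  assumes "finite E" "deg_lt E d f"
  shows "\<exists>g. (\<forall>r<d. chaos E r (g r)) \<and> f = (\<lambda>x. \<Sum>r<d. g r x)"
  using assms(2)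
proof (induction d arbitrary: f)
  case 0
  thus ?case by (simp add: deg_lt_0D)
next
  case (Suc d)
  have "deg_lt E d (\<lambda>x. OU E f x + real d * f x)" using deg_lt_OU[OF assms(1) Suc.prems] by simp
  from Suc.IH[OF this] obtain g where g: "\<And>r. r < d \<Longrightarrow> chaos E r (g r)"
    and eq: "(\<lambda>x. OU E f x + real d * f x) = (\<lambda>x. \<Sum>r<d. g r x)" by blast
  \<comment> \<open>On the chaos of order \<open>r < d\<close> the operator \<open>OU + d\<close> is
    multiplication by \<open>d - r\<close>, so this division inverts it. The difference
    \<open>t\<close> of \<open>f\<close> and the sum of the \<open>h r\<close> is then annihilated
    by \<open>OU + d\<close>, which puts it into the chaos of order \<open>d\<close>.\<close>
  define h where "h r x = 1 / (real d - real r) * g r x" for r x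
  have h: "chaos E r (h r)" if "r < d" for r
    using g[OF that] OU_cmult[OF chaos_polyfun[OF g[OF that]], of "1 / (real d - real r)"]
      deg_lt_cmult[of E "Suc r" "g r" "1 / (real d - real r)"]
    unfolding h_def chaos_def by (auto intro: deg_lt_cmult simp: algebra_simps simp del: times_divide_eq_left)
  define t where "t x = f x - (\<Sum>r<d. h r x)" for x
  have hs: "deg_lt E (Suc d) (\<lambda>x. \<Sum>r<d. h r x)"
  proof (intro deg_lt_sum)
    fix r assume "r \<in> {..<d}"
    thus "deg_lt E (Suc d) (h r)" using h[of r] deg_lt_mono[of E "Suc r" "h r" "Suc d"] by (simp add: chaos_def)
  qed
  have "OU E t = (\<lambda>x. OU E f x - (\<Sum>r<d. OU E (h r) x))"
    unfolding t_def using Suc.prems hs h chaos_polyfun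
    by (subst OU_diff, (auto intro: deg_lt_imp_polyfun)[2], subst OU_sum) auto
  also have "\<dots> = (\<lambda>x. - real d * t x)"
  proof
    fix x
    have "(\<Sum>r<d. OU E (h r) x + real d * h r x) = (\<Sum>r<d. g r x)"
    proof (intro sum.cong refl)
      fix r assume r: "r \<in> {..<d}"
      hence "OU E (h r) x = - real r * h r x" using h[of r] by (simp add: chaos_def)
      hence "OU E (h r) x + real d * h r x = (real d - real r) * h r x" by (simp add: algebra_simps)
      thus "OU E (h r) x + real d * h r x = g r x" using r by (simp add: h_def)
    qed
    also have "\<dots> = OU E f x + real d * f x" using eq by (simp add: fun_eq_iff)
    finally show "OU E f x - (\<Sum>r<d. OU E (h r) x) = - real d * t x"
      by (simp add: t_def sum.distrib right_diff_distrib flip: sum_distrib_left)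
  qed
  finally have "chaos E d t" unfolding chaos_def t_def using Suc.prems hs by (auto intro: deg_lt_diff)
  thus ?case using h
    by (intro exI[of _ "\<lambda>r. if r < d then h r else t"]) (auto simp: t_def less_Suc_eq)
qed

text \<open>Commuting \<open>pd e\<close> past the drift produces one extra \<open>- pd e g\<close>,
  so a derivative raises the eigenvalue by one.\<close>

lemma chaos_pd:
  assumes "finite E" "chaos E (Suc r) g" "e \<in> E"
  shows "chaos E r (pd e g)"
proof -
  have g: "polyfun E g" using assms by (auto intro: chaos_polyfun)
  have "pd e (OU E g) = (\<lambda>x. \<Sum>a\<in>E. pd e (\<lambda>x. pd a (pd a g) x - x a * pd a g x) x)"
    unfolding OU_def by (rule pd_sum[of _ E]) (intro polyfun_diff polyfun_mult polyfun_pd polyfun_coord g)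
  also have "\<dots> = (\<lambda>x. \<Sum>a\<in>E. (pd a (pd a (pd e g)) x - x a * pd a (pd e g) x) - (if a = e then pd e g x else 0))"
  proof (intro ext sum.cong refl)
    fix x a assume "a \<in> E"
    hence "pd e (\<lambda>x. pd a (pd a g) x - x a * pd a g x)
       = (\<lambda>x. pd e (pd a (pd a g)) x - ((if e = a then 1 else 0) * pd a g x + x a * pd e (pd a g) x))"
      using g by (subst pd_diff[of E]; (subst pd_mult[of E])?) (auto intro!: polyfun_intros simp: pd_coord)
    moreover have "pd e (pd a (pd a g)) = pd a (pd a (pd e g))" "pd e (pd a g) = pd a (pd e g)"
      using g by (metis pd_commute polyfun_pd)+
    ultimately show "pd e (\<lambda>x. pd a (pd a g) x - x a * pd a g x) x
      = (pd a (pd a (pd e g)) x - x a * pd a (pd e g) x) - (if a = e then pd e g x else 0)" by auto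
  qed
  also have "\<dots> = (\<lambda>x. OU E (pd e g) x - pd e g x)"
    using assms by (simp add: OU_def sum_subtractf fun_eq_iff)
  finally have "OU E (pd e g) = (\<lambda>x. pd e (OU E g) x + pd e g x)" by (simp add: fun_eq_iff)
  also have "OU E g = (\<lambda>x. - real (Suc r) * g x)" using assms by (simp add: chaos_def)
  also have "pd e \<dots> = (\<lambda>x. - real (Suc r) * pd e g x)" by (rule pd_cmult[OF g])
  finally have "OU E (pd e g) = (\<lambda>x. - real r * pd e g x)" by (simp add: algebra_simps)
  thus ?thesis using assms deg_lt_pd[of E "Suc (Suc r)" g e] by (simp add: chaos_def)
qed


section \<open>Gaussian expectation, variance and the Poincare inequality\<close>

definition energy :: "'e set \<Rightarrow> (('e \<Rightarrow> real) \<Rightarrow> real) \<Rightarrow> ('e \<Rightarrow> real) \<Rightarrow> real" where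
  "energy E f x = (\<Sum>e\<in>E. (pd e f x)\<^sup>2)"

lemma polyfun_energy: "polyfun E f \<Longrightarrow> polyfun E (energy E f)"
  unfolding energy_def by (intro polyfun_intros)

text \<open>These properties of expectation are all that the variance estimates use. Every statement
  about \<open>Ex\<close> concerns polynomial functions, hence no integrability conditions appear
  before the locale is instantiated.\<close>

locale gaussian_expectation =
  fixes E :: "'e set" and Ex :: "(('e \<Rightarrow> real) \<Rightarrow> real) \<Rightarrow> real"
  assumes finite_E: "finite E"
    and Ex_add: "polyfun E f \<Longrightarrow> polyfun E g \<Longrightarrow> Ex (\<lambda>x. f x + g x) = Ex f + Ex g"
    and Ex_cmult: "polyfun E f \<Longrightarrow> Ex (\<lambda>x. c * f x) = c * Ex f"
    and Ex_one: "Ex (\<lambda>x. 1) = 1"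
    and Ex_nonneg: "polyfun E f \<Longrightarrow> (\<And>x. 0 \<le> f x) \<Longrightarrow> 0 \<le> Ex f"
    and Ex_by_parts: "e \<in> E \<Longrightarrow> polyfun E f \<Longrightarrow> Ex (\<lambda>x. x e * f x) = Ex (pd e f)"
begin

lemma Ex_const: "Ex (\<lambda>x. c) = c"
  using Ex_cmult[OF polyfun_const, of c 1] Ex_one by simp

lemma Ex_diff: "polyfun E f \<Longrightarrow> polyfun E g \<Longrightarrow> Ex (\<lambda>x. f x - g x) = Ex f - Ex g"
  using Ex_add[of f "\<lambda>x. -1 * g x"] Ex_cmult[of g "-1"] by (simp add: polyfun_intros)

lemma Ex_divide: "polyfun E f \<Longrightarrow> Ex (\<lambda>x. f x / c) = Ex f / c"
  using Ex_cmult[of f "1 / c"] by simp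

lemma Ex_sum: "(\<And>i. i \<in> I \<Longrightarrow> polyfun E (f i)) \<Longrightarrow> Ex (\<lambda>x. \<Sum>i\<in>I. f i x) = (\<Sum>i\<in>I. Ex (f i))"
  by (induction I rule: infinite_finite_induct) (simp_all add: Ex_const Ex_add polyfun_sum)

lemma Ex_mono: "polyfun E f \<Longrightarrow> polyfun E g \<Longrightarrow> (\<And>x. f x \<le> g x) \<Longrightarrow> Ex f \<le> Ex g"
  using Ex_nonneg[of "\<lambda>x. g x - f x"] Ex_diff[of g f] by (simp add: polyfun_diff)

lemma Ex_abs_le: "polyfun E f \<Longrightarrow> polyfun E g \<Longrightarrow> (\<And>x. \<bar>f x\<bar> \<le> g x) \<Longrightarrow> \<bar>Ex f\<bar> \<le> Ex g"
  using Ex_mono[of f g] Ex_mono[of "\<lambda>x. -1 * f x" g] Ex_cmult[of f "-1"]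
  by (simp add: abs_le_iff polyfun_intros)

text \<open>Integrating the drift by parts cancels the second derivative. The right-hand side is
  symmetric in \<open>f\<close> and \<open>g\<close>, whence the operator is self-adjoint and
  different chaoses are orthogonal.\<close>

lemma Ex_OU:
  assumes "polyfun E f" "polyfun E g"
  shows "Ex (\<lambda>x. f x * OU E g x) = - (\<Sum>e\<in>E. Ex (\<lambda>x. pd e f x * pd e g x))"
proof -
  have "Ex (\<lambda>x. f x * OU E g x) = (\<Sum>e\<in>E. Ex (\<lambda>x. f x * pd e (pd e g) x - x e * (f x * pd e g x)))"
    unfolding OU_def sum_distrib_left using assms
    by (subst Ex_sum[symmetric]) (auto intro!: polyfun_intros simp: algebra_simps)
  also have "\<dots> = (\<Sum>e\<in>E. - Ex (\<lambda>x. pd e f x * pd e g x))"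
  proof (intro sum.cong refl)
    fix e assume e: "e \<in> E"
    have "Ex (\<lambda>x. x e * (f x * pd e g x)) = Ex (\<lambda>x. pd e f x * pd e g x + f x * pd e (pd e g) x)"
      using assms e by (subst Ex_by_parts) (auto intro!: polyfun_intros simp: pd_mult[of E] polyfun_pd)
    thus "Ex (\<lambda>x. f x * pd e (pd e g) x - x e * (f x * pd e g x)) = - Ex (\<lambda>x. pd e f x * pd e g x)"
      using assms e by (simp add: Ex_diff Ex_add polyfun_intros)
  qed
  finally show ?thesis by (simp add: sum_negf)
qed

lemma chaos_orthogonal:
  assumes "chaos E r f" "chaos E s g" "r \<noteq> s"
  shows "Ex (\<lambda>x. f x * g x) = 0"
proof -
  have p: "polyfun E f" "polyfun E g" using assms by (auto intro: chaos_polyfun)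
  have "Ex (\<lambda>x. f x * OU E g x) = Ex (\<lambda>x. g x * OU E f x)"
    using p by (simp add: Ex_OU mult.commute)
  moreover have "Ex (\<lambda>x. f x * OU E g x) = Ex (\<lambda>x. - real s * (f x * g x))"
    using assms by (simp add: chaos_def algebra_simps)
  moreover have "Ex (\<lambda>x. g x * OU E f x) = Ex (\<lambda>x. - real r * (f x * g x))"
    using assms by (simp add: chaos_def algebra_simps)
  ultimately show ?thesis
    using assms(3) Ex_cmult[OF polyfun_mult[OF p], of "- real r"] Ex_cmult[OF polyfun_mult[OF p], of "- real s"] by simp
qed

lemma Ex_chaos_sum:
  assumes "\<And>r. r < d \<Longrightarrow> chaos E r (g r)"
  shows "Ex (\<lambda>x. (\<Sum>r<d. a r * g r x) * (\<Sum>r<d. b r * g r x)) = (\<Sum>r<d. a r * b r * Ex (\<lambda>x. (g r x)\<^sup>2))"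
proof -
  have p: "polyfun E (g r)" if "r < d" for r using assms that by (auto intro: chaos_polyfun)
  have "Ex (\<lambda>x. (\<Sum>r<d. a r * g r x) * (\<Sum>r<d. b r * g r x))
      = (\<Sum>r<d. \<Sum>s<d. a r * b s * Ex (\<lambda>x. g r x * g s x))"
    unfolding sum_product
    by (subst Ex_sum, (auto intro!: polyfun_intros p)[1], intro sum.cong refl,
        subst Ex_sum, (auto intro!: polyfun_intros p)[1], intro sum.cong refl)
       (simp add: p polyfun_intros mult_ac flip: Ex_cmult)
  also have "\<dots> = (\<Sum>r<d. \<Sum>s<d. if s = r then a r * b r * Ex (\<lambda>x. (g r x)\<^sup>2) else 0)"
    by (intro sum.cong refl) (auto simp: power2_eq_square chaos_orthogonal[OF assms assms])
  finally show ?thesis by simp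
qed

definition Var :: "(('e \<Rightarrow> real) \<Rightarrow> real) \<Rightarrow> real" where
  "Var f = Ex (\<lambda>x. (f x)\<^sup>2) - (Ex f)\<^sup>2"

lemma Var_alt:
  assumes "polyfun E f" shows "Var f = Ex (\<lambda>x. (f x - Ex f)\<^sup>2)"
proof -
  define \<mu> where "\<mu> = Ex f"
  have "Ex (\<lambda>x. (f x - \<mu>)\<^sup>2) = Ex (\<lambda>x. ((f x)\<^sup>2 + - (2 * \<mu>) * f x) + \<mu>\<^sup>2)"
    by (simp add: power2_eq_square algebra_simps)
  also have "\<dots> = Ex (\<lambda>x. (f x)\<^sup>2) + - (2 * \<mu>) * Ex f + \<mu>\<^sup>2"
    using assms by (subst Ex_add; (subst Ex_add)?; (subst Ex_cmult)?; (subst Ex_const)?; (intro polyfun_intros)?) auto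
  finally show ?thesis by (simp add: Var_def \<mu>_def power2_eq_square)
qed

lemma Var_cmult: "polyfun E f \<Longrightarrow> Var (\<lambda>x. c * f x) = c\<^sup>2 * Var f"
  by (simp add: Var_def power_mult_distrib Ex_cmult polyfun_intros algebra_simps)

lemma Var_divide: "polyfun E f \<Longrightarrow> Var (\<lambda>x. f x / c) = Var f / c\<^sup>2"
  using Var_cmult[of f "1 / c"] by (simp add: power_divide)

lemma Var_sum_le:
  assumes "\<And>i. i \<in> I \<Longrightarrow> polyfun E (f i)"
  shows "Var (\<lambda>x. \<Sum>i\<in>I. f i x) \<le> real (card I) * (\<Sum>i\<in>I. Var (f i))"
proof -
  have "Var (\<lambda>x. \<Sum>i\<in>I. f i x) = Ex (\<lambda>x. (\<Sum>i\<in>I. f i x - Ex (f i))\<^sup>2)"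
    using assms by (simp add: Var_alt polyfun_intros Ex_sum sum_subtractf)
  also have "\<dots> \<le> Ex (\<lambda>x. real (card I) * (\<Sum>i\<in>I. (f i x - Ex (f i))\<^sup>2))"
    using assms by (intro Ex_mono polyfun_intros) (auto simp: mult.commute[of "real (card I)"] intro: sum_squared_le_sum_of_squares)
  also have "\<dots> = real (card I) * (\<Sum>i\<in>I. Var (f i))"
    using assms by (simp add: Ex_cmult Ex_sum polyfun_intros Var_alt)
  finally show ?thesis .
qed

lemma Var_add_le:
  assumes "polyfun E f" "polyfun E g"
  shows "Var (\<lambda>x. f x + g x) \<le> 2 * Var f + 2 * Var g"
  using Var_sum_le[of "{True, False}" "\<lambda>b. if b then f else g"] assms by simp

text \<open>The weights \<open>a\<close> are free so that one decomposition serves \<open>f\<close>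
  itself (weight 1) as well as \<open>OU f + d f\<close> (weight \<open>d - r\<close>); the two
  variances can then be compared term by term.\<close>

lemma chaos_expansion:
  assumes "deg_lt E d f"
  shows "\<exists>g. (\<forall>r<d. chaos E r (g r)) \<and> f = (\<lambda>x. \<Sum>r<d. g r x) \<and>
     (\<forall>a. Var (\<lambda>x. \<Sum>r<d. a r * g r x) = (\<Sum>r=1..<d. (a r)\<^sup>2 * Ex (\<lambda>x. (g r x)\<^sup>2)))"
proof -
  obtain g where g: "\<And>r. r < d \<Longrightarrow> chaos E r (g r)" and f: "f = (\<lambda>x. \<Sum>r<d. g r x)"
    using chaos_decomposition[OF finite_E assms] by blast
  have p: "polyfun E (g r)" if "r < d" for r using g that by (auto intro: chaos_polyfun)
  have one: "chaos E 0 (\<lambda>x. 1)" by (simp add: chaos_def OU_const deg_lt_const)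
  have z: "Ex (g r) = 0" if "r < d" "r \<noteq> 0" for r
    using chaos_orthogonal[OF g one] that by simp
  have e: "Ex (\<lambda>x. \<Sum>r<d. a r * g r x) = (if d = 0 then 0 else a 0 * Ex (g 0))" for a
  proof -
    have "Ex (\<lambda>x. \<Sum>r<d. a r * g r x) = (\<Sum>r<d. a r * Ex (g r))"
      using p by (subst Ex_sum) (auto intro!: polyfun_intros simp: Ex_cmult)
    also have "\<dots> = (\<Sum>r<d. if r = 0 then a 0 * Ex (g 0) else 0)"
      using z by (intro sum.cong) auto
    finally show ?thesis by simp
  qed
  have v: "Var (\<lambda>x. \<Sum>r<d. a r * g r x) = (\<Sum>r=1..<d. (a r)\<^sup>2 * Ex (\<lambda>x. (g r x)\<^sup>2))" for a
  proof (cases d)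
    case (Suc d')
    \<comment> \<open>The chaos of order 0 consists of constants. Its contribution to the second
      moment is exactly the square of the mean, which is why the sum for the variance starts at
      1.\<close>
    obtain c where c: "g 0 = (\<lambda>x. c)" using g[of 0] Suc by (auto simp: chaos_def dest: deg_lt_1D)
    have "Var (\<lambda>x. \<Sum>r<d. a r * g r x) = (\<Sum>r<d. (a r)\<^sup>2 * Ex (\<lambda>x. (g r x)\<^sup>2)) - (a 0 * c)\<^sup>2"
      using Ex_chaos_sum[OF g, of d a a] unfolding Var_def e e[of "\<lambda>_. 1", simplified]
      by (simp add: Suc c Ex_const power2_eq_square del: sum.lessThan_Suc)
    also have "(\<Sum>r<d. (a r)\<^sup>2 * Ex (\<lambda>x. (g r x)\<^sup>2)) = (\<Sum>r\<in>insert 0 {1..<d}. (a r)\<^sup>2 * Ex (\<lambda>x. (g r x)\<^sup>2))"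
      using Suc by (intro sum.cong) auto
    finally show ?thesis by (simp add: c Ex_const power_mult_distrib)
  qed (simp add: Var_def Ex_const)
  show ?thesis using g f v by (intro exI[of _ g]) simp
qed

text \<open>With the squared norms of the chaos components as summands, the variance has weights 1
  for \<open>r \<ge> 1\<close>, while the expected energy, equal to \<open>- Ex (f * OU f)\<close>,
  has weights \<open>r\<close>.\<close>

lemma poincare:
  assumes "polyfun E f"
  shows "Var f \<le> Ex (energy E f)"
proof -
  from assms obtain d where d: "deg_lt E d f" by (auto simp: polyfun_def)
  from chaos_expansion[OF d] obtain g where g': "\<forall>r<d. chaos E r (g r)" and f: "f = (\<lambda>x. \<Sum>r<d. g r x)"
    and v: "\<forall>a. Var (\<lambda>x. \<Sum>r<d. a r * g r x) = (\<Sum>r=1..<d. (a r)\<^sup>2 * Ex (\<lambda>x. (g r x)\<^sup>2))"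
    by (elim exE conjE) (rule that)
  note g = g'[rule_format]
  have p: "polyfun E (g r)" if "r < d" for r using g that by (auto intro: chaos_polyfun)
  have nn: "0 \<le> Ex (\<lambda>x. (g r x)\<^sup>2)" if "r < d" for r using p[OF that] by (intro Ex_nonneg polyfun_intros) auto
  have "Ex (energy E f) = - Ex (\<lambda>x. f x * OU E f x)"
    unfolding energy_def using assms by (simp add: Ex_OU Ex_sum polyfun_intros power2_eq_square)
  also have "OU E f = (\<lambda>x. \<Sum>r<d. - real r * g r x)"
    unfolding f using p g by (subst OU_sum) (auto simp: chaos_def)
  also have "- Ex (\<lambda>x. f x * (\<Sum>r<d. - real r * g r x)) = (\<Sum>r<d. real r * Ex (\<lambda>x. (g r x)\<^sup>2))"
    using Ex_chaos_sum[OF g, of d "\<lambda>_. 1" "\<lambda>r. - real r"] by (simp add: f sum_negf)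
  finally have en: "Ex (energy E f) = (\<Sum>r<d. real r * Ex (\<lambda>x. (g r x)\<^sup>2))" .
  have "Var f = (\<Sum>r=1..<d. 1 * Ex (\<lambda>x. (g r x)\<^sup>2))"
    using v[THEN spec, of "\<lambda>_. 1"] by (simp add: f)
  also have "\<dots> \<le> (\<Sum>r=1..<d. real r * Ex (\<lambda>x. (g r x)\<^sup>2))"
    by (intro sum_mono mult_right_mono nn) auto
  also have "\<dots> \<le> (\<Sum>r<d. real r * Ex (\<lambda>x. (g r x)\<^sup>2))"
    by (intro sum_mono2) (auto intro: mult_nonneg_nonneg nn)
  finally show ?thesis by (simp add: en)
qed

lemma chaos_lower_orthogonal:
  assumes "deg_lt E d h" "chaos E d g"
  shows "Ex (\<lambda>x. h x * g x) = 0"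
proof -
  obtain q where q: "\<And>r. r < d \<Longrightarrow> chaos E r (q r)" and h: "h = (\<lambda>x. \<Sum>r<d. q r x)"
    using chaos_decomposition[OF finite_E assms(1)] by blast
  have "Ex (\<lambda>x. h x * g x) = (\<Sum>r<d. Ex (\<lambda>x. q r x * g x))"
    unfolding h sum_distrib_right using q assms(2)
    by (subst Ex_sum) (auto intro!: polyfun_mult intro: chaos_polyfun)
  also have "\<dots> = 0" using q assms(2) by (intro sum.neutral) (auto intro: chaos_orthogonal)
  finally show ?thesis .
qed

text \<open>The chaos components of \<open>F - T\<close> of order \<open>r < d\<close> are those of \<open>OU F + d F\<close> divided by \<open>d - r \<ge> 1\<close>.\<close>
lemma Var_le_OU_plus_top:
  assumes F: "deg_lt E (Suc d) F" and T: "chaos E d T" and S: "deg_lt E d (\<lambda>x. F x - T x - S x)" and d: "d > 0"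
  obtains g where "chaos E d g" "deg_lt E d (\<lambda>x. S x - g x)"
    "Var (\<lambda>x. F x - T x) \<le> Ex (\<lambda>x. (g x)\<^sup>2) + Var (\<lambda>x. OU E F x + real d * F x)"
proof -
  have FT: "deg_lt E (Suc d) (\<lambda>x. F x - T x)" using F T by (auto simp: chaos_def intro: deg_lt_diff)
  from chaos_expansion[OF FT] obtain g where g': "\<forall>r<Suc d. chaos E r (g r)"
    and f: "(\<lambda>x. F x - T x) = (\<lambda>x. \<Sum>r<Suc d. g r x)"
    and v': "\<forall>a. Var (\<lambda>x. \<Sum>r<Suc d. a r * g r x) = (\<Sum>r=1..<Suc d. (a r)\<^sup>2 * Ex (\<lambda>x. (g r x)\<^sup>2))"
    by (elim exE conjE) (rule that)
  note g = g'[rule_format] and v = v'[rule_format]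
  have pg: "polyfun E (g r)" if "r < Suc d" for r using g that by (auto intro: chaos_polyfun)
  have p: "polyfun E F" "polyfun E T" using F T chaos_polyfun by (auto intro: deg_lt_imp_polyfun)
  \<comment> \<open>Subtracting \<open>T\<close> does not change this expression, because
    \<open>OU + d\<close> annihilates the chaos of order \<open>d\<close>.\<close>
  have "(\<lambda>x. OU E F x + real d * F x) = (\<lambda>x. OU E (\<lambda>x. F x - T x) x + real d * (F x - T x))"
    using T by (subst OU_diff[OF p]) (simp add: chaos_def algebra_simps)
  also have "OU E (\<lambda>x. F x - T x) = (\<lambda>x. \<Sum>r<Suc d. - real r * g r x)"
    unfolding f using g pg by (subst OU_sum) (auto simp: chaos_def simp del: sum.lessThan_Suc)
  also have "(\<lambda>x. (\<Sum>r<Suc d. - real r * g r x) + real d * (F x - T x)) = (\<lambda>x. \<Sum>r<Suc d. (real d - real r) * g r x)"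
    unfolding fun_cong[OF f] sum_distrib_left sum.distrib[symmetric]
    by (intro ext sum.cong refl) (simp add: algebra_simps)
  finally have R: "(\<lambda>x. OU E F x + real d * F x) = (\<lambda>x. \<Sum>r<Suc d. (real d - real r) * g r x)" .
  have nn: "0 \<le> Ex (\<lambda>x. (g r x)\<^sup>2)" if "r < d" for r using pg that by (intro Ex_nonneg polyfun_intros) auto
  have "Var (\<lambda>x. F x - T x) = (\<Sum>r=1..<Suc d. Ex (\<lambda>x. (g r x)\<^sup>2))"
    using v[of "\<lambda>_. 1"] by (simp add: f)
  also have "\<dots> = Ex (\<lambda>x. (g d x)\<^sup>2) + (\<Sum>r=1..<d. Ex (\<lambda>x. (g r x)\<^sup>2))"
    using d by (simp add: sum.atLeastLessThan_Suc)
  also have "(\<Sum>r=1..<d. Ex (\<lambda>x. (g r x)\<^sup>2)) \<le> (\<Sum>r=1..<d. (real d - real r)\<^sup>2 * Ex (\<lambda>x. (g r x)\<^sup>2))"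
  proof (intro sum_mono)
    fix r assume r: "r \<in> {1..<d}"
    hence "1 \<le> (real d - real r)\<^sup>2" by (simp add: one_le_power)
    thus "Ex (\<lambda>x. (g r x)\<^sup>2) \<le> (real d - real r)\<^sup>2 * Ex (\<lambda>x. (g r x)\<^sup>2)"
      using mult_right_mono[of 1 "(real d - real r)\<^sup>2", OF _ nn[of r]] r by simp
  qed
  also have "\<dots> = Var (\<lambda>x. OU E F x + real d * F x)"
    unfolding R v using d by (simp add: sum.atLeastLessThan_Suc)
  finally have "Var (\<lambda>x. F x - T x) \<le> Ex (\<lambda>x. (g d x)\<^sup>2) + Var (\<lambda>x. OU E F x + real d * F x)" by simp
  \<comment> \<open>\<open>S\<close> agrees with \<open>F - T\<close> up to lower degree, and the
    chaoses of order below \<open>d\<close> have lower degree as well. So \<open>g d\<close> is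
    pinned down by \<open>S\<close> alone, without a formula for the projection.\<close>
  moreover have "deg_lt E d (\<lambda>x. S x - g d x)"
  proof -
    have "deg_lt E d (g r)" if "r < d" for r
      using g[of r] that deg_lt_mono[of E "Suc r" "g r" d] by (simp add: chaos_def)
    hence "deg_lt E d (\<lambda>x. \<Sum>r<d. g r x)" by (intro deg_lt_sum) auto
    hence "deg_lt E d (\<lambda>x. (\<Sum>r<d. g r x) - (F x - T x - S x))" by (rule deg_lt_diff[OF _ S])
    also have "(\<lambda>x. (\<Sum>r<d. g r x) - (F x - T x - S x)) = (\<lambda>x. S x - g d x)"
      using fun_cong[OF f] by (simp add: fun_eq_iff algebra_simps)
    finally show ?thesis .
  qed
  ultimately show ?thesis using that g by blast
qed

end

section \<open>Monomials and their pairing with the top chaos\<close>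

definition monom_fun :: "'e multiset \<Rightarrow> ('e \<Rightarrow> real) \<Rightarrow> real" where
  "monom_fun M x = (\<Prod>e\<in>#M. x e)"

lemma monom_fun_empty: "monom_fun {#} = (\<lambda>x. 1)"
  by (simp add: monom_fun_def fun_eq_iff)

lemma deg_lt_monom_fun: "set_mset M \<subseteq> E \<Longrightarrow> deg_lt E (Suc (size M)) (monom_fun M)"
proof (induction M)
  case empty
  show ?case using deg_lt_const[of E 0 1] by (simp add: monom_fun_empty)
next
  case (add e M)
  have "monom_fun (add_mset e M) = (\<lambda>x. x e * monom_fun M x)" by (simp add: monom_fun_def fun_eq_iff)
  thus ?case using add by (simp add: deg_lt_var)
qed

lemma polyfun_monom_fun: "set_mset M \<subseteq> E \<Longrightarrow> polyfun E (monom_fun M)"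
  by (rule deg_lt_imp_polyfun[OF deg_lt_monom_fun])

lemma pd_monom_fun: "pd e (monom_fun M) = (\<lambda>x. real (count M e) * monom_fun (M - {#e#}) x)"
proof (induction M)
  case empty
  show ?case by (simp add: monom_fun_empty pd_const)
next
  case (add a M)
  have "monom_fun (add_mset a M) = (\<lambda>x. x a * monom_fun M x)" for a M by (simp add: monom_fun_def fun_eq_iff)
  note add_eq = this
  have "pd e (monom_fun (add_mset a M)) = (\<lambda>x. (if e = a then 1 else 0) * monom_fun M x + x a * pd e (monom_fun M) x)"
    unfolding add_eq by (subst pd_mult[of "insert a (set_mset M)"]) (auto intro: polyfun_coord polyfun_monom_fun simp: pd_coord)
  also have "\<dots> = (\<lambda>x. real (count (add_mset a M) e) * monom_fun (add_mset a M - {#e#}) x)"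
  proof
    fix x
    show "(if e = a then 1 else 0) * monom_fun M x + x a * pd e (monom_fun M) x
       = real (count (add_mset a M) e) * monom_fun (add_mset a M - {#e#}) x"
    proof (cases "e \<in># M")
      case True
      then obtain M' where M: "M = add_mset e M'" by (metis insert_DiffM)
      have "pd e (monom_fun M) x = real (Suc (count M' e)) * monom_fun M' x"
        by (simp only: add.IH) (simp add: M)
      moreover have "monom_fun M x = x e * monom_fun M' x" by (simp add: M add_eq)
      moreover have "add_mset a M - {#e#} = (if a = e then M else add_mset a M')" by (simp add: M)
      moreover have "count (add_mset a M) e = (if a = e then 2 else 1) + count M' e" by (simp add: M)
      ultimately show ?thesis by (simp add: add_eq algebra_simps)
    next
      case False
      thus ?thesis by (auto simp: add.IH not_in_iff)
    qed
  qed
  finally show ?case .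
qed

text \<open>Second derivatives vanish, and each variable present contributes a factor -1 through the
  drift. A product of distinct variables thus already lies in the chaos of its degree, which is what
  applies to cycles.\<close>

lemma OU_monom_fun_squarefree:
  assumes "finite E" "set_mset M \<subseteq> E" "\<And>e. count M e \<le> 1"
  shows "OU E (monom_fun M) = (\<lambda>x. - real (size M) * monom_fun M x)"
proof
  fix x
  have "OU E (monom_fun M) x = (\<Sum>e\<in>E. - (real (count M e) * monom_fun M x))"
    unfolding OU_def
  proof (intro sum.cong refl)
    fix e
    have "count (M - {#e#}) e = 0" using assms(3)[of e] by simp
    hence "pd e (pd e (monom_fun M)) x = 0"
      by (simp add: pd_monom_fun pd_cmult[OF polyfun_monom_fun[OF order_refl]])
    moreover have "x e * (real (count M e) * monom_fun (M - {#e#}) x) = real (count M e) * monom_fun M x"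
    proof (cases "e \<in># M")
      case True
      then obtain M' where M: "M = add_mset e M'" by (metis insert_DiffM)
      show ?thesis by (simp add: M monom_fun_def)
    qed (simp add: not_in_iff)
    ultimately show "pd e (pd e (monom_fun M)) x - x e * pd e (monom_fun M) x = - (real (count M e) * monom_fun M x)"
      by (simp add: pd_monom_fun)
  qed
  also have "\<dots> = - (real (\<Sum>e\<in>E. count M e) * monom_fun M x)"
    by (simp add: sum_negf flip: sum_distrib_right)
  also have "(\<Sum>e\<in>E. count M e) = size M"
    unfolding size_multiset_overloaded_eq using assms
    by (intro sum.mono_neutral_right) (auto simp: not_in_iff)
  finally show "OU E (monom_fun M) x = - real (size M) * monom_fun M x" by simp
qed

context gaussian_expectation
begin

text \<open>Pairing a monomial with a top-order chaos component differentiates the latter down to a constant.\<close>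
lemma Ex_monom_top_chaos:
  assumes "set_mset M \<subseteq> E"
  shows "\<exists>K. 0 \<le> K \<and> K \<le> fact (size M) \<and> (\<forall>W c N g. finite W \<longrightarrow>
     (\<forall>w\<in>W. size (N w) = size M \<and> set_mset (N w) \<subseteq> E) \<longrightarrow> chaos E (size M) g \<longrightarrow>
     deg_lt E (size M) (\<lambda>x. (\<Sum>w\<in>W. c w * monom_fun (N w) x) - g x) \<longrightarrow>
     Ex (\<lambda>x. monom_fun M x * g x) = K * (\<Sum>w\<in>{w\<in>W. N w = M}. c (w::'w)))"
  using assms
proof (induction M)
  case empty
  show ?case
  proof (intro exI[of _ 1] conjI allI impI)
    fix W :: "'w set" and c N g
    assume W: "finite W" "\<forall>w\<in>W. size (N w) = size ({#}::'e multiset) \<and> set_mset (N w) \<subseteq> E"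
      and "deg_lt E (size ({#}::'e multiset)) (\<lambda>x. (\<Sum>w\<in>W. c w * monom_fun (N w) x) - g x)"
    hence "g = (\<lambda>x. \<Sum>w\<in>W. c w)"
      by (auto dest!: deg_lt_0D simp: fun_eq_iff monom_fun_def)
    moreover have "{w\<in>W. N w = {#}} = W" using W by auto
    ultimately show "Ex (\<lambda>x. monom_fun {#} x * g x) = 1 * (\<Sum>w\<in>{w\<in>W. N w = {#}}. c w)"
      by (simp add: monom_fun_def Ex_const)
  qed auto
next
  case (add e M)
  from add.prems have e: "e \<in> E" and M: "set_mset M \<subseteq> E" by auto
  from add.IH[OF M] obtain K where K: "0 \<le> K" "K \<le> fact (size M)"
    and KM: "\<forall>W c N g. finite W \<longrightarrow>
     (\<forall>w\<in>W. size (N w) = size M \<and> set_mset (N w) \<subseteq> E) \<longrightarrow> chaos E (size M) g \<longrightarrow>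
     deg_lt E (size M) (\<lambda>x. (\<Sum>w\<in>W. c w * monom_fun (N w) x) - g x) \<longrightarrow>
     Ex (\<lambda>x. monom_fun M x * g x) = K * (\<Sum>w\<in>{w\<in>W. N w = M}. c (w::'w))" by blast
  \<comment> \<open>One copy of \<open>e\<close> is removed per step, so the constant ends up as the
    product of the factorials of the multiplicities; this is at most the factorial of the
    size.\<close>
  define K' where "K' = K * real (count (add_mset e M) e)"
  have "real (count (add_mset e M) e) \<le> real (Suc (size M))"
    using count_le_size[of M e] by simp
  hence "K' \<le> fact (size M) * real (Suc (size M))" unfolding K'_def using K by (intro mult_mono) auto
  hence K': "0 \<le> K'" "K' \<le> fact (size (add_mset e M))" using K by (auto simp: K'_def mult.commute)
  have "Ex (\<lambda>x. monom_fun (add_mset e M) x * g x) = K' * (\<Sum>w\<in>{w\<in>W. N w = add_mset e M}. c w)"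
    if W: "finite W" "\<forall>w\<in>W. size (N w) = size (add_mset e M) \<and> set_mset (N w) \<subseteq> E"
      and g: "chaos E (size (add_mset e M)) g"
      and low: "deg_lt E (size (add_mset e M)) (\<lambda>x. (\<Sum>w\<in>W. c w * monom_fun (N w) x) - g x)"
    for W :: "'w set" and c N g
  proof -
    have pg: "polyfun E g" using g by (rule chaos_polyfun)
    have pM: "polyfun E (monom_fun M)" using M by (rule polyfun_monom_fun)
    have pN: "polyfun E (monom_fun (N w))" if "w \<in> W" for w using W that by (auto intro: polyfun_monom_fun)
    have "Ex (\<lambda>x. monom_fun (add_mset e M) x * g x) = Ex (\<lambda>x. x e * (monom_fun M x * g x))"
      by (simp add: monom_fun_def mult_ac)
    also have "\<dots> = Ex (\<lambda>x. pd e (monom_fun M) x * g x + monom_fun M x * pd e g x)"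
      using e pg pM by (subst Ex_by_parts) (auto intro: polyfun_mult simp: pd_mult[of E])
    also have "\<dots> = Ex (\<lambda>x. pd e (monom_fun M) x * g x) + Ex (\<lambda>x. monom_fun M x * pd e g x)"
      using pg pM by (intro Ex_add polyfun_intros)
    \<comment> \<open>The derivative of the monomial has degree below the order of \<open>g\<close>,
      so it is orthogonal to \<open>g\<close>.\<close>
    also have "Ex (\<lambda>x. pd e (monom_fun M) x * g x) = 0"
      using deg_lt_pd[OF deg_lt_monom_fun[OF M], of e] g
      by (intro chaos_lower_orthogonal[of "size (add_mset e M)"]) (auto intro: deg_lt_Suc)
    \<comment> \<open>The hypothesis is applied to the differentiated representation: only monomials
      containing \<open>e\<close> survive, and their coefficients are multiplied by the multiplicity
      of \<open>e\<close>. This is why arbitrary weights \<open>c\<close> and labels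
      \<open>N\<close> are allowed.\<close>
    also have "Ex (\<lambda>x. monom_fun M x * pd e g x)
      = K * (\<Sum>w\<in>{w\<in>{w\<in>W. e \<in># N w}. N w - {#e#} = M}. c w * real (count (N w) e))"
    proof (rule KM[THEN spec, THEN spec, THEN spec, THEN spec, THEN mp, THEN mp, THEN mp, THEN mp])
      show "finite {w \<in> W. e \<in># N w}" using W by simp
      show "\<forall>w\<in>{w \<in> W. e \<in># N w}. size (N w - {#e#}) = size M \<and> set_mset (N w - {#e#}) \<subseteq> E"
        using W by (auto simp: size_Diff_singleton dest: in_diffD)
      show "chaos E (size M) (pd e g)" using chaos_pd[OF finite_E _ e] g by simp
      have "pd e (\<lambda>x. (\<Sum>w\<in>W. c w * monom_fun (N w) x) - g x)
         = (\<lambda>x. (\<Sum>w\<in>W. c w * (real (count (N w) e) * monom_fun (N w - {#e#}) x)) - pd e g x)"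
        using pg pN by (subst pd_diff[of E]; (subst pd_sum[of _ E])?)
           (auto intro!: polyfun_intros simp: pd_cmult[OF pN] pd_monom_fun)
      also have "\<dots> = (\<lambda>x. (\<Sum>w\<in>{w \<in> W. e \<in># N w}. c w * real (count (N w) e) * monom_fun (N w - {#e#}) x) - pd e g x)"
        using W by (intro ext arg_cong2[of _ _ _ _ "(-)"] refl sum.mono_neutral_cong_right) (auto simp: not_in_iff)
      finally show "deg_lt E (size M) (\<lambda>x. (\<Sum>w\<in>{w \<in> W. e \<in># N w}. c w * real (count (N w) e) * monom_fun (N w - {#e#}) x) - pd e g x)"
        using deg_lt_pd[OF low, of e] by simp
    qed
    also have "{w\<in>{w\<in>W. e \<in># N w}. N w - {#e#} = M} = {w\<in>W. N w = add_mset e M}"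
      by (auto dest: insert_DiffM)
    finally show ?thesis by (simp add: K'_def sum_distrib_left sum_distrib_right mult_ac)
  qed
  thus ?case using K' by blast
qed

text \<open>As \<open>S - g\<close> is orthogonal to \<open>g\<close>, the square may be replaced by
  \<open>S * g\<close>. Each monomial of \<open>S\<close> then pairs with \<open>g\<close> only
  through the labels carrying the same monomial, and \<open>m\<close> bounds their number.\<close>

lemma Ex_top_chaos_square_le:
  fixes W :: "'w set"
  assumes W: "finite W" and N: "\<And>w. w \<in> W \<Longrightarrow> size (N w) = d \<and> set_mset (N w) \<subseteq> E"
    and g: "chaos E d g" and low: "deg_lt E d (\<lambda>x. c * (\<Sum>w\<in>W. monom_fun (N w) x) - g x)"
    and m: "\<And>w. w \<in> W \<Longrightarrow> card {w'\<in>W. N w' = N w} \<le> m"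
  shows "Ex (\<lambda>x. (g x)\<^sup>2) \<le> c\<^sup>2 * fact d * real m * real (card W)"
proof -
  define S where "S = (\<lambda>x. c * (\<Sum>w\<in>W. monom_fun (N w) x))"
  have pN: "polyfun E (monom_fun (N w))" if "w \<in> W" for w using N that by (auto intro: polyfun_monom_fun)
  have pg: "polyfun E g" using g by (rule chaos_polyfun)
  have pS: "polyfun E S" unfolding S_def by (intro polyfun_intros pN)
  have "Ex (\<lambda>x. (S x - g x) * g x) = 0" using low g unfolding S_def by (rule chaos_lower_orthogonal)
  hence "Ex (\<lambda>x. (g x)\<^sup>2) = Ex (\<lambda>x. S x * g x)"
    using pS pg by (simp add: left_diff_distrib Ex_diff polyfun_intros power2_eq_square)
  also have "\<dots> = c * (\<Sum>w\<in>W. Ex (\<lambda>x. monom_fun (N w) x * g x))"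
  proof -
    have p: "polyfun E (\<lambda>x. \<Sum>w\<in>W. monom_fun (N w) x * g x)"
      by (intro polyfun_sum polyfun_mult pN pg)
    have "Ex (\<lambda>x. S x * g x) = c * Ex (\<lambda>x. \<Sum>w\<in>W. monom_fun (N w) x * g x)"
      unfolding S_def mult.assoc sum_distrib_right by (rule Ex_cmult[OF p])
    thus ?thesis using pN pg by (simp add: Ex_sum polyfun_mult)
  qed
  also have "\<dots> = (\<Sum>w\<in>W. c * Ex (\<lambda>x. monom_fun (N w) x * g x))" by (simp add: sum_distrib_left)
  also have "\<dots> \<le> (\<Sum>w\<in>W. c\<^sup>2 * fact d * real m)"
  proof (rule sum_mono)
    fix w assume w: "w \<in> W"
    have sz: "size (N w) = d" and sub: "set_mset (N w) \<subseteq> E" using N[OF w] by auto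
    from Ex_monom_top_chaos[OF sub] obtain K where K: "0 \<le> K" "K \<le> fact d"
      and KM: "\<forall>W c N' g. finite W \<longrightarrow>
       (\<forall>w\<in>W. size (N' w) = d \<and> set_mset (N' w) \<subseteq> E) \<longrightarrow> chaos E d g \<longrightarrow>
       deg_lt E d (\<lambda>x. (\<Sum>w\<in>W. c w * monom_fun (N' w) x) - g x) \<longrightarrow>
       Ex (\<lambda>x. monom_fun (N w) x * g x) = K * (\<Sum>w'\<in>{w'\<in>W. N' w' = N w}. c (w'::'w))"
      unfolding sz by blast
    have KE: "Ex (\<lambda>x. monom_fun (N w) x * g x) = K * (\<Sum>w'\<in>{w'\<in>W. N w' = N w}. c)"
      using KM[THEN spec, of W, THEN spec, of "\<lambda>_. c", THEN spec, of N, THEN spec, of g] W N g low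
      by (simp add: sum_distrib_left)
    have "c * Ex (\<lambda>x. monom_fun (N w) x * g x) = c\<^sup>2 * (K * real (card {w'\<in>W. N w' = N w}))"
      by (simp add: KE power2_eq_square)
    also have "\<dots> \<le> c\<^sup>2 * (fact d * real m)"
      using K m[OF w] by (intro mult_left_mono mult_mono) auto
    finally show "c * Ex (\<lambda>x. monom_fun (N w) x * g x) \<le> c\<^sup>2 * fact d * real m" by (simp add: mult.assoc)
  qed
  also have "\<dots> = c\<^sup>2 * fact d * real m * real (card W)" by simp
  finally show ?thesis .
qed

end

section \<open>Chebyshev polynomials of a Wigner matrix\<close>

text \<open>For \<open>s = 1\<close> these are the Chebyshev polynomials of the second kind in \<open>t / 2\<close>, for \<open>s = 0\<close> the
  powers of \<open>t\<close>; the parameter lets one differentiation formula serve both.\<close>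
fun tpol :: "real \<Rightarrow> real \<Rightarrow> nat \<Rightarrow> real" where
  "tpol s t 0 = 1"
| "tpol s t (Suc 0) = t"
| "tpol s t (Suc (Suc m)) = t * tpol s t (Suc m) - s * tpol s t m"

lemma tpol_0: "tpol 0 t m = t ^ m"
  by (induction m rule: induct_nat_012) simp_all

lemma tpol_1_bound: "\<bar>tpol 1 t m\<bar> \<le> (1 + \<bar>t\<bar>) ^ m"
proof (induction m rule: induct_nat_012)
  case (ge2 m)
  have "\<bar>tpol 1 t (Suc (Suc m))\<bar> \<le> \<bar>t\<bar> * \<bar>tpol 1 t (Suc m)\<bar> + \<bar>tpol 1 t m\<bar>"
    using abs_triangle_ineq4[of "t * tpol 1 t (Suc m)" "tpol 1 t m"] by (simp add: abs_mult)
  also have "\<dots> \<le> \<bar>t\<bar> * (1 + \<bar>t\<bar>) ^ Suc m + (1 + \<bar>t\<bar>) ^ m"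
    using ge2 by (intro add_mono mult_left_mono) auto
  also have "\<dots> \<le> \<bar>t\<bar> * (1 + \<bar>t\<bar>) ^ Suc m + (1 + \<bar>t\<bar>) ^ Suc m"
    by (simp add: mult_nonneg_nonneg algebra_simps)
  finally show ?case by (simp add: algebra_simps)
qed simp_all

text \<open>The Clebsch-Gordan type rule for Chebyshev polynomials of the second kind. Unrolled, it
  linearises products, and it reduces \<open>W\<close> to traces in \<open>Var_W_le\<close>.\<close>

lemma tpol_1_mult:
  "tpol 1 t (Suc c) * tpol 1 t (Suc d) = tpol 1 t (Suc (Suc (c + d))) + tpol 1 t c * tpol 1 t d"
proof (induction c rule: induct_nat_012)
  case 0 show ?case by simp
next
  case 1
  show ?case by (cases d) (simp_all add: algebra_simps)
next
  case (ge2 c)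
  have "tpol 1 t (Suc (Suc (Suc c))) * tpol 1 t (Suc d)
     = t * (tpol 1 t (Suc (Suc c)) * tpol 1 t (Suc d)) - tpol 1 t (Suc c) * tpol 1 t (Suc d)"
    by (simp add: algebra_simps)
  also have "\<dots> = t * (tpol 1 t (Suc (Suc (Suc c + d))) + tpol 1 t (Suc c) * tpol 1 t d)
      - (tpol 1 t (Suc (Suc (c + d))) + tpol 1 t c * tpol 1 t d)"
    by (simp only: ge2)
  also have "\<dots> = tpol 1 t (Suc (Suc (Suc (Suc c) + d))) + tpol 1 t (Suc (Suc c)) * tpol 1 t d"
    by (simp add: algebra_simps)
  finally show ?case .
qed

text \<open>The two sums are the derivatives of the polynomials of degree \<open>m + 2\<close> and
  \<open>m\<close>, so this is the rule that the derivative of \<open>P_(m+2)\<close> is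
  \<open>m + 2\<close> times the second-kind polynomial of degree \<open>m + 1\<close>.\<close>

lemma tpol_1_convolution:
  "(\<Sum>c<Suc (Suc m). tpol 1 t c * tpol 1 t (Suc m - c)) - (\<Sum>c<m. tpol 1 t c * tpol 1 t (m - 1 - c))
     = real (m + 2) * tpol 1 t (Suc m)"
proof -
  have "(\<Sum>c<Suc (Suc m). tpol 1 t c * tpol 1 t (Suc m - c))
      = 2 * tpol 1 t (Suc m) + (\<Sum>c<m. tpol 1 t (Suc c) * tpol 1 t (m - c))"
    by (subst sum.lessThan_Suc, subst sum.lessThan_Suc_shift) simp
  also have "(\<Sum>c<m. tpol 1 t (Suc c) * tpol 1 t (m - c))
     = (\<Sum>c<m. tpol 1 t (Suc m) + tpol 1 t c * tpol 1 t (m - 1 - c))"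
  proof (intro sum.cong refl)
    fix c assume "c \<in> {..<m}"
    then obtain d where "m = Suc (c + d)" using less_imp_Suc_add by blast
    thus "tpol 1 t (Suc c) * tpol 1 t (m - c) = tpol 1 t (Suc m) + tpol 1 t c * tpol 1 t (m - 1 - c)"
      using tpol_1_mult[of t c d] by simp
  qed
  finally show ?thesis by (simp add: sum.distrib algebra_simps)
qed

lemma rcheb_tpol: "poly (rcheb (Suc (Suc m))) t = tpol 1 t (Suc (Suc m)) - tpol 1 t m"
proof (induction m rule: induct_nat_012)
  case (ge2 m)
  have rec: "poly (rcheb (Suc (Suc m))) t = t * poly (rcheb (Suc m)) t - poly (rcheb m) t" for m
    by (simp add: poly_rcheb cheb_Suc_Suc algebra_simps)
  show ?case by (subst rec) (simp add: ge2 algebra_simps)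
qed (simp_all add: poly_rcheb cheb_Suc_Suc cheb_0 cheb_1 algebra_simps)

text \<open>The matrix with eigenvectors \<open>v l\<close> and eigenvalues \<open>p l\<close>.
  Since \<open>p\<close> is a function of the eigenvalue index, sums and products of functions of
  one matrix are pointwise operations on \<open>p\<close>.\<close>

definition fmat :: "nat \<Rightarrow> (nat \<Rightarrow> nat \<Rightarrow> real) \<Rightarrow> (nat \<Rightarrow> real) \<Rightarrow> nat \<Rightarrow> nat \<Rightarrow> real" where
  "fmat n v p i j = (\<Sum>l<n. p l * v l i * v l j)"

lemma fmat_sym: "fmat n v p i j = fmat n v p j i"
  by (simp add: fmat_def mult_ac)

lemma fmat_sum: "(\<Sum>c\<in>I. fmat n v (p c) i j) = fmat n v (\<lambda>l. \<Sum>c\<in>I. p c l) i j"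
  unfolding fmat_def by (subst sum.swap) (simp add: sum_distrib_right)

lemma fmat_diff: "fmat n v p i j - fmat n v q i j = fmat n v (\<lambda>l. p l - q l) i j"
  by (simp add: fmat_def left_diff_distrib sum_subtractf)

lemma fmat_cmult: "c * fmat n v p i j = fmat n v (\<lambda>l. c * p l) i j"
  by (simp add: fmat_def sum_distrib_left mult_ac)

context
  fixes n C lam v assumes es: "is_eigensystem n C lam v"
begin

lemma fmat_one: "i < n \<Longrightarrow> j < n \<Longrightarrow> fmat n v (\<lambda>_. 1) i j = \<delta> i j"
  using es by (simp add: fmat_def is_eigensystem_def)

lemma fmat_eigenvalues: "i < n \<Longrightarrow> j < n \<Longrightarrow> fmat n v lam i j = C i j"
  using es by (simp add: fmat_def is_eigensystem_def)

lemma fmat_mult: "(\<Sum>k<n. fmat n v p i k * fmat n v q k j) = fmat n v (\<lambda>l. p l * q l) i j"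
proof -
  have "(\<Sum>k<n. fmat n v p i k * fmat n v q k j)
      = (\<Sum>k<n. \<Sum>l<n. \<Sum>m<n. p l * q m * v l i * v m j * (v l k * v m k))"
    by (simp add: fmat_def sum_product mult_ac)
  also have "\<dots> = (\<Sum>l<n. \<Sum>k<n. \<Sum>m<n. p l * q m * v l i * v m j * (v l k * v m k))"
    by (rule sum.swap)
  also have "\<dots> = (\<Sum>l<n. \<Sum>m<n. \<Sum>k<n. p l * q m * v l i * v m j * (v l k * v m k))"
    by (intro sum.cong refl sum.swap)
  also have "\<dots> = (\<Sum>l<n. \<Sum>m<n. \<delta> l m * (p l * q m * v l i * v m j))"
  proof (intro sum.cong refl)
    fix l m assume "l \<in> {..<n}" "m \<in> {..<n}"
    hence "(\<Sum>k<n. v l k * v m k) = \<delta> l m" using es by (simp add: is_eigensystem_def)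
    thus "(\<Sum>k<n. p l * q m * v l i * v m j * (v l k * v m k)) = \<delta> l m * (p l * q m * v l i * v m j)"
      by (simp flip: sum_distrib_left)
  qed
  also have "\<dots> = fmat n v (\<lambda>l. p l * q l) i j" by (simp add: fmat_def)
  finally show ?thesis .
qed

lemma fmat_trace: "(\<Sum>i<n. fmat n v p i i) = (\<Sum>l<n. p l)"
proof -
  have "(\<Sum>i<n. fmat n v p i i) = (\<Sum>l<n. p l * (\<Sum>i<n. v l i * v l i))"
    unfolding fmat_def by (subst sum.swap) (simp add: sum_distrib_left mult.assoc)
  also have "\<dots> = (\<Sum>l<n. p l)" using es by (simp add: is_eigensystem_def \<delta>_def)
  finally show ?thesis .
qed

lemma fmat_inner: "(\<Sum>i<n. \<Sum>j<n. fmat n v p i j * fmat n v q i j) = (\<Sum>l<n. p l * q l)"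
proof -
  have "(\<Sum>i<n. \<Sum>j<n. fmat n v p i j * fmat n v q i j) = (\<Sum>i<n. fmat n v (\<lambda>l. p l * q l) i i)"
    by (intro sum.cong refl) (subst fmat_mult[symmetric], simp add: fmat_sym)
  thus ?thesis by (simp add: fmat_trace)
qed

lemma fmat_row_norm: "(\<Sum>j<n. (fmat n v p i j)\<^sup>2) = fmat n v (\<lambda>l. (p l)\<^sup>2) i i"
  using fmat_mult[of p i p i] by (simp add: fmat_sym[of n v p _ i] power2_eq_square)

lemma fmat_diag_mono: "(\<And>l. p l \<le> q l) \<Longrightarrow> fmat n v p i i \<le> fmat n v q i i"
  unfolding fmat_def mult.assoc by (intro sum_mono mult_right_mono) auto

lemma fmat_diag_abs: "\<bar>fmat n v p i i\<bar> \<le> fmat n v (\<lambda>l. \<bar>p l\<bar>) i i"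
  unfolding fmat_def by (rule order_trans[OF sum_abs]) (simp add: abs_mult mult.assoc abs_mult_self_eq)

lemma fmat_diag_square: 
  assumes "i < n" shows "(fmat n v p i i)\<^sup>2 \<le> fmat n v (\<lambda>l. (p l)\<^sup>2) i i"
proof -
  have "(fmat n v p i i)\<^sup>2 \<le> (\<Sum>j<n. (fmat n v p i j)\<^sup>2)"
    using assms by (intro member_le_sum[of i "{..<n}" "\<lambda>j. (fmat n v p i j)\<^sup>2"]) auto
  thus ?thesis by (simp add: fmat_row_norm)
qed

text \<open>Diagonal entries are averages over the spectral measures with weights
  \<open>(v l i)^2\<close>. The pointwise bound is integrated against the product of two such
  measures, each of total mass one.\<close>

lemma fmat_diag_mult_le:
  assumes i: "i < n" and j: "j < n" and pq: "\<And>l m. \<bar>p l\<bar> * \<bar>q m\<bar> \<le> r l + r m"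
  shows "\<bar>fmat n v p i i * fmat n v q j j\<bar> \<le> fmat n v r i i + fmat n v r j j"
proof -
  have "\<bar>fmat n v p i i * fmat n v q j j\<bar> \<le> fmat n v (\<lambda>l. \<bar>p l\<bar>) i i * fmat n v (\<lambda>l. \<bar>q l\<bar>) j j"
    unfolding abs_mult by (intro mult_mono fmat_diag_abs order_trans[OF abs_ge_zero fmat_diag_abs]) auto
  also have "\<dots> = (\<Sum>l<n. \<Sum>m<n. (\<bar>p l\<bar> * \<bar>q m\<bar>) * ((v l i)\<^sup>2 * (v m j)\<^sup>2))"
    by (simp add: fmat_def sum_product power2_eq_square mult_ac)
  also have "\<dots> \<le> (\<Sum>l<n. \<Sum>m<n. (r l + r m) * ((v l i)\<^sup>2 * (v m j)\<^sup>2))"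
    using pq by (intro sum_mono mult_right_mono) auto
  also have "\<dots> = fmat n v r i i * fmat n v (\<lambda>_. 1) j j + fmat n v (\<lambda>_. 1) i i * fmat n v r j j"
    unfolding fmat_def sum_product sum.distrib[symmetric]
    by (intro sum.cong refl) (simp add: power2_eq_square algebra_simps)
  also have "\<dots> = fmat n v r i i + fmat n v r j j"
    using i j by (simp add: fmat_one \<delta>_def)
  finally show ?thesis .
qed

end

text \<open>The recursion of \<open>tpol\<close> on matrices, without reference to eigenvalues. In
  this form the entries are visibly polynomial functions of the matrix entries and can be
  differentiated.\<close>

fun tmat :: "real \<Rightarrow> nat \<Rightarrow> (nat \<Rightarrow> nat \<Rightarrow> real) \<Rightarrow> nat \<Rightarrow> nat \<Rightarrow> nat \<Rightarrow> real" where
  "tmat s n C 0 i j = \<delta> i j"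
| "tmat s n C (Suc 0) i j = C i j"
| "tmat s n C (Suc (Suc m)) i j = (\<Sum>l<n. C i l * tmat s n C (Suc m) l j) - s * tmat s n C m i j"

lemma tmat_eigen:
  assumes "is_eigensystem n C lam v" "i < n" "j < n"
  shows "tmat s n C m i j = fmat n v (\<lambda>l. tpol s (lam l) m) i j"
  using assms(2)
proof (induction m arbitrary: i rule: induct_nat_012)
  case (ge2 m)
  have "tmat s n C (Suc (Suc m)) i j
     = (\<Sum>k<n. fmat n v lam i k * fmat n v (\<lambda>l. tpol s (lam l) (Suc m)) k j) - s * fmat n v (\<lambda>l. tpol s (lam l) m) i j"
    using ge2 assms by (simp add: fmat_eigenvalues[OF assms(1)])
  also have "\<dots> = fmat n v (\<lambda>l. tpol s (lam l) (Suc (Suc m))) i j"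
    by (simp only: fmat_mult[OF assms(1)] fmat_cmult[of s] fmat_diff tpol.simps)
  finally show ?case .
qed (use assms in \<open>simp_all add: fmat_one[OF assms(1)] fmat_eigenvalues[OF assms(1)]\<close>)

section \<open>Derivatives of Chebyshev polynomials of the random matrix\<close>

definition edges :: "nat \<Rightarrow> (nat \<times> nat) set" where
  "edges n = {(i, j). i < j \<and> j < n}"

lemma finite_edges: "finite (edges n)"
  by (rule finite_subset[of _ "{..<n} \<times> {..<n}"]) (auto simp: edges_def)

lemma sum_edges_sym:
  fixes f :: "nat \<Rightarrow> nat \<Rightarrow> real"
  shows "(\<Sum>(p, q)\<in>edges n. f p q + f q p) = (\<Sum>p<n. \<Sum>q<n. f p q) - (\<Sum>p<n. f p p)"
proof -
  have "(\<Sum>(p, q)\<in>edges n. f q p) = (\<Sum>(p, q)\<in>prod.swap ` edges n. f p q)"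
    by (subst sum.reindex) (auto simp: case_prod_unfold)
  have "(\<Sum>(p, q)\<in>edges n. f p q + f q p) = (\<Sum>(p, q)\<in>edges n \<union> prod.swap ` edges n. f p q)"
  proof -
    have "edges n \<inter> prod.swap ` edges n = {}" by (auto simp: edges_def)
    hence "(\<Sum>(p, q)\<in>edges n \<union> prod.swap ` edges n. f p q) = (\<Sum>(p, q)\<in>edges n. f p q) + (\<Sum>(p, q)\<in>prod.swap ` edges n. f p q)"
      by (intro sum.union_disjoint) (auto simp: finite_edges)
    thus ?thesis
      using \<open>(\<Sum>(p, q)\<in>edges n. f q p) = _\<close> by (simp add: case_prod_unfold sum.distrib)
  qed
  also have "\<dots> = (\<Sum>(p, q)\<in>{..<n} \<times> {..<n} - (\<lambda>p. (p, p)) ` {..<n}. f p q)"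
    by (intro sum.cong) (force simp: edges_def image_iff)+
  also have "\<dots> = (\<Sum>(p, q)\<in>{..<n} \<times> {..<n}. f p q) - (\<Sum>(p, q)\<in>(\<lambda>p. (p, p)) ` {..<n}. f p q)"
    by (intro sum_diff) auto
  also have "(\<Sum>(p, q)\<in>(\<lambda>p. (p, p)) ` {..<n}. f p q) = (\<Sum>p<n. f p p)"
    by (subst sum.reindex) (auto simp: inj_on_def)
  finally show ?thesis by (simp add: sum.cartesian_product)
qed

definition entry :: "nat \<Rightarrow> nat \<Rightarrow> (nat \<times> nat \<Rightarrow> real) \<Rightarrow> real" where
  "entry i j x = (if i = j then 0 else x (min i j, max i j))"

lemma entry_sym: "entry i j x = entry j i x"
  by (simp add: entry_def min.commute max.commute)

lemma deg_lt_entry: "i < n \<Longrightarrow> j < n \<Longrightarrow> deg_lt (edges n) (Suc (Suc 0)) (entry i j)"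
proof (cases "i = j")
  case False
  assume "i < n" "j < n"
  with False have "(min i j, max i j) \<in> edges n" by (auto simp: edges_def min_def max_def)
  from deg_lt_coord[OF this] False show ?thesis by (simp add: entry_def[abs_def])
qed (simp add: entry_def[abs_def] deg_lt_0)

lemma pd_entry:
  assumes "p < q"
  shows "pd (p, q) (entry i j) = (\<lambda>x. \<delta> i p * \<delta> q j + \<delta> i q * \<delta> p j)"
  using assms
  by (cases i j rule: linorder_cases) (auto simp: entry_def[abs_def] pd_const pd_coord \<delta>_def fun_eq_iff min_def max_def)

locale matrix_size =
  fixes n :: nat
  assumes n_pos: "0 < n"
begin

definition B :: "(nat \<times> nat \<Rightarrow> real) \<Rightarrow> nat \<Rightarrow> nat \<Rightarrow> real" where
  "B x i j = entry i j x / sqrt (real n)"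

definition V :: "real \<Rightarrow> nat \<Rightarrow> nat \<Rightarrow> nat \<Rightarrow> (nat \<times> nat \<Rightarrow> real) \<Rightarrow> real" where
  "V s m i j x = tmat s n (B x) m i j"

lemma V_simps:
  "V s 0 i j x = \<delta> i j" "V s (Suc 0) i j x = B x i j"
  "V s (Suc (Suc m)) i j x = (\<Sum>l<n. B x i l * V s (Suc m) l j x) - s * V s m i j x"
  by (simp_all add: V_def)

lemma V_step: "(\<Sum>l<n. B x i l * V s m l j x) = V s (Suc m) i j x + (if m = 0 then 0 else s * V s (m - 1) i j x)" if "j < n"
  using that by (cases m) (simp_all add: V_simps)

lemma eigensystem_B: "\<exists>lam v. is_eigensystem n (B x) lam v"
  by (rule eigensystem_exists) (simp add: B_def entry_sym)

lemma V_sym: "i < n \<Longrightarrow> j < n \<Longrightarrow> V s m i j x = V s m j i x"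
  using eigensystem_B[of x] by (auto simp: V_def tmat_eigen fmat_sym)

lemma deg_lt_B: "i < n \<Longrightarrow> j < n \<Longrightarrow> deg_lt (edges n) (Suc (Suc 0)) (\<lambda>x. B x i j)"
  using deg_lt_cmult[OF deg_lt_entry, of i n j "1 / sqrt (real n)"] by (simp add: B_def)

lemma deg_lt_V:
  assumes "j < n" shows "i < n \<Longrightarrow> deg_lt (edges n) (Suc m) (V s m i j)"
proof (induction m arbitrary: i rule: induct_nat_012)
  case 0
  show ?case by (simp add: V_simps[abs_def] deg_lt_const)
next
  case 1
  thus ?case using assms by (simp add: V_simps[abs_def] deg_lt_B)
next
  case (ge2 m)
  have "deg_lt (edges n) (Suc (Suc (Suc m))) (\<lambda>x. B x i l * V s (Suc m) l j x)" if "l < n" for l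
    using deg_lt_mult[OF deg_lt_B[of i l] ge2.IH(2)[of l]] ge2.prems that by simp
  moreover have "deg_lt (edges n) (Suc (Suc (Suc m))) (V s m i j)"
    by (rule deg_lt_mono[OF ge2.IH(1)[OF ge2.prems]]) simp
  ultimately show ?case unfolding V_simps[abs_def]
    by (intro deg_lt_diff deg_lt_sum deg_lt_cmult) auto
qed

lemma polyfun_V: "i < n \<Longrightarrow> j < n \<Longrightarrow> polyfun (edges n) (V s m i j)"
  using deg_lt_V deg_lt_imp_polyfun by blast

lemma polyfun_B: "i < n \<Longrightarrow> j < n \<Longrightarrow> polyfun (edges n) (\<lambda>x. B x i j)"
  using deg_lt_B deg_lt_imp_polyfun by blast

lemma pd_B: "p < q \<Longrightarrow> i < n \<Longrightarrow> j < n \<Longrightarrow> 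
    pd (p, q) (\<lambda>x. B x i j) = (\<lambda>x. (\<delta> i p * \<delta> q j + \<delta> i q * \<delta> p j) / sqrt (real n))"
  using pd_cmult[OF deg_lt_imp_polyfun[OF deg_lt_entry], of i n j "(p, q)" "1 / sqrt (real n)"]
  by (simp add: B_def pd_entry)

text \<open>In the product rule for the recursion, the correction terms with factor \<open>s\<close>
  telescope. For \<open>c = 0\<close> no correction occurs, as there is no polynomial of index
  -1.\<close>

lemma convolution_step:
  fixes f g :: "nat \<Rightarrow> real"
  shows "(\<Sum>c<Suc m. (f (Suc c) + (if c = 0 then 0 else s * f (c - 1))) * g (m - c)) - s * (\<Sum>c<m. f c * g (m - 1 - c))
     = (\<Sum>c<Suc m. f (Suc c) * g (m - c))"
proof -
  have "(\<Sum>c<Suc m. (f (Suc c) + (if c = 0 then 0 else s * f (c - 1))) * g (m - c))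
     = (\<Sum>c<Suc m. f (Suc c) * g (m - c)) + (\<Sum>c<Suc m. (if c = 0 then 0 else s * f (c - 1)) * g (m - c))"
    by (simp only: distrib_right sum.distrib)
  also have "(\<Sum>c<Suc m. (if c = 0 then 0 else s * f (c - 1)) * g (m - c)) = s * (\<Sum>c<m. f c * g (m - 1 - c))"
    by (subst sum.lessThan_Suc_shift) (simp add: sum_distrib_left mult.assoc)
  finally show ?thesis by simp
qed

text \<open>The generating function in \<open>z\<close> of these matrices is the inverse of
  \<open>1 - z B + s z^2\<close>. Differentiating an inverse puts the derivative of \<open>B\<close>
  between two copies of it; coefficients give this convolution, for every \<open>s\<close>.\<close>

lemma pd_V:
  assumes pq: "p < q" "q < n" and j: "j < n" and i: "i < n"
  shows "pd (p, q) (V s m i j) = (\<lambda>x. (\<Sum>c<m. V s c i p x * V s (m - 1 - c) q j x + V s c i q x * V s (m - 1 - c) p j x) / sqrt (real n))"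
  using i
proof (induction m arbitrary: i rule: induct_nat_012)
  case 0
  show ?case by (simp add: V_simps[abs_def] pd_const)
next
  case 1
  thus ?case using assms by (simp add: V_simps[abs_def] pd_B)
next
  case (ge2 m)
  have p: "p < n" using pq by simp
  define r where "r = sqrt (real n)"
  have "pd (p, q) (V s (Suc (Suc m)) i j) = (\<lambda>x. (\<Sum>l<n. pd (p, q) (\<lambda>x. B x i l) x * V s (Suc m) l j x
        + B x i l * pd (p, q) (V s (Suc m) l j) x) - s * pd (p, q) (V s m i j) x)"
    unfolding V_simps[abs_def] using ge2.prems j
    by (subst pd_diff[of "edges n"], (intro polyfun_intros polyfun_B polyfun_V; simp)+,
        subst pd_sum[of _ "edges n"], (intro polyfun_intros polyfun_B polyfun_V; simp),
        subst pd_cmult[of "edges n"], (intro polyfun_V; simp))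
       (simp add: pd_mult[OF polyfun_B polyfun_V])
  also have "\<dots> = (\<lambda>x. (\<Sum>c<Suc (Suc m). V s c i p x * V s (Suc m - c) q j x + V s c i q x * V s (Suc m - c) p j x) / r)"
  proof
    fix x
    have "(\<Sum>l<n. pd (p, q) (\<lambda>x. B x i l) x * V s (Suc m) l j x)
        = (\<Sum>l<n. (\<delta> i p * (\<delta> q l * V s (Suc m) l j x) + \<delta> i q * (\<delta> p l * V s (Suc m) l j x)) / r)"
      using pq ge2.prems by (intro sum.cong refl) (simp add: pd_B r_def algebra_simps)
    also have "\<dots> = (\<delta> i p * V s (Suc m) q j x + \<delta> i q * V s (Suc m) p j x) / r"
      using pq p by (simp only: sum_divide_distrib[symmetric] sum.distrib sum_distrib_left[symmetric] sum_delta_mult)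
    finally have 1: "(\<Sum>l<n. pd (p, q) (\<lambda>x. B x i l) x * V s (Suc m) l j x)
      = (V s 0 i p x * V s (Suc m) q j x + V s 0 i q x * V s (Suc m) p j x) / r" by (simp add: V_simps)
    have "(\<Sum>l<n. B x i l * pd (p, q) (V s (Suc m) l j) x)
       = (\<Sum>l<n. \<Sum>c<Suc m. (B x i l * V s c l p x * V s (m - c) q j x + B x i l * V s c l q x * V s (m - c) p j x) / r)"
      by (intro sum.cong refl) (simp add: ge2.IH(2) r_def sum_distrib_left sum_divide_distrib distrib_left mult.assoc del: sum.lessThan_Suc)
    also have "\<dots> = (\<Sum>c<Suc m. \<Sum>l<n. (B x i l * V s c l p x * V s (m - c) q j x + B x i l * V s c l q x * V s (m - c) p j x) / r)"
      by (rule sum.swap)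
    also have "\<dots> = (\<Sum>c<Suc m. ((\<Sum>l<n. B x i l * V s c l p x) * V s (m - c) q j x + (\<Sum>l<n. B x i l * V s c l q x) * V s (m - c) p j x)) / r"
      by (simp add: sum.distrib sum_distrib_right sum_divide_distrib add_divide_distrib del: sum.lessThan_Suc)
    finally have 2: "(\<Sum>l<n. B x i l * pd (p, q) (V s (Suc m) l j) x)
       = ((\<Sum>c<Suc m. (V s (Suc c) i p x + (if c = 0 then 0 else s * V s (c - 1) i p x)) * V s (m - c) q j x)
         + (\<Sum>c<Suc m. (V s (Suc c) i q x + (if c = 0 then 0 else s * V s (c - 1) i q x)) * V s (m - c) p j x)) / r"
      using p pq by (simp add: V_step sum.distrib del: sum.lessThan_Suc)
    have 3: "s * pd (p, q) (V s m i j) x = (s * (\<Sum>c<m. V s c i p x * V s (m - 1 - c) q j x) + s * (\<Sum>c<m. V s c i q x * V s (m - 1 - c) p j x)) / r"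
      using ge2.IH(1)[OF ge2.prems] by (simp add: r_def sum.distrib distrib_left)
    show "(\<Sum>l<n. pd (p, q) (\<lambda>x. B x i l) x * V s (Suc m) l j x
        + B x i l * pd (p, q) (V s (Suc m) l j) x) - s * pd (p, q) (V s m i j) x
       = (\<Sum>c<Suc (Suc m). V s c i p x * V s (Suc m - c) q j x + V s c i q x * V s (Suc m - c) p j x) / r"
      unfolding sum.distrib 1 2 3
      using convolution_step[of "\<lambda>c. V s c i p x" s "\<lambda>c. V s c q j x" m] convolution_step[of "\<lambda>c. V s c i q x" s "\<lambda>c. V s c p j x" m]
      by (simp only: sum.lessThan_Suc_shift[of _ "Suc m"] add_divide_distrib[symmetric] diff_divide_distrib[symmetric]) simp
  qed
  finally show ?case by (simp add: r_def del: sum.lessThan_Suc)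
qed

definition Z :: "real \<Rightarrow> nat \<Rightarrow> (nat \<times> nat \<Rightarrow> real) \<Rightarrow> real" where
  "Z s m x = (\<Sum>i<n. V s m i i x)"

definition W :: "real \<Rightarrow> nat \<Rightarrow> nat \<Rightarrow> (nat \<times> nat \<Rightarrow> real) \<Rightarrow> real" where
  "W s c d x = (\<Sum>i<n. \<Sum>j<n. V s c i j x * V s d i j x)"

definition Y :: "real \<Rightarrow> nat \<Rightarrow> nat \<Rightarrow> (nat \<times> nat \<Rightarrow> real) \<Rightarrow> real" where
  "Y s c d x = (\<Sum>i<n. V s c i i x * V s d i i x)"

text \<open>The outcome of integrating \<open>T\<close> by parts. The unit matrix in position
  \<open>(p, q)\<close> and its transpose produce the terms with \<open>Z\<close> and
  \<open>W\<close>; \<open>2 Y\<close> removes the contribution of \<open>p = q\<close>, because the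
  diagonal of the matrix is zero.\<close>

definition Q :: "real \<Rightarrow> nat \<Rightarrow> (nat \<times> nat \<Rightarrow> real) \<Rightarrow> real" where
  "Q s m x = (\<Sum>c<m. Z s c x * Z s (m - 1 - c) x + W s c (m - 1 - c) x - 2 * Y s c (m - 1 - c) x) / real n"

definition T :: "real \<Rightarrow> nat \<Rightarrow> (nat \<times> nat \<Rightarrow> real) \<Rightarrow> real" where
  "T s m x = (\<Sum>i<n. \<Sum>j<n. B x i j * V s m i j x)"

lemma deg_lt_Z: "deg_lt (edges n) (Suc m) (Z s m)"
  unfolding Z_def by (intro deg_lt_sum deg_lt_V) auto

lemma polyfun_Z: "polyfun (edges n) (Z s m)"
  by (rule deg_lt_imp_polyfun[OF deg_lt_Z])

lemma polyfun_W: "polyfun (edges n) (W s c d)"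
  unfolding W_def by (intro polyfun_intros polyfun_V) auto

lemma polyfun_Y: "polyfun (edges n) (Y s c d)"
  unfolding Y_def by (intro polyfun_intros polyfun_V) auto

lemma polyfun_Q: "polyfun (edges n) (Q s m)"
  unfolding Q_def by (intro polyfun_intros polyfun_Z polyfun_W polyfun_Y)

lemma T_eq: "T s (Suc m) x = Z s (Suc (Suc m)) x + s * Z s m x"
proof -
  have "T s (Suc m) x = (\<Sum>i<n. \<Sum>j<n. B x i j * V s (Suc m) j i x)"
    unfolding T_def by (intro sum.cong refl) (simp add: V_sym)
  thus ?thesis by (simp add: Z_def V_step sum.distrib sum_distrib_left)
qed

context
  fixes x lam v assumes es: "is_eigensystem n (B x) lam v"
begin

lemma V_fmat: "i < n \<Longrightarrow> j < n \<Longrightarrow> V s m i j x = fmat n v (\<lambda>l. tpol s (lam l) m) i j"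
  using es by (simp add: V_def tmat_eigen)

lemma Z_eigen: "Z s m x = (\<Sum>l<n. tpol s (lam l) m)"
  by (simp add: Z_def V_fmat fmat_trace[OF es])

lemma W_eigen: "W s c d x = (\<Sum>l<n. tpol s (lam l) c * tpol s (lam l) d)"
  by (simp add: W_def V_fmat fmat_inner[OF es])

end

lemma sum_pd_V:
  "(\<Sum>(p, q)\<in>edges n. pd (p, q) (V s m p q) x) = sqrt (real n) / 2 * Q s m x"
proof -
  define r where "r = sqrt (real n)"
  have r: "r > 0" "r * r = real n" using n_pos by (auto simp: r_def)
  define h where "h p q = (\<Sum>c<m. V s c p p x * V s (m - 1 - c) q q x + V s c p q x * V s (m - 1 - c) p q x)" for p q
  \<comment> \<open>Reversing the order of summation exchanges the two factors and makes
    \<open>h\<close> symmetric, so a sum over edges becomes half of a sum over ordered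
    pairs.\<close>
  have rev: "(\<Sum>c<m. V s c p p x * V s (m - 1 - c) q q x) = (\<Sum>c<m. V s c q q x * V s (m - 1 - c) p p x)" for p q
    by (subst sum.nat_diff_reindex[symmetric]) (auto intro!: sum.cong simp: mult.commute)
  have hs: "h p q = h q p" if "p < n" "q < n" for p q
    unfolding h_def sum.distrib rev[of p q] using that by (simp add: V_sym[of p q])
  have "(\<Sum>(p, q)\<in>edges n. pd (p, q) (V s m p q) x) = (\<Sum>(p, q)\<in>edges n. h p q + h q p) / (2 * r)"
    unfolding sum_divide_distrib
  proof (intro sum.cong refl, clarify)
    fix p q assume "(p, q) \<in> edges n"
    hence pq: "p < q" "q < n" by (auto simp: edges_def)
    hence "pd (p, q) (V s m p q) x = h p q / r" by (simp add: pd_V h_def r_def)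
    also have "\<dots> = (h p q + h q p) / (2 * r)" using pq hs[of p q] by simp
    finally show "pd (p, q) (V s m p q) x = (h p q + h q p) / (2 * r)" .
  qed
  also have "\<dots> = ((\<Sum>p<n. \<Sum>q<n. h p q) - (\<Sum>p<n. h p p)) / (2 * r)" by (simp only: sum_edges_sym)
  also have "(\<Sum>p<n. \<Sum>q<n. h p q) = (\<Sum>c<m. Z s c x * Z s (m - 1 - c) x + W s c (m - 1 - c) x)"
  proof -
    have "(\<Sum>p<n. \<Sum>q<n. h p q) = (\<Sum>c<m. \<Sum>p<n. \<Sum>q<n. V s c p p x * V s (m - 1 - c) q q x + V s c p q x * V s (m - 1 - c) p q x)"
      unfolding h_def by (subst (2) sum.swap, subst sum.swap) (rule refl)
    thus ?thesis by (simp add: Z_def W_def sum_product sum.distrib)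
  qed
  also have "(\<Sum>p<n. h p p) = (\<Sum>c<m. 2 * Y s c (m - 1 - c) x)"
    unfolding h_def Y_def by (subst sum.swap) (simp add: sum_distrib_left)
  also have "((\<Sum>c<m. Z s c x * Z s (m - 1 - c) x + W s c (m - 1 - c) x) - (\<Sum>c<m. 2 * Y s c (m - 1 - c) x)) / (2 * r)
     = r / 2 * Q s m x"
    unfolding Q_def sum_subtractf r(2)[symmetric] using r(1) by (simp add: field_simps)
  finally show ?thesis by (simp add: r_def)
qed

lemma T_edges: "T s m x = 2 / sqrt (real n) * (\<Sum>(p, q)\<in>edges n. x (p, q) * V s m p q x)"
proof -
  define h where "h p q = B x p q * V s m p q x" for p q
  have "2 / sqrt (real n) * (\<Sum>(p, q)\<in>edges n. x (p, q) * V s m p q x) = (\<Sum>(p, q)\<in>edges n. h p q + h q p)"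
    unfolding sum_distrib_left
    by (intro sum.cong refl) (auto simp: h_def edges_def B_def entry_def V_sym)
  also have "\<dots> = T s m x" unfolding sum_edges_sym by (simp add: T_def h_def B_def entry_def)
  finally show ?thesis ..
qed

lemma pd_Z:
  assumes "is_eigensystem n (B x) lam v" "p < q" "q < n"
  shows "pd (p, q) (Z s m) x = 2 / sqrt (real n) * fmat n v (\<lambda>l. \<Sum>c<m. tpol s (lam l) c * tpol s (lam l) (m - 1 - c)) p q"
proof -
  have p: "p < n" using assms by simp
  note e = V_fmat[OF assms(1)]
  have "pd (p, q) (Z s m) x = (\<Sum>i<n. pd (p, q) (V s m i i) x)"
    unfolding Z_def by (subst pd_sum[of _ "edges n"]) (auto intro: polyfun_V)
  also have "\<dots> = (\<Sum>i<n. \<Sum>c<m. V s c i p x * V s (m - 1 - c) q i x + V s c i q x * V s (m - 1 - c) p i x) / sqrt (real n)"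
    unfolding sum_divide_distrib[of _ "{..<n}"] using assms by (intro sum.cong refl) (simp add: pd_V)
  also have "(\<Sum>i<n. \<Sum>c<m. V s c i p x * V s (m - 1 - c) q i x + V s c i q x * V s (m - 1 - c) p i x)
    = (\<Sum>c<m. \<Sum>i<n. V s (m - 1 - c) q i x * V s c i p x + V s (m - 1 - c) p i x * V s c i q x)"
    by (subst sum.swap) (simp add: mult.commute)
  also have "\<dots> = (\<Sum>c<m. 2 * fmat n v (\<lambda>l. tpol s (lam l) c * tpol s (lam l) (m - 1 - c)) p q)"
    using p assms by (intro sum.cong refl)
      (simp add: e sum.distrib fmat_mult[OF assms(1)], simp add: fmat_sym[of _ _ _ q p] mult.commute)
  also have "\<dots> = 2 * fmat n v (\<lambda>l. \<Sum>c<m. tpol s (lam l) c * tpol s (lam l) (m - 1 - c)) p q"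
    by (simp only: sum_distrib_left[symmetric] fmat_sum)
  finally show ?thesis by simp
qed

text \<open>The trace of the rescaled Chebyshev polynomial of degree \<open>m + 2\<close>.\<close>
definition F :: "nat \<Rightarrow> (nat \<times> nat \<Rightarrow> real) \<Rightarrow> real" where
  "F m x = Z 1 (Suc (Suc m)) x - Z 1 m x"

lemma deg_lt_F: "deg_lt (edges n) (Suc (Suc (Suc m))) (F m)"
  unfolding F_def by (intro deg_lt_diff deg_lt_Z deg_lt_mono[OF deg_lt_Z]) auto

lemma polyfun_F: "polyfun (edges n) (F m)"
  by (rule deg_lt_imp_polyfun[OF deg_lt_F])

text \<open>By \<open>tpol_1_convolution\<close> the gradient of the Chebyshev trace collapses to
  single matrix entries. A second derivative is therefore needed only of an entry, which is what
  makes \<open>OU F\<close> computable.\<close>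

lemma pd_F:
  assumes "p < q" "q < n"
  shows "pd (p, q) (F m) = (\<lambda>x. 2 * real (m + 2) / sqrt (real n) * V 1 (Suc m) p q x)"
proof
  fix x
  obtain lam v where es: "is_eigensystem n (B x) lam v" using eigensystem_B by blast
  have "pd (p, q) (F m) x = pd (p, q) (Z 1 (Suc (Suc m))) x - pd (p, q) (Z 1 m) x"
    unfolding F_def by (subst pd_diff[OF polyfun_Z polyfun_Z]) simp
  also have "\<dots> = 2 / sqrt (real n) * fmat n v (\<lambda>l. real (m + 2) * tpol 1 (lam l) (Suc m)) p q"
    unfolding pd_Z[OF es assms] right_diff_distrib[symmetric] fmat_diff
    using tpol_1_convolution[of "lam _" m] by simp
  also have "\<dots> = 2 * real (m + 2) / sqrt (real n) * V 1 (Suc m) p q x"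
    using assms by (simp add: V_def tmat_eigen[OF es] fmat_cmult[symmetric])
  finally show "pd (p, q) (F m) x = \<dots>" .
qed

lemma OU_F: "OU (edges n) (F m) = (\<lambda>x. real (m + 2) * (Q 1 (Suc m) x - T 1 (Suc m) x))"
proof
  fix x
  define r where "r = sqrt (real n)"
  have r: "r > 0" using n_pos by (auto simp: r_def)
  have "OU (edges n) (F m) x = (\<Sum>(p, q)\<in>edges n. 2 * real (m + 2) / r * pd (p, q) (V 1 (Suc m) p q) x
       - 2 * real (m + 2) / r * (x (p, q) * V 1 (Suc m) p q x))"
    unfolding OU_def
  proof (intro sum.cong refl, clarify)
    fix p q assume "(p, q) \<in> edges n"
    hence pq: "p < q" "q < n" by (auto simp: edges_def)
    show "pd (p, q) (pd (p, q) (F m)) x - x (p, q) * pd (p, q) (F m) x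
      = 2 * real (m + 2) / r * pd (p, q) (V 1 (Suc m) p q) x - 2 * real (m + 2) / r * (x (p, q) * V 1 (Suc m) p q x)"
      using pq by (simp only: pd_F pd_cmult[OF polyfun_V] less_trans[OF pq] r_def) simp
  qed
  also have "\<dots> = 2 * real (m + 2) / r * (\<Sum>(p, q)\<in>edges n. pd (p, q) (V 1 (Suc m) p q) x)
       - 2 * real (m + 2) / r * (\<Sum>(p, q)\<in>edges n. x (p, q) * V 1 (Suc m) p q x)"
    by (simp add: case_prod_unfold sum_subtractf sum_distrib_left)
  also have "\<dots> = real (m + 2) * (Q 1 (Suc m) x - T 1 (Suc m) x)"
    unfolding sum_pd_V T_edges using r by (simp add: r_def[symmetric] field_simps)
  finally show "OU (edges n) (F m) x = \<dots>" .
qed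

text \<open>The two extreme summands contain \<open>Z 1 0 = n\<close>, which cancels the
  normalisation; they are split off since they are not small.\<close>

lemma Q_1_expand:
  "Q 1 (Suc (Suc m)) x = 2 * Z 1 (Suc m) x + ((\<Sum>c<m. Z 1 (Suc c) x * Z 1 (m - c) x)
     + (\<Sum>c<Suc (Suc m). W 1 c (Suc m - c) x - 2 * Y 1 c (Suc m - c) x)) / real n"
proof -
  have Z0: "Z 1 0 x = real n" by (simp add: Z_def V_simps \<delta>_def)
  have "(\<Sum>c<Suc (Suc m). Z 1 c x * Z 1 (Suc m - c) x) = 2 * real n * Z 1 (Suc m) x + (\<Sum>c<m. Z 1 (Suc c) x * Z 1 (m - c) x)"
    by (subst sum.lessThan_Suc, subst sum.lessThan_Suc_shift) (simp add: Z0)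
  thus ?thesis using n_pos unfolding Q_def by (simp add: sum.distrib sum_subtractf field_simps del: sum.lessThan_Suc)
qed

text \<open>The linear terms add up to
  \<open>2 Z_(m+1) - (Z_(m+3) + Z_(m+1)) + (Z_(m+3) - Z_(m+1)) = 0\<close>, so that everything left
  carries the factor \<open>1 / n\<close>.\<close>

lemma OU_F_remainder:
  "OU (edges n) (F (Suc m)) x + real (m + 3) * F (Suc m) x
     = real (m + 3) * ((\<Sum>c<m. Z 1 (Suc c) x * Z 1 (m - c) x) / real n
         + (\<Sum>c<Suc (Suc m). W 1 c (Suc m - c) x - 2 * Y 1 c (Suc m - c) x) / real n)"
  unfolding OU_F Q_1_expand T_eq add_divide_distrib by (simp add: F_def algebra_simps)

end

section \<open>Variance bounds\<close>

lemma power_mult_le_sum: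
  fixes a b :: real
  assumes "c + d = 2 * q"
  shows "\<bar>a ^ c\<bar> * \<bar>b ^ d\<bar> \<le> a ^ (2 * q) + b ^ (2 * q)"
proof -
  define M where "M = max \<bar>a\<bar> \<bar>b\<bar>"
  have "\<bar>a ^ c\<bar> * \<bar>b ^ d\<bar> \<le> M ^ c * M ^ d"
    unfolding power_abs M_def by (intro mult_mono power_mono) auto
  also have "\<dots> = M ^ (2 * q)" by (simp add: assms flip: power_add)
  also have "\<dots> \<le> \<bar>a\<bar> ^ (2 * q) + \<bar>b\<bar> ^ (2 * q)" unfolding M_def by (auto simp: max_def)
  finally show ?thesis by (simp add: power_even_abs)
qed

lemma one_plus_power_le:
  fixes t :: real
  assumes "j \<le> 2 * N"
  shows "(1 + \<bar>t\<bar>) ^ j \<le> 4 ^ N * (1 + t ^ (2 * N))"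
proof -
  define M where "M = max 1 \<bar>t\<bar>"
  have "(1 + \<bar>t\<bar>) ^ j \<le> (1 + \<bar>t\<bar>) ^ (2 * N)" using assms by (intro power_increasing) auto
  also have "\<dots> \<le> (2 * M) ^ (2 * N)" unfolding M_def by (intro power_mono) auto
  also have "\<dots> = 4 ^ N * M ^ (2 * N)" by (simp add: power_mult_distrib power_mult)
  also have "M ^ (2 * N) \<le> 1 + \<bar>t\<bar> ^ (2 * N)" unfolding M_def by (auto simp: max_def)
  finally show ?thesis by (simp add: power_even_abs)
qed

lemma mean_square_le: "((\<Sum>l<n. p l) / real n)\<^sup>2 \<le> (\<Sum>l<n. (p l)\<^sup>2) / real (n::nat)" if "n > 0" for p :: "nat \<Rightarrow> real"
  using sum_squared_le_sum_of_squares[of p "{..<n}"] that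
  by (simp add: power_divide divide_simps power2_eq_square)

text \<open>The exponent 8 is reached by applying the inequality for squares three times.\<close>

lemma mean_power8_le:
  fixes p :: "nat \<Rightarrow> real"
  assumes n: "n > 0"
  shows "((\<Sum>l<n. p l) / real n) ^ 8 \<le> (\<Sum>l<n. (p l) ^ 8) / real n"
proof -
  have "(((((\<Sum>l<n. p l) / real n)\<^sup>2)\<^sup>2)\<^sup>2) \<le> (((\<Sum>l<n. (p l)\<^sup>2) / real n)\<^sup>2)\<^sup>2"
    using n by (intro power_mono mean_square_le) auto
  also have "\<dots> \<le> ((\<Sum>l<n. ((p l)\<^sup>2)\<^sup>2) / real n)\<^sup>2"
    using n by (intro power_mono mean_square_le) auto
  also have "\<dots> \<le> (\<Sum>l<n. (((p l)\<^sup>2)\<^sup>2)\<^sup>2) / real n" using n by (rule mean_square_le)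
  finally show ?thesis by (simp flip: power_mult)
qed

lemma tpol_power: "j * m \<le> r \<Longrightarrow> \<bar>tpol 1 t m\<bar> ^ j \<le> (1 + \<bar>t\<bar>) ^ r"
proof -
  assume "j * m \<le> r"
  have "\<bar>tpol 1 t m\<bar> ^ j \<le> ((1 + \<bar>t\<bar>) ^ m) ^ j" by (intro power_mono tpol_1_bound) auto
  also have "\<dots> = (1 + \<bar>t\<bar>) ^ (j * m)" by (simp only: power_mult[symmetric] mult.commute)
  also have "\<dots> \<le> (1 + \<bar>t\<bar>) ^ r" using \<open>j * m \<le> r\<close> by (intro power_increasing) auto
  finally show ?thesis .
qed

lemma sum_edges_le:
  fixes g :: "nat \<Rightarrow> nat \<Rightarrow> real"
  shows "(\<Sum>(p, q)\<in>edges n. (g p q + g q p)\<^sup>2) \<le> 2 * (\<Sum>p<n. \<Sum>q<n. (g p q)\<^sup>2)"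
proof -
  have "(\<Sum>(p, q)\<in>edges n. (g p q + g q p)\<^sup>2) \<le> (\<Sum>(p, q)\<in>edges n. 2 * (g p q)\<^sup>2 + 2 * (g q p)\<^sup>2)"
  proof (rule sum_mono, clarify)
    fix p q
    show "(g p q + g q p)\<^sup>2 \<le> 2 * (g p q)\<^sup>2 + 2 * (g q p)\<^sup>2"
      using zero_le_power2[of "g p q - g q p"] by (simp add: power2_eq_square algebra_simps)
  qed
  also have "\<dots> = (\<Sum>p<n. \<Sum>q<n. 2 * (g p q)\<^sup>2) - (\<Sum>p<n. 2 * (g p p)\<^sup>2)" by (rule sum_edges_sym)
  also have "\<dots> \<le> (\<Sum>p<n. \<Sum>q<n. 2 * (g p q)\<^sup>2)" by (simp add: sum_nonneg)
  finally show ?thesis by (simp add: sum_distrib_left)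
qed

lemma energy_mult_le:
  assumes "polyfun E f" "polyfun E g"
  shows "energy E (\<lambda>x. f x * g x) x \<le> 2 * ((g x)\<^sup>2 * energy E f x) + 2 * ((f x)\<^sup>2 * energy E g x)"
proof -
  have "energy E (\<lambda>x. f x * g x) x = (\<Sum>e\<in>E. (pd e f x * g x + f x * pd e g x)\<^sup>2)"
    by (simp add: energy_def pd_mult[OF assms])
  also have "\<dots> \<le> (\<Sum>e\<in>E. 2 * ((g x)\<^sup>2 * (pd e f x)\<^sup>2) + 2 * ((f x)\<^sup>2 * (pd e g x)\<^sup>2))"
  proof (rule sum_mono)
    fix e
    show "(pd e f x * g x + f x * pd e g x)\<^sup>2 \<le> 2 * ((g x)\<^sup>2 * (pd e f x)\<^sup>2) + 2 * ((f x)\<^sup>2 * (pd e g x)\<^sup>2)"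
      using zero_le_power2[of "pd e f x * g x - f x * pd e g x"] by (simp add: power2_eq_square algebra_simps)
  qed
  also have "\<dots> = 2 * ((g x)\<^sup>2 * energy E f x) + 2 * ((f x)\<^sup>2 * energy E g x)"
    by (simp add: energy_def sum.distrib sum_distrib_left)
  finally show ?thesis .
qed

text \<open>An upper bound, uniform in \<open>n\<close>, for the expected normalised trace of
  \<open>(1 + |B|)^j\<close> with \<open>j \<le> 2 N\<close>. The factor \<open>4 ^ N\<close> comes
  from \<open>one_plus_power_le\<close>, the power of \<open>14 N\<close> from the recursion in
  \<open>even_moment\<close>.\<close>

definition moment_bound :: "nat \<Rightarrow> real" where
  "moment_bound N = 4 ^ N * (1 + (14 * real N) ^ N)"

lemma moment_bound_ge_1: "1 \<le> moment_bound N"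
proof -
  have "1 * 1 \<le> (4::real) ^ N * (1 + (14 * real N) ^ N)" by (intro mult_mono) auto
  thus ?thesis by (simp add: moment_bound_def)
qed

section \<open>Loop equations and moments uniform in the dimension\<close>

locale gaussian_matrix = matrix_size n + gaussian_expectation "edges n" Ex
  for n and Ex :: "((nat \<times> nat \<Rightarrow> real) \<Rightarrow> real) \<Rightarrow> real"
begin

text \<open>The loop equation, also known as Schwinger-Dyson equation. With \<open>s = 0\<close> it
  yields the moment bounds, with \<open>s = 1\<close> the means of the Chebyshev traces.\<close>

lemma Ex_T: "Ex (T s m) = Ex (Q s m)"
proof -
  have pV: "polyfun (edges n) (\<lambda>x. x e * V s m (fst e) (snd e) x)" if "e \<in> edges n" for e
    using that by (intro polyfun_mult polyfun_coord polyfun_V) (auto simp: edges_def)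
  have pV': "polyfun (edges n) (pd e (V s m (fst e) (snd e)))" if "e \<in> edges n" for e
    using that by (intro polyfun_pd polyfun_V) (auto simp: edges_def)
  have pS: "polyfun (edges n) (\<lambda>x. \<Sum>e\<in>edges n. x e * V s m (fst e) (snd e) x)"
    by (rule polyfun_sum) (rule pV)
  have "Ex (T s m) = 2 / sqrt (real n) * Ex (\<lambda>x. \<Sum>e\<in>edges n. x e * V s m (fst e) (snd e) x)"
    using Ex_cmult[OF pS, of "2 / sqrt (real n)"] by (simp add: T_edges[abs_def] case_prod_unfold)
  also have "Ex (\<lambda>x. \<Sum>e\<in>edges n. x e * V s m (fst e) (snd e) x) = (\<Sum>(p, q)\<in>edges n. Ex (\<lambda>x. x (p, q) * V s m p q x))"
    by (subst Ex_sum[OF pV]) (auto simp: case_prod_unfold)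
  also have "(\<Sum>(p, q)\<in>edges n. Ex (\<lambda>x. x (p, q) * V s m p q x)) = (\<Sum>(p, q)\<in>edges n. Ex (pd (p, q) (V s m p q)))"
  proof (intro sum.cong refl, clarify)
    fix p q assume "(p, q) \<in> edges n"
    thus "Ex (\<lambda>x. x (p, q) * V s m p q x) = Ex (pd (p, q) (V s m p q))"
      by (intro Ex_by_parts polyfun_V) (auto simp: edges_def)
  qed
  also have "\<dots> = Ex (\<lambda>x. \<Sum>(p, q)\<in>edges n. pd (p, q) (V s m p q) x)"
    using Ex_sum[of "edges n" "\<lambda>e. pd e (V s m (fst e) (snd e))", OF pV'] by (simp add: case_prod_unfold)
  also have "\<dots> = sqrt (real n) / 2 * Ex (Q s m)"
    unfolding sum_pd_V by (rule Ex_cmult[OF polyfun_Q])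
  finally show ?thesis using n_pos by simp
qed

context
  fixes x lam v assumes es: "is_eigensystem n (B x) lam v"
begin

lemma Y_abs_le:
  assumes "\<And>l m. \<bar>tpol s (lam l) c\<bar> * \<bar>tpol s (lam m) d\<bar> \<le> r l + r m"
  shows "\<bar>Y s c d x\<bar> \<le> 2 * (\<Sum>l<n. r l)"
proof -
  have "\<bar>Y s c d x\<bar> \<le> (\<Sum>i<n. \<bar>V s c i i x * V s d i i x\<bar>)" unfolding Y_def by (rule sum_abs)
  also have "\<dots> \<le> (\<Sum>i<n. fmat n v r i i + fmat n v r i i)"
  proof (rule sum_mono)
    fix i assume "i \<in> {..<n}"
    thus "\<bar>V s c i i x * V s d i i x\<bar> \<le> fmat n v r i i + fmat n v r i i"
      using fmat_diag_mult_le[OF es, of i i "\<lambda>l. tpol s (lam l) c" "\<lambda>l. tpol s (lam l) d" r] assms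
      by (simp add: V_fmat[OF es])
  qed
  also have "\<dots> = 2 * (\<Sum>l<n. r l)" by (simp only: sum.distrib fmat_trace[OF es])
  finally show ?thesis .
qed

text \<open>In each summand the exponents add up to \<open>2 q\<close>, so every term is controlled
  by the trace \<open>S\<close> of the even power: \<open>2 n S\<close> for the product of traces,
  \<open>S\<close> for \<open>W\<close> and \<open>4 S\<close> for \<open>2 Y\<close>. With
  \<open>1 \<le> n\<close> this gives the 7.\<close>

lemma Q_0_le: "Q 0 (Suc (2 * q)) x \<le> 7 * real (2 * q + 1) * Z 0 (2 * q) x"
proof -
  have "Z 0 c x * Z 0 (2 * q - c) x + W 0 c (2 * q - c) x - 2 * Y 0 c (2 * q - c) x \<le> 7 * real n * Z 0 (2 * q) x"
    if c: "c < Suc (2 * q)" for c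
  proof -
    define d where "d = 2 * q - c"
    have cd: "c + d = 2 * q" using c by (simp add: d_def)
    define S where "S = (\<Sum>l<n. lam l ^ (2 * q))"
    have S: "S \<ge> 0" unfolding S_def by (intro sum_nonneg) (simp add: power_mult)
    have ZS: "Z 0 (2 * q) x = S" by (simp add: Z_eigen[OF es] tpol_0 S_def)
    have "Z 0 c x * Z 0 d x = (\<Sum>l<n. \<Sum>m<n. lam l ^ c * lam m ^ d)" by (simp add: Z_eigen[OF es] tpol_0 sum_product)
    also have "\<dots> \<le> (\<Sum>l<n. \<Sum>m<n. lam l ^ (2 * q) + lam m ^ (2 * q))"
    proof (intro sum_mono)
      fix l m
      show "lam l ^ c * lam m ^ d \<le> lam l ^ (2 * q) + lam m ^ (2 * q)"
        using power_mult_le_sum[OF cd, of "lam l" "lam m"] abs_ge_self[of "lam l ^ c * lam m ^ d"] by (simp add: abs_mult)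
    qed
    also have "\<dots> = 2 * real n * S" by (simp add: sum.distrib S_def flip: sum_distrib_left)
    finally have 1: "Z 0 c x * Z 0 d x \<le> 2 * real n * S" .
    have 2: "W 0 c d x = S" by (simp add: W_eigen[OF es] tpol_0 S_def cd flip: power_add)
    have "\<bar>Y 0 c d x\<bar> \<le> 2 * S" unfolding S_def by (rule Y_abs_le) (simp add: tpol_0 power_mult_le_sum[OF cd])
    with 1 2 have "Z 0 c x * Z 0 d x + W 0 c d x - 2 * Y 0 c d x \<le> 2 * real n * S + 5 * S" by linarith
    also have "5 * S \<le> 5 * (real n * S)" using n_pos S by (simp add: mult_le_cancel_right1)
    finally show ?thesis unfolding ZS d_def[symmetric] by (simp add: mult_ac)
  qed
  hence "(\<Sum>c<Suc (2 * q). Z 0 c x * Z 0 (2 * q - c) x + W 0 c (2 * q - c) x - 2 * Y 0 c (2 * q - c) x)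
     \<le> (\<Sum>c<Suc (2 * q). 7 * real n * Z 0 (2 * q) x)" by (intro sum_mono) auto
  thus ?thesis using n_pos by (simp add: Q_def divide_le_eq algebra_simps)
qed

end

lemma Z_0_even_nonneg: "0 \<le> Z 0 (2 * q) x"
proof -
  obtain lam v where es: "is_eigensystem n (B x) lam v" using eigensystem_B by blast
  show ?thesis unfolding Z_eigen[OF es] tpol_0 by (intro sum_nonneg) (simp add: power_mult)
qed

text \<open>The loop equation bounds each even moment by \<open>7 (2 q + 1) \<le> 14 (q + 1)\<close>
  times the preceding one. No walks are counted; the resulting growth \<open>q^q\<close> is
  affordable.\<close>

lemma even_moment: "Ex (Z 0 (2 * q)) \<le> real n * (14 * real q) ^ q"
proof (induction q)
  case 0
  show ?case by (simp add: Z_def V_simps \<delta>_def Ex_const)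
next
  case (Suc q)
  have "Ex (Z 0 (2 * Suc q)) = Ex (T 0 (Suc (2 * q)))"
    by (rule arg_cong[of _ _ Ex]) (simp add: T_eq fun_eq_iff)
  also have "\<dots> = Ex (Q 0 (Suc (2 * q)))" by (rule Ex_T)
  also have "\<dots> \<le> Ex (\<lambda>x. 7 * real (2 * q + 1) * Z 0 (2 * q) x)"
    using Q_0_le eigensystem_B by (intro Ex_mono polyfun_intros polyfun_Q polyfun_Z) blast
  also have "\<dots> = 7 * real (2 * q + 1) * Ex (Z 0 (2 * q))" by (rule Ex_cmult[OF polyfun_Z])
  also have "\<dots> \<le> (14 * real (Suc q)) * (real n * (14 * real (Suc q)) ^ q)"
  proof (rule mult_mono)
    show "7 * real (2 * q + 1) \<le> 14 * real (Suc q)" by simp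
    show "0 \<le> 14 * real (Suc q)" by simp
    show "0 \<le> Ex (Z 0 (2 * q))" by (intro Ex_nonneg polyfun_Z Z_0_even_nonneg)
    have "(14 * real q) ^ q \<le> (14 * real (Suc q)) ^ q" by (intro power_mono) auto
    with Suc.IH show "Ex (Z 0 (2 * q)) \<le> real n * (14 * real (Suc q)) ^ q"
      by (meson mult_left_mono of_nat_0_le_iff order_trans)
  qed
  finally show ?case by (simp add: mult_ac)
qed

text \<open>A polynomial majorant: absolute values of eigenvalues are not polynomials in the
  entries, so they are dominated by an even power before \<open>Ex\<close> is applied.\<close>

definition G :: "nat \<Rightarrow> (nat \<times> nat \<Rightarrow> real) \<Rightarrow> real" where
  "G N x = 4 ^ N * (1 + Z 0 (2 * N) x / real n)"

lemma polyfun_G: "polyfun (edges n) (G N)"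
  unfolding G_def by (intro polyfun_intros polyfun_Z)

lemma Ex_G: "Ex (G N) \<le> moment_bound N"
proof -
  have "Ex (G N) = 4 ^ N * (1 + Ex (Z 0 (2 * N)) / real n)"
    unfolding G_def using polyfun_Z
    by (subst Ex_cmult; (subst Ex_add)?; (subst Ex_const)?; (subst Ex_divide)?; (intro polyfun_intros)?) auto
  also have "\<dots> \<le> 4 ^ N * (1 + (14 * real N) ^ N)"
    using even_moment[of N] n_pos by (simp add: divide_le_eq mult.commute)
  finally show ?thesis by (simp add: moment_bound_def)
qed

lemma sum_eigen_power_le:
  assumes "is_eigensystem n (B x) lam v" "j \<le> 2 * N"
  shows "(\<Sum>l<n. (1 + \<bar>lam l\<bar>) ^ j) \<le> real n * G N x"
proof -
  have "(\<Sum>l<n. (1 + \<bar>lam l\<bar>) ^ j) \<le> (\<Sum>l<n. 4 ^ N * (1 + lam l ^ (2 * N)))"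
    using assms(2) by (intro sum_mono one_plus_power_le)
  also have "\<dots> = real n * G N x"
    using n_pos by (simp add: G_def Z_eigen[OF assms(1)] tpol_0 sum.distrib field_simps flip: sum_distrib_left)
  finally show ?thesis .
qed

text \<open>Eigenvalues enter only through a pointwise comparison with the polynomial
  \<open>G N\<close>, for whichever eigensystem of \<open>B x\<close> is chosen; their dependence on
  \<open>x\<close> never has to be measurable.\<close>

lemma Ex_le_moment_bound:
  assumes "polyfun (edges n) f" "c \<ge> 0" "\<And>x lam v. is_eigensystem n (B x) lam v \<Longrightarrow> f x \<le> c * G N x"
  shows "Ex f \<le> c * moment_bound N"
proof -
  have "Ex f \<le> Ex (\<lambda>x. c * G N x)"
    using assms eigensystem_B by (intro Ex_mono polyfun_intros polyfun_G) blast+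
  also have "\<dots> = c * Ex (G N)" by (rule Ex_cmult[OF polyfun_G])
  also have "\<dots> \<le> c * moment_bound N" using assms(2) by (intro mult_left_mono Ex_G)
  finally show ?thesis .
qed

text \<open>The gradient consists of the entries of \<open>p(B)\<close> times
  \<open>2 / sqrt n\<close>, so the energy is at most a normalised trace of \<open>p(B)^2\<close>.
  It is of order one although the trace has \<open>n\<close> summands.\<close>

lemma energy_Z_le:
  assumes es: "is_eigensystem n (B x) lam v"
  shows "energy (edges n) (Z 1 a) x \<le> 2 * (real a)\<^sup>2 * ((\<Sum>l<n. (1 + \<bar>lam l\<bar>) ^ (2 * a)) / real n)"
proof -
  define p where "p l = (\<Sum>c<a. tpol 1 (lam l) c * tpol 1 (lam l) (a - 1 - c))" for l
  have pb: "\<bar>p l\<bar> \<le> real a * (1 + \<bar>lam l\<bar>) ^ a" for l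
  proof -
    have "\<bar>p l\<bar> \<le> (\<Sum>c<a. \<bar>tpol 1 (lam l) c\<bar> * \<bar>tpol 1 (lam l) (a - 1 - c)\<bar>)"
      unfolding p_def abs_mult[symmetric] by (rule sum_abs)
    also have "\<dots> \<le> (\<Sum>c<a. (1 + \<bar>lam l\<bar>) ^ c * (1 + \<bar>lam l\<bar>) ^ (a - 1 - c))"
      by (intro sum_mono mult_mono tpol_1_bound) auto
    also have "\<dots> \<le> (\<Sum>c<a. (1 + \<bar>lam l\<bar>) ^ a)"
      unfolding power_add[symmetric] by (intro sum_mono power_increasing) auto
    finally show ?thesis by simp
  qed
  have "energy (edges n) (Z 1 a) x = (\<Sum>(i, j)\<in>edges n. (fmat n v p i j / sqrt (real n) + fmat n v p j i / sqrt (real n))\<^sup>2)"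
    unfolding energy_def
  proof (intro sum.cong refl, clarify)
    fix i j assume "(i, j) \<in> edges n"
    hence "pd (i, j) (Z 1 a) x = 2 / sqrt (real n) * fmat n v p i j"
      using pd_Z[OF es, of i j 1 a] unfolding p_def[abs_def] by (simp add: edges_def)
    thus "(pd (i, j) (Z 1 a) x)\<^sup>2 = (fmat n v p i j / sqrt (real n) + fmat n v p j i / sqrt (real n))\<^sup>2"
      by (simp add: fmat_sym[of n v p j i])
  qed
  also have "\<dots> \<le> 2 * (\<Sum>i<n. \<Sum>j<n. (fmat n v p i j / sqrt (real n))\<^sup>2)" by (rule sum_edges_le)
  also have "\<dots> = 2 * (\<Sum>l<n. (p l)\<^sup>2) / real n"
    using fmat_inner[OF es, of p p] n_pos by (simp add: power_divide power2_eq_square flip: sum_divide_distrib)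
  also have "(\<Sum>l<n. (p l)\<^sup>2) \<le> (\<Sum>l<n. (real a)\<^sup>2 * (1 + \<bar>lam l\<bar>) ^ (2 * a))"
  proof (rule sum_mono)
    fix l
    have "\<bar>p l\<bar>\<^sup>2 \<le> (real a * (1 + \<bar>lam l\<bar>) ^ a)\<^sup>2" by (intro power_mono pb) auto
    thus "(p l)\<^sup>2 \<le> (real a)\<^sup>2 * (1 + \<bar>lam l\<bar>) ^ (2 * a)" by (simp add: power_mult_distrib power_mult[symmetric] mult.commute)
  qed
  finally show ?thesis using n_pos by (simp add: sum_distrib_left[symmetric] divide_right_mono mult_ac)
qed

lemma Var_Z_le:
  assumes "a \<le> N"
  shows "Var (Z 1 a) \<le> 2 * (real a)\<^sup>2 * moment_bound N"
proof -
  have "Var (Z 1 a) \<le> Ex (energy (edges n) (Z 1 a))" by (rule poincare[OF polyfun_Z])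
  also have "\<dots> \<le> 2 * (real a)\<^sup>2 * moment_bound N"
  proof (rule Ex_le_moment_bound)
    fix x lam v assume es: "is_eigensystem n (B x) lam v"
    have "energy (edges n) (Z 1 a) x \<le> 2 * (real a)\<^sup>2 * ((\<Sum>l<n. (1 + \<bar>lam l\<bar>) ^ (2 * a)) / real n)" by (rule energy_Z_le[OF es])
    also have "\<dots> \<le> 2 * (real a)\<^sup>2 * G N x"
      using sum_eigen_power_le[OF es, of "2 * a" N] assms n_pos by (intro mult_left_mono) (auto simp: divide_le_eq mult.commute)
    finally show "energy (edges n) (Z 1 a) x \<le> 2 * (real a)\<^sup>2 * G N x" .
  qed (auto intro: polyfun_energy polyfun_Z)
  finally show ?thesis .
qed

lemma Ex_energy_Z_square_le:
  assumes "2 * a \<le> N"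
  shows "Ex (\<lambda>x. (energy (edges n) (Z 1 a) x)\<^sup>2) \<le> 4 * (real a) ^ 4 * moment_bound N"
proof (rule Ex_le_moment_bound)
  fix x lam v assume es: "is_eigensystem n (B x) lam v"
  have "(energy (edges n) (Z 1 a) x)\<^sup>2 \<le> (2 * (real a)\<^sup>2 * ((\<Sum>l<n. (1 + \<bar>lam l\<bar>) ^ (2 * a)) / real n))\<^sup>2"
    by (intro power_mono energy_Z_le[OF es]) (simp add: energy_def sum_nonneg)
  also have "\<dots> = 4 * (real a) ^ 4 * ((\<Sum>l<n. (1 + \<bar>lam l\<bar>) ^ (2 * a)) / real n)\<^sup>2"
    by (simp add: power_mult_distrib power2_eq_square numeral_eq_Suc)
  also have "\<dots> \<le> 4 * (real a) ^ 4 * ((\<Sum>l<n. ((1 + \<bar>lam l\<bar>) ^ (2 * a))\<^sup>2) / real n)"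
    using n_pos by (intro mult_left_mono mean_square_le) auto
  also have "\<dots> \<le> 4 * (real a) ^ 4 * G N x"
    using sum_eigen_power_le[OF es, of "2 * a * 2" N] assms n_pos
    by (intro mult_left_mono) (auto simp: divide_le_eq mult.commute power_mult[symmetric])
  finally show "(energy (edges n) (Z 1 a) x)\<^sup>2 \<le> 4 * (real a) ^ 4 * G N x" .
qed (auto intro: polyfun_power polyfun_energy polyfun_Z)

text \<open>Powers of eigenvalues up to \<open>8 a\<close> must be covered by the exponent
  \<open>2 N\<close>. This is the most demanding use of \<open>moment_bound\<close>, and it leads to
  the choice \<open>N = 4 k\<close> later.\<close>

lemma Ex_Z_power8_le:
  assumes "4 * a \<le> N"
  shows "Ex (\<lambda>x. (Z 1 a x) ^ 8) \<le> real n ^ 8 * moment_bound N"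
proof (rule Ex_le_moment_bound)
  fix x lam v assume es: "is_eigensystem n (B x) lam v"
  have "(Z 1 a x / real n) ^ 8 \<le> (\<Sum>l<n. (tpol 1 (lam l) a) ^ 8) / real n"
    unfolding Z_eigen[OF es] using n_pos by (rule mean_power8_le)
  also have "\<dots> \<le> (\<Sum>l<n. (1 + \<bar>lam l\<bar>) ^ (8 * a)) / real n"
    using tpol_power[of 8 a "8 * a"] by (intro divide_right_mono sum_mono) auto
  also have "\<dots> \<le> G N x"
    using sum_eigen_power_le[OF es, of "8 * a" N] assms n_pos by (simp add: divide_le_eq mult.commute)
  finally show "(Z 1 a x) ^ 8 \<le> real n ^ 8 * G N x" using n_pos by (simp add: power_divide divide_le_eq mult.commute)
qed (auto intro: polyfun_power polyfun_Z)

text \<open>The constant is \<open>5 = 1 + 2 * 2\<close>: one trace for \<open>W\<close>, and two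
  for each of the two copies of \<open>Y\<close>.\<close>

lemma Ex_W_Y_le:
  assumes "c + d \<le> N"
  shows "\<bar>Ex (\<lambda>x. W 1 c d x - 2 * Y 1 c d x)\<bar> \<le> 5 * real n * moment_bound N"
proof -
  have "\<bar>W 1 c d x - 2 * Y 1 c d x\<bar> \<le> 5 * real n * G N x" for x
  proof -
    obtain lam v where es: "is_eigensystem n (B x) lam v" using eigensystem_B by blast
    define S where "S = (\<Sum>l<n. (1 + \<bar>lam l\<bar>) ^ (2 * N))"
    have b: "\<bar>tpol 1 (lam l) c\<bar> * \<bar>tpol 1 (lam m) d\<bar> \<le> (1 + \<bar>lam l\<bar>) ^ (2 * N) + (1 + \<bar>lam m\<bar>) ^ (2 * N)" for l m
    proof -
      define M where "M = max (1 + \<bar>lam l\<bar>) (1 + \<bar>lam m\<bar>)"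
      have "\<bar>tpol 1 (lam l) c\<bar> * \<bar>tpol 1 (lam m) d\<bar> \<le> (1 + \<bar>lam l\<bar>) ^ c * (1 + \<bar>lam m\<bar>) ^ d"
        by (intro mult_mono tpol_1_bound) auto
      also have "\<dots> \<le> M ^ c * M ^ d" unfolding M_def by (intro mult_mono power_mono) auto
      also have "\<dots> \<le> M ^ (2 * N)" unfolding power_add[symmetric] M_def using assms by (intro power_increasing) auto
      also have "\<dots> \<le> (1 + \<bar>lam l\<bar>) ^ (2 * N) + (1 + \<bar>lam m\<bar>) ^ (2 * N)" by (auto simp: M_def max_def)
      finally show ?thesis .
    qed
    have "\<bar>Y 1 c d x\<bar> \<le> 2 * S" unfolding S_def by (rule Y_abs_le[OF es b])
    moreover have "\<bar>W 1 c d x\<bar> \<le> S"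
    proof -
      have "\<bar>W 1 c d x\<bar> \<le> (\<Sum>l<n. \<bar>tpol 1 (lam l) c\<bar> * \<bar>tpol 1 (lam l) d\<bar>)"
        unfolding W_eigen[OF es] abs_mult[symmetric] by (rule sum_abs)
      also have "\<dots> \<le> S" unfolding S_def
      proof (rule sum_mono)
        fix l
        have "\<bar>tpol 1 (lam l) c\<bar> * \<bar>tpol 1 (lam l) d\<bar> \<le> (1 + \<bar>lam l\<bar>) ^ c * (1 + \<bar>lam l\<bar>) ^ d"
          by (intro mult_mono tpol_1_bound) auto
        also have "\<dots> \<le> (1 + \<bar>lam l\<bar>) ^ (2 * N)" unfolding power_add[symmetric] using assms by (intro power_increasing) auto
        finally show "\<bar>tpol 1 (lam l) c\<bar> * \<bar>tpol 1 (lam l) d\<bar> \<le> (1 + \<bar>lam l\<bar>) ^ (2 * N)" .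
      qed
      finally show ?thesis .
    qed
    ultimately have "\<bar>W 1 c d x - 2 * Y 1 c d x\<bar> \<le> 5 * S" by linarith
    also have "\<dots> \<le> 5 * (real n * G N x)" unfolding S_def using sum_eigen_power_le[OF es] by simp
    finally show ?thesis by simp
  qed
  hence "\<bar>Ex (\<lambda>x. W 1 c d x - 2 * Y 1 c d x)\<bar> \<le> Ex (\<lambda>x. 5 * real n * G N x)"
    by (intro Ex_abs_le polyfun_intros polyfun_W polyfun_Y polyfun_G)
  also have "\<dots> = 5 * real n * Ex (G N)" by (rule Ex_cmult[OF polyfun_G])
  also have "\<dots> \<le> 5 * real n * moment_bound N" by (intro mult_left_mono Ex_G) auto
  finally show ?thesis .
qed

text \<open>The loop equation has \<open>Z_(m+3) + Z_(m+1)\<close> on one side and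
  \<open>2 Z_(m+1)\<close> from the extreme summands on the other. What remains is a recursion with
  step two and increments of order \<open>1 / n\<close> times products.\<close>

lemma Ex_Z_rec:
  "Ex (Z 1 (m + 3)) = Ex (Z 1 (m + 1)) + ((\<Sum>c<m. Ex (\<lambda>x. Z 1 (Suc c) x * Z 1 (m - c) x))
       + (\<Sum>c<Suc (Suc m). Ex (\<lambda>x. W 1 c (Suc m - c) x - 2 * Y 1 c (Suc m - c) x))) / real n"
proof -
  have "Ex (Z 1 (m + 3)) + Ex (Z 1 (m + 1)) = Ex (T 1 (Suc (Suc m)))"
    unfolding T_eq[abs_def] by (simp add: Ex_add polyfun_Z numeral_3_eq_3)
  also have "\<dots> = Ex (Q 1 (Suc (Suc m)))" by (rule Ex_T)
  also have "\<dots> = 2 * Ex (Z 1 (Suc m)) + ((\<Sum>c<m. Ex (\<lambda>x. Z 1 (Suc c) x * Z 1 (m - c) x))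
         + (\<Sum>c<Suc (Suc m). Ex (\<lambda>x. W 1 c (Suc m - c) x - 2 * Y 1 c (Suc m - c) x))) / real n"
  proof -
    have p1: "polyfun (edges n) (\<lambda>x. \<Sum>c<m. Z 1 (Suc c) x * Z 1 (m - c) x)"
      by (intro polyfun_sum polyfun_mult polyfun_Z)
    have p2: "polyfun (edges n) (\<lambda>x. W 1 c d x - 2 * Y 1 c d x)" for c d
      by (intro polyfun_diff polyfun_mult polyfun_const polyfun_W polyfun_Y)
    have p3: "polyfun (edges n) (\<lambda>x. \<Sum>c<Suc (Suc m). W 1 c (Suc m - c) x - 2 * Y 1 c (Suc m - c) x)"
      by (intro polyfun_sum p2)
    have "Ex (Q 1 (Suc (Suc m))) = Ex (\<lambda>x. 2 * Z 1 (Suc m) x) + Ex (\<lambda>x. ((\<Sum>c<m. Z 1 (Suc c) x * Z 1 (m - c) x)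
         + (\<Sum>c<Suc (Suc m). W 1 c (Suc m - c) x - 2 * Y 1 c (Suc m - c) x)) / real n)"
      unfolding Q_1_expand[abs_def] by (rule Ex_add[OF polyfun_mult[OF polyfun_const polyfun_Z] polyfun_divide[OF polyfun_add[OF p1 p3]]])
    also have "Ex (\<lambda>x. 2 * Z 1 (Suc m) x) = 2 * Ex (Z 1 (Suc m))" by (rule Ex_cmult[OF polyfun_Z])
    finally show ?thesis
      by (simp add: Ex_divide[OF polyfun_add[OF p1 p3]] Ex_add[OF p1 p3] Ex_sum p2 polyfun_mult polyfun_Z del: sum.lessThan_Suc)
  qed
  finally show ?thesis by simp
qed

lemma Ex_Z_1: "Ex (Z 1 (Suc 0)) = 0"
  by (simp add: Z_def[abs_def] V_simps B_def entry_def Ex_const)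

text \<open>The expected trace of \<open>B^2\<close> is \<open>n - 1\<close>, since the diagonal is
  zero, and the polynomial of degree 2 subtracts \<open>n\<close>.\<close>

lemma Ex_Z_2: "Ex (Z 1 (Suc (Suc 0))) = -1"
proof -
  have c: "Z 1 0 x = real n" "W 1 0 0 x = real n" "Y 1 0 0 x = real n" for x
    by (simp_all add: Z_def W_def Y_def V_simps \<delta>_def if_distrib cong: if_cong)
  have c0: "Z 1 0 = (\<lambda>x. real n)" by (simp add: c fun_eq_iff)
  have "Ex (Z 1 (Suc (Suc 0))) + Ex (Z 1 0) = Ex (Q 1 (Suc 0))"
    using Ex_T[of 1 "Suc 0"] unfolding T_eq[abs_def] by (simp add: Ex_add polyfun_Z)
  hence "real n * (1 + Ex (Z 1 (Suc (Suc 0)))) = 0" using n_pos by (simp add: Q_def[abs_def] c c0 Ex_const field_simps)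
  thus ?thesis using n_pos by simp
qed

lemma Ex_mult_abs_le:
  assumes "polyfun (edges n) f" "polyfun (edges n) g"
  shows "\<bar>Ex (\<lambda>x. f x * g x)\<bar> \<le> (Ex (\<lambda>x. (f x)\<^sup>2) + Ex (\<lambda>x. (g x)\<^sup>2)) / 2"
proof -
  have "\<bar>Ex (\<lambda>x. f x * g x)\<bar> \<le> Ex (\<lambda>x. ((f x)\<^sup>2 + (g x)\<^sup>2) / 2)"
  proof (intro Ex_abs_le polyfun_mult polyfun_divide polyfun_add polyfun_power assms)
    fix x show "\<bar>f x * g x\<bar> \<le> ((f x)\<^sup>2 + (g x)\<^sup>2) / 2"
      using zero_le_power2[of "f x - g x"] zero_le_power2[of "f x + g x"]
      by (simp add: abs_le_iff power2_eq_square algebra_simps)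
  qed
  also have "\<dots> = (Ex (\<lambda>x. (f x)\<^sup>2) + Ex (\<lambda>x. (g x)\<^sup>2)) / 2"
    using assms by (simp add: Ex_divide Ex_add polyfun_add polyfun_power)
  finally show ?thesis .
qed

end

text \<open>The size condition makes the quadratic terms in the recursion for the means negligible.\<close>
locale large_gaussian_matrix = gaussian_matrix +
  fixes k :: nat and K :: real
  assumes k_pos: "1 \<le> k" and K_def: "K = moment_bound (4 * k)" and n_large: "38 * real k ^ 4 * K \<le> real n"
begin

lemma K_ge_1: "1 \<le> K" by (simp add: K_def moment_bound_ge_1)

lemma rk: "1 \<le> real k" using k_pos by simp

section \<open>Means, second moments and variances for large dimension\<close>

lemma Var_Z_le_K: "a \<le> k \<Longrightarrow> Var (Z 1 a) \<le> 2 * (real k)\<^sup>2 * K"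
proof -
  assume a: "a \<le> k"
  have "Var (Z 1 a) \<le> 2 * (real a)\<^sup>2 * K" unfolding K_def using a by (intro Var_Z_le) auto
  also have "\<dots> \<le> 2 * (real k)\<^sup>2 * K" using a K_ge_1 by (intro mult_right_mono mult_left_mono power_mono) auto
  finally show ?thesis .
qed

text \<open>Every step of the recursion adds at most \<open>6 k K\<close>, namely \<open>k K\<close>
  for the products of traces and \<open>5 k K\<close> for the sum with \<open>W\<close> and
  \<open>Y\<close>. The products depend on earlier means quadratically, but carry
  \<open>1 / n\<close>, and the size condition on \<open>n\<close> absorbs this.\<close>

lemma mean_Z_le: "1 \<le> a \<Longrightarrow> a \<le> k \<Longrightarrow> \<bar>Ex (Z 1 a)\<bar> \<le> 6 * real k * K * real a"
proof (induction a rule: less_induct)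
  case (less a)
  have "a = 1 \<or> a = 2 \<or> a = (a - 3) + 3" using less.prems by linarith
  then consider "a = 1" | "a = 2" | m where "a = m + 3" by blast
  thus ?case
  proof cases
    case 1
    thus ?thesis using K_ge_1 by (simp add: Ex_Z_1)
  next
    case 2
    have "1 * 1 \<le> real k * K" using rk K_ge_1 by (intro mult_mono) auto
    thus ?thesis using 2 by (simp add: Ex_Z_2 numeral_2_eq_2)
  next
    case (3 m)
    define M where "M = 6 * (real k)\<^sup>2 * K"
    have sq: "Ex (\<lambda>x. (Z 1 b x)\<^sup>2) \<le> 2 * (real k)\<^sup>2 * K + M\<^sup>2" if "1 \<le> b" "b < a" for b
    proof -
      have "\<bar>Ex (Z 1 b)\<bar> \<le> 6 * real k * K * real b" using less that by simp
      also have "\<dots> \<le> 6 * real k * K * real k" using that less.prems K_ge_1 by (intro mult_left_mono) auto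
      finally have "\<bar>Ex (Z 1 b)\<bar>\<^sup>2 \<le> M\<^sup>2" unfolding M_def by (intro power_mono) (auto simp: power2_eq_square mult_ac)
      moreover have "Var (Z 1 b) \<le> 2 * (real k)\<^sup>2 * K" using that less.prems by (intro Var_Z_le_K) auto
      ultimately show ?thesis by (simp add: Var_def)
    qed
    have "\<bar>\<Sum>c<m. Ex (\<lambda>x. Z 1 (Suc c) x * Z 1 (m - c) x)\<bar> \<le> (\<Sum>c<m. 2 * (real k)\<^sup>2 * K + M\<^sup>2)"
    proof (intro order_trans[OF sum_abs] sum_mono)
      fix c assume "c \<in> {..<m}"
      hence "Ex (\<lambda>x. (Z 1 (Suc c) x)\<^sup>2) \<le> 2 * (real k)\<^sup>2 * K + M\<^sup>2" "Ex (\<lambda>x. (Z 1 (m - c) x)\<^sup>2) \<le> 2 * (real k)\<^sup>2 * K + M\<^sup>2"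
        using 3 by (auto intro!: sq)
      from add_mono[OF this]
      show "\<bar>Ex (\<lambda>x. Z 1 (Suc c) x * Z 1 (m - c) x)\<bar> \<le> 2 * (real k)\<^sup>2 * K + M\<^sup>2"
        by (intro order_trans[OF Ex_mult_abs_le[OF polyfun_Z polyfun_Z]]) (simp add: mult_ac)
    qed
    also have "\<dots> \<le> real k * (2 * (real k)\<^sup>2 * K + M\<^sup>2)"
      using 3 less.prems K_ge_1 by (auto intro!: mult_right_mono)
    \<comment> \<open>Here \<open>38 = 2 + 36\<close>, from the variance and from the squared bound
      on the mean. The assumption \<open>n_large\<close> is tailored to trade the factor
      \<open>38 k^4 K\<close> for \<open>n\<close>.\<close>
    also have "2 * (real k)\<^sup>2 * K + M\<^sup>2 \<le> 38 * real k ^ 4 * K\<^sup>2"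
    proof -
      have "(real k)\<^sup>2 * K \<le> real k ^ 4 * K\<^sup>2"
        using rk K_ge_1 by (intro mult_mono power_increasing self_le_power) auto
      moreover have "M\<^sup>2 = 36 * (real k ^ 4 * K\<^sup>2)" by (simp add: M_def power_mult_distrib)
      ultimately show ?thesis by (simp add: mult_ac)
    qed
    also have "real k * (38 * real k ^ 4 * K\<^sup>2) = real k * K * (38 * real k ^ 4 * K)" by (simp add: power2_eq_square)
    also have "\<dots> \<le> real k * K * real n" using K_ge_1 by (intro mult_left_mono n_large) auto
    finally have 1: "\<bar>\<Sum>c<m. Ex (\<lambda>x. Z 1 (Suc c) x * Z 1 (m - c) x)\<bar> \<le> real k * K * real n"
      by (simp add: mult_left_mono)
    have "\<bar>\<Sum>c<Suc (Suc m). Ex (\<lambda>x. W 1 c (Suc m - c) x - 2 * Y 1 c (Suc m - c) x)\<bar> \<le> (\<Sum>c<Suc (Suc m). 5 * real n * K)"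
      unfolding K_def using 3 less.prems by (intro order_trans[OF sum_abs] sum_mono Ex_W_Y_le) auto
    also have "\<dots> \<le> real k * (5 * real n * K)"
      using 3 less.prems K_ge_1 by (simp only: sum_constant card_lessThan) (intro mult_right_mono; simp)
    finally have 2: "\<bar>\<Sum>c<Suc (Suc m). Ex (\<lambda>x. W 1 c (Suc m - c) x - 2 * Y 1 c (Suc m - c) x)\<bar> \<le> 5 * (real k * K * real n)"
      by (simp add: mult_ac del: sum.lessThan_Suc)
    define D where "D = ((\<Sum>c<m. Ex (\<lambda>x. Z 1 (Suc c) x * Z 1 (m - c) x))
       + (\<Sum>c<Suc (Suc m). Ex (\<lambda>x. W 1 c (Suc m - c) x - 2 * Y 1 c (Suc m - c) x))) / real n"
    have "\<bar>D\<bar> * real n \<le> 6 * (real k * K) * real n" 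
      using 1 2 n_pos unfolding D_def by (simp add: abs_divide del: sum.lessThan_Suc)
    hence "\<bar>D\<bar> \<le> 6 * (real k * K)" using n_pos by simp
    moreover have "Ex (Z 1 a) = Ex (Z 1 (m + 1)) + D" unfolding 3 D_def by (rule Ex_Z_rec)
    moreover have "\<bar>Ex (Z 1 (m + 1))\<bar> \<le> 6 * real k * K * real (m + 1)" using 3 less by (intro less.IH) auto
    ultimately have "\<bar>Ex (Z 1 a)\<bar> \<le> 6 * real k * K * real (m + 1) + 6 * (real k * K)" by linarith
    also have "\<dots> = 6 * real k * K * real (m + 2)" by (simp add: algebra_simps)
    also have "\<dots> \<le> 6 * real k * K * real a" using 3 K_ge_1 by (intro mult_left_mono) auto
    finally show ?thesis .
  qed
qed

text \<open>The second moments of the traces are at most this: variance \<open>2 k^2 K\<close> plus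
  squared mean \<open>36 k^4 K^2\<close>.\<close>

definition K2 :: real where "K2 = 38 * real k ^ 4 * K\<^sup>2"

lemma K_le_K2: "real k ^ 4 * K \<le> K2 / 38" "K \<le> K2 / 38"
proof -
  have "real k ^ 4 * K \<le> real k ^ 4 * K\<^sup>2" using K_ge_1 by (intro mult_left_mono self_le_power) auto
  thus *: "real k ^ 4 * K \<le> K2 / 38" by (simp add: K2_def)
  have "1 * K \<le> real k ^ 4 * K" using rk K_ge_1 by (intro mult_right_mono) auto
  with * show "K \<le> K2 / 38" by simp
qed

lemma Ex_Z_square_le: 
  assumes "1 \<le> a" "a \<le> k" shows "Ex (\<lambda>x. (Z 1 a x)\<^sup>2) \<le> K2"
proof -
  have "\<bar>Ex (Z 1 a)\<bar> \<le> 6 * real k * K * real a" using assms by (rule mean_Z_le)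
  also have "\<dots> \<le> 6 * real k * K * real k" using assms K_ge_1 by (intro mult_left_mono) auto
  finally have "\<bar>Ex (Z 1 a)\<bar>\<^sup>2 \<le> (6 * real k * K * real k)\<^sup>2" by (intro power_mono) auto
  also have "\<dots> = 36 * (real k ^ 4 * K\<^sup>2)" by (simp add: power_mult_distrib)
  also have "(real k)\<^sup>2 * K \<le> real k ^ 4 * K\<^sup>2"
    using rk K_ge_1 by (intro mult_mono power_increasing self_le_power) auto
  hence "2 * (real k)\<^sup>2 * K \<le> 2 * (real k ^ 4 * K\<^sup>2)" by simp
  ultimately show ?thesis using Var_Z_le_K[OF assms(2)] by (simp add: Var_def K2_def)
qed

text \<open>Interpolation between the bounded second moment and the trivial bound \<open>n ^ 8\<close> on the eighth.\<close>
lemma Ex_Z_power4_le: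
  assumes "1 \<le> a" "a \<le> k"
  shows "Ex (\<lambda>x. (Z 1 a x) ^ 4) \<le> 2 * real n ^ 3 * K2"
proof -
  \<comment> \<open>Truncation level for the squared trace. With \<open>n^3\<close> the tail term
    \<open>n^8 / \<alpha>^2 = n^2\<close> stays below the main term \<open>\<alpha>\<close>.\<close>
  define \<alpha> where "\<alpha> = real n ^ 3"
  have \<alpha>: "\<alpha> > 0" using n_pos by (simp add: \<alpha>_def)
  have "Ex (\<lambda>x. (Z 1 a x) ^ 4) \<le> Ex (\<lambda>x. \<alpha> * (Z 1 a x)\<^sup>2 + (Z 1 a x) ^ 8 / \<alpha>\<^sup>2)"
  proof (intro Ex_mono polyfun_intros polyfun_Z)
    fix x
    define z where "z = (Z 1 a x)\<^sup>2"
    have z: "z \<ge> 0" by (simp add: z_def)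
    have "z\<^sup>2 \<le> \<alpha> * z + z ^ 4 / \<alpha>\<^sup>2"
    proof (cases "z \<le> \<alpha>")
      case True
      hence "z * z \<le> \<alpha> * z" using z by (intro mult_right_mono) auto
      moreover have "0 \<le> z ^ 4 / \<alpha>\<^sup>2" by simp
      ultimately show ?thesis unfolding power2_eq_square[of z] by linarith
    next
      case False
      hence "\<alpha>\<^sup>2 \<le> z\<^sup>2" using \<alpha> by (intro power_mono) auto
      hence "z\<^sup>2 * \<alpha>\<^sup>2 \<le> z\<^sup>2 * z\<^sup>2" by (intro mult_left_mono) auto
      hence "z\<^sup>2 \<le> z ^ 4 / \<alpha>\<^sup>2" using \<alpha> by (simp add: le_divide_eq flip: power_add)
      moreover have "0 \<le> \<alpha> * z" using \<alpha> z by simp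
      ultimately show ?thesis by linarith
    qed
    thus "(Z 1 a x) ^ 4 \<le> \<alpha> * (Z 1 a x)\<^sup>2 + (Z 1 a x) ^ 8 / \<alpha>\<^sup>2" by (simp add: z_def flip: power_mult)
  qed
  also have "\<dots> = \<alpha> * Ex (\<lambda>x. (Z 1 a x)\<^sup>2) + Ex (\<lambda>x. (Z 1 a x) ^ 8) / \<alpha>\<^sup>2"
    by (simp add: Ex_add Ex_cmult Ex_divide polyfun_mult polyfun_const polyfun_power polyfun_Z polyfun_divide)
  also have "\<dots> \<le> \<alpha> * K2 + (real n ^ 8 * K) / \<alpha>\<^sup>2"
    using \<alpha> Ex_Z_power8_le[of a "4 * k"] assms by (intro add_mono mult_left_mono divide_right_mono Ex_Z_square_le) (auto simp: K_def)
  also have "(real n ^ 8 * K) / \<alpha>\<^sup>2 = real n ^ 2 * K"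
    using n_pos by (simp add: \<alpha>_def divide_simps flip: power_mult power_add)
  also have "\<dots> \<le> real n ^ 3 * K2"
    using n_pos K_ge_1 K_le_K2(2) by (intro mult_mono power_increasing) auto
  finally show ?thesis by (simp add: \<alpha>_def mult_ac)
qed

lemma Ex_Z_square_energy_le:
  assumes "1 \<le> a" "a \<le> k" "b \<le> k"
  shows "Ex (\<lambda>x. (Z 1 a x)\<^sup>2 * energy (edges n) (Z 1 b) x) \<le> 2 * (real n * sqrt (real n)) * K2"
proof -
  \<comment> \<open>The weight in the inequality between arithmetic and geometric mean:
    \<open>\<beta>^2 = n^3\<close> balances the fourth moment of the trace, of order
    \<open>n^3\<close>, against the second moment of the energy, of order one.\<close>
  define \<beta> where "\<beta> = real n * sqrt (real n)"
  have \<beta>: "\<beta> > 0" "\<beta> * \<beta> = real n ^ 3" using n_pos by (simp_all add: \<beta>_def power3_eq_cube mult_ac)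
  define en where "en = energy (edges n) (Z 1 b)"
  have pe: "polyfun (edges n) en" unfolding en_def by (intro polyfun_energy polyfun_Z)
  have "Ex (\<lambda>x. (Z 1 a x)\<^sup>2 * en x) \<le> Ex (\<lambda>x. (Z 1 a x) ^ 4 / (2 * \<beta>) + \<beta> / 2 * (en x)\<^sup>2)"
  proof (intro Ex_mono polyfun_intros polyfun_Z pe)
    fix x
    have "0 \<le> ((Z 1 a x)\<^sup>2 - \<beta> * en x)\<^sup>2 / (2 * \<beta>)" using \<beta> by simp
    also have "\<dots> = (Z 1 a x) ^ 4 / (2 * \<beta>) + \<beta> / 2 * (en x)\<^sup>2 - (Z 1 a x)\<^sup>2 * en x"
      using \<beta> by (simp add: field_simps power2_eq_square numeral_eq_Suc)
    finally show "(Z 1 a x)\<^sup>2 * en x \<le> (Z 1 a x) ^ 4 / (2 * \<beta>) + \<beta> / 2 * (en x)\<^sup>2" by simp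
  qed
  also have "\<dots> = Ex (\<lambda>x. (Z 1 a x) ^ 4) / (2 * \<beta>) + \<beta> / 2 * Ex (\<lambda>x. (en x)\<^sup>2)"
    using pe by (subst Ex_add; (subst Ex_divide)?; (subst Ex_cmult)?; (intro polyfun_intros polyfun_Z)?) auto
  also have "\<dots> \<le> (2 * real n ^ 3 * K2) / (2 * \<beta>) + \<beta> / 2 * (4 * real b ^ 4 * K)"
    unfolding en_def using \<beta> assms Ex_energy_Z_square_le[of b "4 * k"]
    by (intro add_mono divide_right_mono mult_left_mono Ex_Z_power4_le) (auto simp: K_def)
  also have "(2 * real n ^ 3 * K2) / (2 * \<beta>) = \<beta> * K2" unfolding \<beta>(2)[symmetric] using \<beta>(1) by simp
  also have "\<beta> / 2 * (4 * real b ^ 4 * K) \<le> \<beta> / 2 * (2 * K2)"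
  proof (intro mult_left_mono)
    have "real b ^ 4 * K \<le> real k ^ 4 * K" using assms K_ge_1 by (intro mult_right_mono power_mono) auto
    thus "4 * real b ^ 4 * K \<le> 2 * K2" using K_le_K2 K_ge_1 by linarith
  qed (use \<beta> in auto)
  finally show ?thesis by (simp add: en_def \<beta>_def mult_ac)
qed

text \<open>This power \<open>n^(3/2)\<close>, divided by \<open>n^2\<close> in the remainder,
  determines the rate of the whole estimate.\<close>

lemma Var_ZZ_le:
  assumes "1 \<le> a" "a \<le> k" "1 \<le> b" "b \<le> k"
  shows "Var (\<lambda>x. Z 1 a x * Z 1 b x) \<le> 8 * (real n * sqrt (real n)) * K2"
proof -
  have pe: "polyfun (edges n) (\<lambda>x. (Z 1 a x)\<^sup>2 * energy (edges n) (Z 1 b) x)" for a b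
    by (intro polyfun_mult polyfun_power polyfun_energy polyfun_Z)
  have "Var (\<lambda>x. Z 1 a x * Z 1 b x) \<le> Ex (energy (edges n) (\<lambda>x. Z 1 a x * Z 1 b x))"
    by (intro poincare polyfun_mult polyfun_Z)
  also have "\<dots> \<le> Ex (\<lambda>x. 2 * ((Z 1 b x)\<^sup>2 * energy (edges n) (Z 1 a) x) + 2 * ((Z 1 a x)\<^sup>2 * energy (edges n) (Z 1 b) x))"
    by (intro Ex_mono energy_mult_le polyfun_Z polyfun_energy polyfun_mult polyfun_add polyfun_const polyfun_power)
  also have "\<dots> = 2 * Ex (\<lambda>x. (Z 1 b x)\<^sup>2 * energy (edges n) (Z 1 a) x) + 2 * Ex (\<lambda>x. (Z 1 a x)\<^sup>2 * energy (edges n) (Z 1 b) x)"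
    by (simp add: Ex_add Ex_cmult polyfun_mult[OF polyfun_const] pe)
  also have "\<dots> \<le> 2 * (2 * (real n * sqrt (real n)) * K2) + 2 * (2 * (real n * sqrt (real n)) * K2)"
    using assms by (intro add_mono mult_left_mono Ex_Z_square_energy_le) auto
  finally show ?thesis by (simp add: mult_ac)
qed

text \<open>The gradient is a sum of products of two entries from row \<open>i\<close>. Its squared
  norm factors into row norms, each a diagonal entry of a function of \<open>B\<close>, which leaves
  a factor \<open>1 / n\<close>.\<close>

lemma energy_diag_le:
  assumes es: "is_eigensystem n (B x) lam v" and i: "i < n" and a: "a \<le> k"
  shows "energy (edges n) (V 1 a i i) x \<le> 2 * (real k)\<^sup>2 / real n * (fmat n v (\<lambda>l. (1 + \<bar>lam l\<bar>) ^ (2 * k)) i i)\<^sup>2"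
proof -
  define m where "m = fmat n v (\<lambda>l. (1 + \<bar>lam l\<bar>) ^ (2 * k)) i i"
  define g where "g p q = (\<Sum>c<a. V 1 c i p x * V 1 (a - 1 - c) i q x) / sqrt (real n)" for p q
  have row: "(\<Sum>p<n. (V 1 c i p x)\<^sup>2) \<le> m" if "c \<le> k" for c
  proof -
    have "(\<Sum>p<n. (V 1 c i p x)\<^sup>2) = fmat n v (\<lambda>l. (tpol 1 (lam l) c)\<^sup>2) i i"
      using i by (simp add: V_fmat[OF es] fmat_row_norm[OF es])
    also have "\<dots> \<le> m" unfolding m_def
      using tpol_power[of 2 c "2 * k"] that by (intro fmat_diag_mono[OF es]) auto
    finally show ?thesis .
  qed
  have "energy (edges n) (V 1 a i i) x = (\<Sum>(p, q)\<in>edges n. (g p q + g q p)\<^sup>2)"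
    unfolding energy_def
  proof (intro sum.cong refl, clarify)
    fix p q assume "(p, q) \<in> edges n"
    hence pq: "p < q" "q < n" "p < n" by (auto simp: edges_def)
    have "pd (p, q) (V 1 a i i) x = g p q + g q p"
      using pq i by (simp add: pd_V g_def V_sym[of _ i] sum.distrib add_divide_distrib)
    thus "(pd (p, q) (V 1 a i i) x)\<^sup>2 = (g p q + g q p)\<^sup>2" by simp
  qed
  also have "\<dots> \<le> 2 * (\<Sum>p<n. \<Sum>q<n. (g p q)\<^sup>2)" by (rule sum_edges_le)
  also have "\<dots> \<le> 2 * (\<Sum>p<n. \<Sum>q<n. (\<Sum>c<a. (V 1 c i p x)\<^sup>2 * (V 1 (a - 1 - c) i q x)\<^sup>2) * real a / real n)"
  proof (intro mult_left_mono sum_mono)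
    fix p q
    show "(g p q)\<^sup>2 \<le> (\<Sum>c<a. (V 1 c i p x)\<^sup>2 * (V 1 (a - 1 - c) i q x)\<^sup>2) * real a / real n"
      using sum_squared_le_sum_of_squares[of "\<lambda>c. V 1 c i p x * V 1 (a - 1 - c) i q x" "{..<a}"] n_pos
      by (simp add: g_def power_divide power_mult_distrib divide_right_mono)
  qed auto
  also have "(\<Sum>p<n. \<Sum>q<n. (\<Sum>c<a. (V 1 c i p x)\<^sup>2 * (V 1 (a - 1 - c) i q x)\<^sup>2) * real a / real n)
     = (\<Sum>c<a. (\<Sum>p<n. (V 1 c i p x)\<^sup>2) * (\<Sum>q<n. (V 1 (a - 1 - c) i q x)\<^sup>2)) * real a / real n"
    unfolding sum_product sum_divide_distrib[symmetric] sum_distrib_right[symmetric]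
    by (subst (2) sum.swap, subst sum.swap) (rule refl)
  also have "(\<Sum>c<a. (\<Sum>p<n. (V 1 c i p x)\<^sup>2) * (\<Sum>q<n. (V 1 (a - 1 - c) i q x)\<^sup>2)) \<le> (\<Sum>c<a. m * m)"
    using a by (intro sum_mono mult_mono row order_trans[OF _ row[of 0]] sum_nonneg) auto
  also have "(\<Sum>c<a. m * m) = real a * m\<^sup>2" by (simp add: power2_eq_square)
  finally have "energy (edges n) (V 1 a i i) x \<le> 2 * (real a * m\<^sup>2 * real a / real n)"
    by (simp add: divide_right_mono mult_right_mono)
  also have "\<dots> = 2 * ((real a)\<^sup>2 * (m\<^sup>2 / real n))" by (simp add: power2_eq_square)
  also have "\<dots> \<le> 2 * ((real k)\<^sup>2 * (m\<^sup>2 / real n))"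
    using a by (intro mult_left_mono mult_right_mono power_mono) auto
  finally show ?thesis by (simp add: m_def)
qed

text \<open>Adding \<open>n\<close> diagonal terms without using decorrelation costs a factor
  \<open>n\<close> in front of the sum of variances. Each variance is of order \<open>1 / n\<close>
  by \<open>energy_diag_le\<close>, so the total is of order \<open>n\<close>, and that
  suffices.\<close>

lemma Var_Y_le:
  assumes "a \<le> k" "b \<le> k"
  shows "Var (Y 1 a b) \<le> 8 * (real k)\<^sup>2 * real n * K"
proof -
  have pV: "polyfun (edges n) (V 1 a i i)" if "i < n" for a i using that by (intro polyfun_V)
  define en where "en i = energy (edges n) (\<lambda>x. V 1 a i i x * V 1 b i i x)" for i
  have pe: "polyfun (edges n) (en i)" if "i < n" for i
    unfolding en_def using that by (intro polyfun_energy polyfun_mult pV)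
  have "Var (Y 1 a b) \<le> real (card {..<n}) * (\<Sum>i<n. Var (\<lambda>x. V 1 a i i x * V 1 b i i x))"
    unfolding Y_def by (intro Var_sum_le polyfun_mult pV) auto
  also have "\<dots> \<le> real n * (\<Sum>i<n. Ex (en i))"
    unfolding en_def by (simp, intro mult_left_mono sum_mono poincare polyfun_mult pV) auto
  also have "(\<Sum>i<n. Ex (en i)) = Ex (\<lambda>x. \<Sum>i<n. en i x)" by (rule Ex_sum[symmetric]) (use pe in auto)
  also have "\<dots> \<le> 8 * (real k)\<^sup>2 * K"
    unfolding K_def
  proof (rule Ex_le_moment_bound)
    fix x lam v assume es: "is_eigensystem n (B x) lam v"
    have "en i x \<le> 8 * (real k)\<^sup>2 / real n * fmat n v (\<lambda>l. (1 + \<bar>lam l\<bar>) ^ (8 * k)) i i" if i: "i < n" for i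
    proof -
      define m where "m = fmat n v (\<lambda>l. (1 + \<bar>lam l\<bar>) ^ (2 * k)) i i"
      have m1: "1 \<le> m"
      proof -
        have "fmat n v (\<lambda>_. 1) i i \<le> m" unfolding m_def by (intro fmat_diag_mono[OF es]) (simp add: one_le_power)
        thus ?thesis using i by (simp add: fmat_one[OF es] \<delta>_def)
      qed
      have Vm: "(V 1 c i i x)\<^sup>2 \<le> m" if "c \<le> k" for c
      proof -
        have "(V 1 c i i x)\<^sup>2 \<le> fmat n v (\<lambda>l. (tpol 1 (lam l) c)\<^sup>2) i i"
          using i by (simp add: V_fmat[OF es] fmat_diag_square[OF es])
        also have "\<dots> \<le> m" unfolding m_def
          using tpol_power[of 2 c "2 * k"] that by (intro fmat_diag_mono[OF es]) auto
        finally show ?thesis .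
      qed
      define t where "t = 2 * (real k)\<^sup>2 / real n"
      have t: "t \<ge> 0" by (simp add: t_def)
      have en0: "0 \<le> energy (edges n) f x" for f by (simp add: energy_def sum_nonneg)
      have "en i x \<le> 2 * ((V 1 b i i x)\<^sup>2 * energy (edges n) (V 1 a i i) x) + 2 * ((V 1 a i i x)\<^sup>2 * energy (edges n) (V 1 b i i) x)"
        unfolding en_def using i by (intro energy_mult_le pV)
      also have "\<dots> \<le> 2 * (m * (t * m\<^sup>2)) + 2 * (m * (t * m\<^sup>2))"
        using assms m1 energy_diag_le[OF es i, folded m_def t_def]
        by (intro add_mono mult_left_mono mult_mono Vm) (auto simp: en0)
      also have "\<dots> = 4 * t * m ^ 3" by (simp add: power2_eq_square power3_eq_cube)
      \<comment> \<open>The exponent is raised from 3 to 4, possible since \<open>m \<ge> 1\<close>,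
        so that two squarings with \<open>fmat_diag_square\<close> move the power inside the
        diagonal entry.\<close>
      also have "\<dots> \<le> 4 * t * m ^ 4" using m1 t by (intro mult_left_mono power_increasing) auto
      also have "m ^ 4 = (m\<^sup>2)\<^sup>2" by simp
      also have "4 * t * (m\<^sup>2)\<^sup>2 \<le> 4 * t * (fmat n v (\<lambda>l. ((1 + \<bar>lam l\<bar>) ^ (2 * k))\<^sup>2) i i)\<^sup>2"
        unfolding m_def using i t by (intro mult_left_mono power_mono fmat_diag_square[OF es]) auto
      also have "\<dots> \<le> 4 * t * fmat n v (\<lambda>l. (((1 + \<bar>lam l\<bar>) ^ (2 * k))\<^sup>2)\<^sup>2) i i"
        using i t by (intro mult_left_mono fmat_diag_square[OF es]) auto
      also have "(\<lambda>l. (((1 + \<bar>lam l\<bar>) ^ (2 * k))\<^sup>2)\<^sup>2) = (\<lambda>l. (1 + \<bar>lam l\<bar>) ^ (8 * k))"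
        by (simp add: mult.commute flip: power_mult)
      finally show ?thesis by (simp add: t_def)
    qed
    hence "(\<Sum>i<n. en i x) \<le> (\<Sum>i<n. 8 * (real k)\<^sup>2 / real n * fmat n v (\<lambda>l. (1 + \<bar>lam l\<bar>) ^ (8 * k)) i i)"
      by (intro sum_mono) auto
    also have "\<dots> = 8 * (real k)\<^sup>2 / real n * (\<Sum>l<n. (1 + \<bar>lam l\<bar>) ^ (8 * k))"
      by (simp only: sum_distrib_left[symmetric] fmat_trace[OF es])
    also have "\<dots> \<le> 8 * (real k)\<^sup>2 / real n * (real n * G (4 * k) x)"
      by (intro mult_left_mono sum_eigen_power_le[OF es]) auto
    finally show "(\<Sum>i<n. en i x) \<le> 8 * (real k)\<^sup>2 * G (4 * k) x" using n_pos by simp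
  qed (auto intro: polyfun_sum pe)
  finally have "Var (Y 1 a b) \<le> real n * (8 * (real k)\<^sup>2 * K)" by (simp add: mult_left_mono)
  thus ?thesis by (simp add: mult_ac)
qed

lemma W_rec: "W 1 (Suc c) (Suc d) x = Z 1 (Suc (Suc (c + d))) x + W 1 c d x"
proof -
  obtain lam v where es: "is_eigensystem n (B x) lam v" using eigensystem_B by blast
  show ?thesis by (simp only: W_eigen[OF es] Z_eigen[OF es] tpol_1_mult sum.distrib)
qed

lemma W_0: "W 1 0 d x = Z 1 d x" "W 1 d 0 x = Z 1 d x"
proof -
  obtain lam v where es: "is_eigensystem n (B x) lam v" using eigensystem_B by blast
  show "W 1 0 d x = Z 1 d x" "W 1 d 0 x = Z 1 d x" by (simp_all add: W_eigen[OF es] Z_eigen[OF es])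
qed

text \<open>\<open>W_rec\<close> peels one trace off per step. Each use of \<open>Var_add_le\<close>
  gives \<open>2 * 1 + 2 * 4 ^ c \<le> 4 ^ (c + 1)\<close>.\<close>

lemma Var_W_le: "c + d \<le> k \<Longrightarrow> Var (W 1 c d) \<le> 4 ^ c * (2 * (real k)\<^sup>2 * K)"
proof (induction c arbitrary: d)
  case 0
  thus ?case using Var_Z_le_K[of d] by (simp add: W_0[abs_def])
next
  case (Suc c)
  have nn: "0 \<le> 2 * (real k)\<^sup>2 * K" using K_ge_1 by simp
  show ?case
  proof (cases d)
    case 0
    have "Var (Z 1 (Suc c)) \<le> 1 * (2 * (real k)\<^sup>2 * K)" using Var_Z_le_K[of "Suc c"] Suc.prems by simp
    also have "\<dots> \<le> 4 ^ Suc c * (2 * (real k)\<^sup>2 * K)" using nn by (intro mult_right_mono one_le_power) auto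
    finally show ?thesis using 0 by (simp add: W_0[abs_def])
  next
    case (Suc d')
    have "Var (W 1 (Suc c) d) \<le> 2 * Var (Z 1 (Suc (Suc (c + d')))) + 2 * Var (W 1 c d')"
      unfolding Suc W_rec[abs_def] by (intro Var_add_le polyfun_Z polyfun_W)
    also have "\<dots> \<le> 2 * (1 * (2 * (real k)\<^sup>2 * K)) + 2 * (4 ^ c * (2 * (real k)\<^sup>2 * K))"
      using Suc Suc.prems Suc.IH[of d'] Var_Z_le_K[of "Suc (Suc (c + d'))"] by simp
    also have "\<dots> \<le> 2 * (4 ^ c * (2 * (real k)\<^sup>2 * K)) + 2 * (4 ^ c * (2 * (real k)\<^sup>2 * K))"
      using nn by (intro add_mono mult_left_mono mult_right_mono one_le_power) auto
    finally show ?thesis by (simp add: mult_ac)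
  qed
qed

text \<open>The products of traces contribute order \<open>n^(-1/2)\<close>; the sum with
  \<open>W\<close> and \<open>Y\<close> contributes \<open>1 / n\<close> and is weakened to the same
  rate. The condition \<open>k = m + 3\<close> reflects that \<open>F (Suc m)\<close> has degree
  \<open>m + 3\<close>.\<close>

lemma Var_remainder_le:
  assumes k: "k = m + 3"
  shows "Var (\<lambda>x. OU (edges n) (F (Suc m)) x + real k * F (Suc m) x) \<le> 800 * real k ^ 8 * 4 ^ k * K\<^sup>2 / sqrt (real n)"
proof -
  define r where "r = sqrt (real n)"
  have r: "r \<ge> 1" "r > 0" "r * r = real n" using n_pos by (auto simp: r_def)
  define f where "f x = (\<Sum>c<m. Z 1 (Suc c) x * Z 1 (m - c) x) / real n" for x
  define g where "g x = (\<Sum>c<Suc (Suc m). W 1 c (Suc m - c) x - 2 * Y 1 c (Suc m - c) x) / real n" for x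
  have pf: "polyfun (edges n) f" unfolding f_def by (intro polyfun_divide polyfun_sum polyfun_mult polyfun_Z)
  have pWY: "polyfun (edges n) (\<lambda>x. W 1 c d x - 2 * Y 1 c d x)" for c d
    by (intro polyfun_diff polyfun_mult polyfun_const polyfun_W polyfun_Y)
  have pg: "polyfun (edges n) g" unfolding g_def by (intro polyfun_divide polyfun_sum pWY)
  have k2: "1 \<le> real k" "0 \<le> K2" using rk K_ge_1 by (auto simp: K2_def)
  have "Var f \<le> real (card {..<m}) * (\<Sum>c<m. Var (\<lambda>x. Z 1 (Suc c) x * Z 1 (m - c) x)) / (real n)\<^sup>2"
    unfolding f_def by (subst Var_divide, (intro polyfun_sum polyfun_mult polyfun_Z)[1])
      (intro divide_right_mono Var_sum_le polyfun_mult polyfun_Z, simp)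
  also have "\<dots> \<le> real (card {..<m}) * (\<Sum>c<m. 8 * (real n * r) * K2) / (real n)\<^sup>2"
    using k unfolding r_def by (intro divide_right_mono mult_left_mono sum_mono Var_ZZ_le) auto
  also have "\<dots> = (real m)\<^sup>2 * (8 * K2) / r"
    using r by (simp add: power2_eq_square field_simps flip: r(3))
  also have "\<dots> \<le> (real k)\<^sup>2 * (8 * K2) / r"
    using r k k2 by (intro divide_right_mono mult_right_mono power_mono) auto
  finally have 1: "Var f \<le> (real k)\<^sup>2 * (8 * K2) / r" .
  define H where "H = real k ^ 2 * K"
  have H: "H \<ge> 0" using K_ge_1 by (simp add: H_def)
  \<comment> \<open>The constant is \<open>68 = 4 + 64\<close>: twice the bound \<open>2 H\<close>
    for \<open>W\<close>, and twice four times the bound \<open>8 H\<close> for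
    \<open>Y\<close>.\<close>
  have WY: "Var (\<lambda>x. W 1 c d x - 2 * Y 1 c d x) \<le> 68 * real n * 4 ^ k * H" if "c + d \<le> k" for c d
  proof -
    have "Var (\<lambda>x. W 1 c d x + (-2) * Y 1 c d x) \<le> 2 * Var (W 1 c d) + 2 * Var (\<lambda>x. (-2) * Y 1 c d x)"
      by (intro Var_add_le polyfun_W polyfun_mult polyfun_const polyfun_Y)
    also have "Var (\<lambda>x. (-2) * Y 1 c d x) = 4 * Var (Y 1 c d)" by (subst Var_cmult[OF polyfun_Y]) simp
    also have "2 * Var (W 1 c d) + 2 * (4 * Var (Y 1 c d)) \<le> 2 * (4 ^ c * (2 * H)) + 2 * (4 * (8 * real n * H))"
      using Var_W_le[OF that] Var_Y_le[of c d] that by (simp add: H_def mult_ac)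
    also have "4 ^ c * (2 * H) \<le> 4 ^ k * real n * (2 * H)"
    proof (intro mult_right_mono)
      have "(4::real) ^ c * 1 \<le> 4 ^ k * real n" using that n_pos by (intro mult_mono power_increasing) auto
      thus "(4::real) ^ c \<le> 4 ^ k * real n" by simp
    qed (use H in auto)
    also have "4 * (8 * real n * H) \<le> 4 ^ k * (4 * (8 * real n * H))"
      using mult_right_mono[of 1 "4 ^ k :: real" "4 * (8 * real n * H)"] H by (simp add: one_le_power)
    finally show ?thesis by (simp add: algebra_simps)
  qed
  have "Var g \<le> real (card {..<Suc (Suc m)}) * (\<Sum>c<Suc (Suc m). Var (\<lambda>x. W 1 c (Suc m - c) x - 2 * Y 1 c (Suc m - c) x)) / (real n)\<^sup>2"
    unfolding g_def by (subst Var_divide, (intro polyfun_sum pWY)[1])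
      (intro divide_right_mono Var_sum_le pWY, simp)
  also have "\<dots> \<le> real (card {..<Suc (Suc m)}) * (\<Sum>c<Suc (Suc m). 68 * real n * 4 ^ k * H) / (real n)\<^sup>2"
    using k by (intro divide_right_mono mult_left_mono sum_mono WY) auto
  also have "\<dots> = (real (m + 2))\<^sup>2 * (68 * 4 ^ k * H) / real n"
    using n_pos by (simp add: power2_eq_square field_simps del: sum.lessThan_Suc)
  also have "\<dots> \<le> (real k)\<^sup>2 * (68 * 4 ^ k * H) / real n"
    using k H by (intro divide_right_mono mult_right_mono power_mono) auto
  also have "\<dots> \<le> (real k)\<^sup>2 * (68 * 4 ^ k * H) / r"
  proof (intro divide_left_mono)
    show "r \<le> real n" using r mult_left_mono[of 1 r r] by simp
  qed (use r H n_pos in auto)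
  finally have 2: "Var g \<le> (real k)\<^sup>2 * (68 * 4 ^ k * H) / r" .
  have "(\<lambda>x. OU (edges n) (F (Suc m)) x + real k * F (Suc m) x) = (\<lambda>x. real k * (f x + g x))"
    unfolding k OU_F_remainder f_def g_def ..
  hence "Var (\<lambda>x. OU (edges n) (F (Suc m)) x + real k * F (Suc m) x) = (real k)\<^sup>2 * Var (\<lambda>x. f x + g x)"
    using pf pg by (simp add: Var_cmult polyfun_add)
  also have "\<dots> \<le> (real k)\<^sup>2 * (2 * Var f + 2 * Var g)" by (intro mult_left_mono Var_add_le pf pg) auto
  also have "\<dots> \<le> (real k)\<^sup>2 * (2 * ((real k)\<^sup>2 * (8 * K2) / r) + 2 * ((real k)\<^sup>2 * (68 * 4 ^ k * H) / r))"
    using 1 2 by (intro mult_left_mono add_mono) auto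
  \<comment> \<open>The factors are \<open>608 = 2 * 8 * 38\<close>, where 38 comes from
    \<open>K2\<close>, and \<open>136 = 2 * 68\<close>. Their sum 744 is rounded up to 800
    below.\<close>
  also have "\<dots> = (608 * (real k ^ 8 * K\<^sup>2) + 136 * 4 ^ k * (real k ^ 6 * K)) / r"
    using r by (simp add: K2_def H_def field_simps numeral_eq_Suc)
  also have "\<dots> \<le> (608 * (4 ^ k * (real k ^ 8 * K\<^sup>2)) + 136 * 4 ^ k * (real k ^ 8 * K\<^sup>2)) / r"
  proof (intro divide_right_mono add_mono mult_left_mono)
    show "real k ^ 8 * K\<^sup>2 \<le> 4 ^ k * (real k ^ 8 * K\<^sup>2)"
      using mult_right_mono[of 1 "4 ^ k :: real" "real k ^ 8 * K\<^sup>2"] by (simp add: one_le_power)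
    show "real k ^ 6 * K \<le> real k ^ 8 * K\<^sup>2"
      using k2 K_ge_1 by (intro mult_mono power_increasing self_le_power) auto
  qed (use r in auto)
  also have "\<dots> \<le> 800 * real k ^ 8 * 4 ^ k * K\<^sup>2 / r"
    using r by (intro divide_right_mono) (auto simp: algebra_simps)
  finally show ?thesis by (simp add: r_def)
qed

end

section \<open>Closed walks and the top chaos component\<close>

lemma sum_PiE_insert:
  assumes "finite I" "finite A" "a \<notin> I"
  shows "(\<Sum>i\<in>insert a I \<rightarrow>\<^sub>E A. f i) = (\<Sum>i\<in>I \<rightarrow>\<^sub>E A. \<Sum>c\<in>A. f (i(a := c)))"
proof -
  have "(\<Sum>i\<in>insert a I \<rightarrow>\<^sub>E A. f i) = (\<Sum>(c, i)\<in>A \<times> (I \<rightarrow>\<^sub>E A). f (i(a := c)))"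
    unfolding PiE_insert_eq using inj_combinator[OF assms(3), of "\<lambda>_. A"]
    by (subst sum.reindex) (auto simp: case_prod_unfold)
  also have "\<dots> = (\<Sum>c\<in>A. \<Sum>i\<in>I \<rightarrow>\<^sub>E A. f (i(a := c)))" by (simp add: sum.cartesian_product)
  also have "\<dots> = (\<Sum>i\<in>I \<rightarrow>\<^sub>E A. \<Sum>c\<in>A. f (i(a := c)))" by (rule sum.swap)
  finally show ?thesis .
qed

text \<open>A union bound over pairs of positions with equal values: such a tuple is determined by
  its entries at the other \<open>k - 1\<close> positions.\<close>

lemma card_noninjective_le:
  "card {i \<in> {..<k} \<rightarrow>\<^sub>E {..<n}. \<not> inj_on i {..<k}} \<le> k\<^sup>2 * n ^ (k - 1)"
proof -
  define P where "P a b = {i \<in> {..<k} \<rightarrow>\<^sub>E {..<n}. i a = i b}" for a b :: nat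
  define D where "D = {(a, b). a < k \<and> b < k \<and> a \<noteq> b}"
  have fD: "finite D" unfolding D_def by (rule finite_subset[of _ "{..<k} \<times> {..<k}"]) auto
  have cD: "card D \<le> k\<^sup>2"
    using card_mono[of "{..<k} \<times> {..<k}" D] by (auto simp: D_def power2_eq_square)
  have fP: "finite (P a b)" for a b unfolding P_def
    by (rule finite_subset[of _ "{..<k} \<rightarrow>\<^sub>E {..<n}"]) (auto intro: finite_PiE)
  have cP: "card (P a b) \<le> n ^ (k - 1)" if "(a, b) \<in> D" for a b
  proof -
    have ab: "a < k" "b < k" "a \<noteq> b" using that by (auto simp: D_def)
    have "card (P a b) \<le> card (({..<k} - {b}) \<rightarrow>\<^sub>E {..<n})"
    proof (rule card_inj_on_le)
      show "inj_on (\<lambda>i. restrict i ({..<k} - {b})) (P a b)"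
      proof (rule inj_onI)
        fix i i' assume i: "i \<in> P a b" and i': "i' \<in> P a b"
          and eq: "restrict i ({..<k} - {b}) = restrict i' ({..<k} - {b})"
        have eq': "i j = i' j" if "j < k" "j \<noteq> b" for j
          using fun_cong[OF eq, of j] that by simp
        show "i = i'"
        proof (rule PiE_ext)
          show "i \<in> {..<k} \<rightarrow>\<^sub>E {..<n}" "i' \<in> {..<k} \<rightarrow>\<^sub>E {..<n}" using i i' by (auto simp: P_def)
          fix j assume "j \<in> {..<k}"
          show "i j = i' j"
            using i i' eq'[OF ab(1) ab(3)] eq'[of j] \<open>j \<in> _\<close> by (cases "j = b") (auto simp: P_def)
        qed
      qed
      show "(\<lambda>i. restrict i ({..<k} - {b})) ` P a b \<subseteq> ({..<k} - {b}) \<rightarrow>\<^sub>E {..<n}"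
      proof (rule image_subsetI)
        fix i assume "i \<in> P a b"
        hence i: "i \<in> {..<k} \<rightarrow>\<^sub>E {..<n}" by (simp add: P_def)
        show "restrict i ({..<k} - {b}) \<in> ({..<k} - {b}) \<rightarrow>\<^sub>E {..<n}"
          unfolding restrict_PiE_iff using PiE_mem[OF i] by blast
      qed
      show "finite (({..<k} - {b}) \<rightarrow>\<^sub>E {..<n})" by (intro finite_PiE) auto
    qed
    also have "\<dots> = n ^ (k - 1)" using ab by (simp add: card_PiE)
    finally show ?thesis .
  qed
  have "{i \<in> {..<k} \<rightarrow>\<^sub>E {..<n}. \<not> inj_on i {..<k}} \<subseteq> (\<Union>(a, b)\<in>D. P a b)"
    by (auto simp: inj_on_def D_def P_def)
  hence "card {i \<in> {..<k} \<rightarrow>\<^sub>E {..<n}. \<not> inj_on i {..<k}} \<le> card (\<Union>(a, b)\<in>D. P a b)"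
    using fD fP by (intro card_mono finite_UN_I) auto
  also have "\<dots> \<le> (\<Sum>(a, b)\<in>D. card (P a b))"
    using card_UN_le[OF fD, of "\<lambda>(a, b). P a b"] by (simp add: case_prod_unfold)
  also have "\<dots> \<le> (\<Sum>(a, b)\<in>D. n ^ (k - 1))" using cP by (intro sum_mono) auto
  also have "\<dots> = card D * n ^ (k - 1)" by (simp add: case_prod_unfold)
  also have "\<dots> \<le> k\<^sup>2 * n ^ (k - 1)" using cD by (rule mult_right_mono) simp
  finally show ?thesis .
qed

section \<open>Closed walks and the edges that they use\<close>

definition step_edge :: "nat \<Rightarrow> (nat \<Rightarrow> nat) \<Rightarrow> nat \<Rightarrow> nat \<times> nat" where
  "step_edge k i j = (min (i j) (i (Suc j mod k)), max (i j) (i (Suc j mod k)))"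

definition walk_edges :: "nat \<Rightarrow> (nat \<Rightarrow> nat) \<Rightarrow> (nat \<times> nat) multiset" where
  "walk_edges k i = image_mset (step_edge k i) (mset_set {..<k})"

definition loopless :: "nat \<Rightarrow> (nat \<Rightarrow> nat) \<Rightarrow> bool" where
  "loopless k i \<longleftrightarrow> (\<forall>j<k. i j \<noteq> i (Suc j mod k))"

definition walk_weight :: "nat \<Rightarrow> (nat \<Rightarrow> nat) \<Rightarrow> (nat \<times> nat \<Rightarrow> real) \<Rightarrow> real" where
  "walk_weight k i x = (\<Prod>j<k. entry (i j) (i (Suc j mod k)) x)"

lemma size_walk_edges: "size (walk_edges k i) = k"
  by (simp add: walk_edges_def)

lemma walk_edges_subset:
  assumes "i \<in> {..<k} \<rightarrow>\<^sub>E {..<n}" "loopless k i"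
  shows "set_mset (walk_edges k i) \<subseteq> edges n"
proof
  fix e assume "e \<in># walk_edges k i"
  then obtain j where j: "j < k" "e = step_edge k i j" by (auto simp: walk_edges_def)
  have "Suc j mod k < k" using j by simp
  hence "i j < n" "i (Suc j mod k) < n" using PiE_mem[OF assms(1)] j(1) by auto
  thus "e \<in> edges n" using assms(2) j by (auto simp: step_edge_def edges_def loopless_def min_def max_def)
qed

lemma walk_weight_monom: "loopless k i \<Longrightarrow> walk_weight k i x = monom_fun (walk_edges k i) x"
  by (simp add: walk_weight_def monom_fun_def walk_edges_def prod_unfold_prod_mset image_mset.compositionality
        comp_def loopless_def step_edge_def entry_def cong: image_mset_cong)

lemma walk_weight_loop: "\<not> loopless k i \<Longrightarrow> walk_weight k i x = 0"
  by (auto simp: walk_weight_def loopless_def entry_def)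

lemma inj_loopless:
  assumes "inj_on i {..<k}" "2 \<le> k"
  shows "loopless k i"
  unfolding loopless_def
proof (intro allI impI notI)
  fix j assume j: "j < k" and eq: "i j = i (Suc j mod k)"
  have "Suc j mod k < k" using j by simp
  hence "j = Suc j mod k" using inj_onD[OF assms(1) eq] j by simp
  thus False using j assms(2) by (cases "Suc j = k") auto
qed

text \<open>A cycle through at least three distinct vertices uses every edge once. For
  \<open>k = 2\<close> both steps use the same edge, so the bound on \<open>k\<close> matters
  here.\<close>

lemma inj_step_edge:
  assumes "inj_on i {..<k}" "3 \<le> k"
  shows "inj_on (step_edge k i) {..<k}"
proof (rule inj_onI)
  fix a b assume ab: "a \<in> {..<k}" "b \<in> {..<k}" and eq: "step_edge k i a = step_edge k i b"
  define s where "s j = Suc j mod k" for j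
  have s: "s j < k" for j using assms(2) by (simp add: s_def)
  from eq have "(i a = i b \<and> i (s a) = i (s b)) \<or> (i a = i (s b) \<and> i (s a) = i b)"
    by (auto simp: step_edge_def s_def min_def max_def split: if_splits)
  hence "a = b \<or> (a = s b \<and> s a = b)"
    using inj_onD[OF assms(1)] ab s by (metis lessThan_iff)
  \<comment> \<open>If both equations held, two steps around the cycle would return to the start, so
    \<open>k\<close> would divide 2.\<close>
  moreover have "a \<noteq> s b \<or> s a \<noteq> b"
    using ab assms(2) by (auto simp: s_def mod_Suc split: if_splits)
  ultimately show "a = b" by blast
qed

lemma count_walk_edges_inj:
  assumes "inj_on i {..<k}" "3 \<le> k"
  shows "count (walk_edges k i) e \<le> 1"
proof -
  have "walk_edges k i = mset_set (step_edge k i ` {..<k})"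
    unfolding walk_edges_def using inj_step_edge[OF assms] by (rule image_mset_mset_set)
  thus ?thesis by (simp add: count_mset_set')
qed

text \<open>Every vertex of a walk is an endpoint of one of its edges. Hence walks with the same
  edges use only vertices of \<open>w\<close>, of which there are at most \<open>k\<close>.\<close>

lemma card_same_edges_le:
  assumes w: "w \<in> {..<k} \<rightarrow>\<^sub>E {..<n}"
  shows "card {w' \<in> {..<k} \<rightarrow>\<^sub>E {..<n}. walk_edges k w' = walk_edges k w} \<le> k ^ k"
proof -
  have "{w' \<in> {..<k} \<rightarrow>\<^sub>E {..<n}. walk_edges k w' = walk_edges k w} \<subseteq> {..<k} \<rightarrow>\<^sub>E w ` {..<k}"
  proof clarify
    fix w' assume w': "w' \<in> {..<k} \<rightarrow>\<^sub>E {..<n}" and eq: "walk_edges k w' = walk_edges k w"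
    show "w' \<in> {..<k} \<rightarrow>\<^sub>E w ` {..<k}"
    proof (rule PiE_I)
      fix j assume j: "j \<in> {..<k}"
      hence "step_edge k w' j \<in># walk_edges k w" unfolding eq[symmetric] by (auto simp: walk_edges_def)
      then obtain l where l: "l < k" "step_edge k w' j = step_edge k w l" by (auto simp: walk_edges_def)
      have "Suc l mod k < k" using l by simp
      moreover have "w' j = w l \<or> w' j = w (Suc l mod k)"
        using l(2) by (auto simp: step_edge_def min_def max_def split: if_splits)
      ultimately show "w' j \<in> w ` {..<k}" using l(1) by auto
    qed (use w' in auto)
  qed
  hence "card {w' \<in> {..<k} \<rightarrow>\<^sub>E {..<n}. walk_edges k w' = walk_edges k w} \<le> card ({..<k} \<rightarrow>\<^sub>E w ` {..<k})"
    by (intro card_mono finite_PiE) auto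
  also have "\<dots> = card (w ` {..<k}) ^ k" by (simp add: card_PiE)
  also have "\<dots> \<le> k ^ k" using card_image_le[of "{..<k}" w] by (intro power_mono) auto
  finally show ?thesis .
qed

section \<open>Traces of powers as sums over closed walks\<close>

context matrix_size
begin

text \<open>The recursion multiplies from the left; paths are to be extended at their last vertex,
  and symmetry of the matrix provides the other side.\<close>

lemma V_0_right_step: 
  assumes "a < n" "b < n"
  shows "V 0 (Suc m) a b x = (\<Sum>l<n. V 0 m a l x * B x l b)"
proof -
  have "V 0 (Suc m) a b x = V 0 (Suc m) b a x" using assms by (rule V_sym)
  also have "\<dots> = (\<Sum>l<n. B x b l * V 0 m l a x)" using V_step[OF assms(1), of x b 0 m] by simp
  also have "\<dots> = (\<Sum>l<n. V 0 m a l x * B x l b)"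
    using assms by (intro sum.cong refl) (simp add: V_sym[of _ a] B_def entry_sym[of b])
  finally show ?thesis .
qed

text \<open>Endpoints are imposed by factors \<open>\<delta>\<close>, not by restricting the index
  set. The sum then runs over all functions, and one more vertex is added by
  \<open>sum_PiE_insert\<close>.\<close>

lemma V_0_paths:
  assumes "a < n" "b < n"
  shows "V 0 m a b x = (\<Sum>i\<in>{..<Suc m} \<rightarrow>\<^sub>E {..<n}. \<delta> a (i 0) * (\<Prod>j<m. B x (i j) (i (Suc j))) * \<delta> b (i m))"
  using assms(2)
proof (induction m arbitrary: b)
  case 0
  have "(\<Sum>i\<in>{..<Suc 0} \<rightarrow>\<^sub>E {..<n}. \<delta> a (i 0) * \<delta> b (i 0)) = (\<Sum>i\<in>insert (0::nat) {} \<rightarrow>\<^sub>E {..<n}. \<delta> a (i 0) * \<delta> b (i 0))"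
    by (simp add: lessThan_Suc)
  also have "\<dots> = (\<Sum>c<n. \<delta> a c * \<delta> b c)" by (subst sum_PiE_insert) auto
  also have "\<dots> = \<delta> b a" using assms(1) by simp
  also have "\<dots> = \<delta> a b" by (simp add: \<delta>_def)
  finally show ?case by (simp add: V_simps)
next
  case (Suc m)
  define f where "f i = \<delta> a (i 0) * (\<Prod>j<m. B x (i j) (i (Suc j)))" for i
  have "V 0 (Suc m) a b x = (\<Sum>l<n. (\<Sum>i\<in>{..<Suc m} \<rightarrow>\<^sub>E {..<n}. f i * \<delta> l (i m)) * B x l b)"
    using assms(1) Suc by (simp add: V_0_right_step f_def)
  also have "\<dots> = (\<Sum>i\<in>{..<Suc m} \<rightarrow>\<^sub>E {..<n}. \<Sum>l<n. \<delta> l (i m) * (f i * B x l b))"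
    unfolding sum_distrib_right by (subst sum.swap) (simp add: mult_ac)
  also have "\<dots> = (\<Sum>i\<in>{..<Suc m} \<rightarrow>\<^sub>E {..<n}. f i * B x (i m) b)"
  proof (intro sum.cong refl)
    fix i assume "i \<in> {..<Suc m} \<rightarrow>\<^sub>E {..<n}"
    hence "i m < n" by auto
    thus "(\<Sum>l<n. \<delta> l (i m) * (f i * B x l b)) = f i * B x (i m) b" by simp
  qed
  also have "\<dots> = (\<Sum>i\<in>{..<Suc m} \<rightarrow>\<^sub>E {..<n}. \<Sum>c<n. \<delta> b c * (f i * B x (i m) c))"
    using Suc.prems by simp
  also have "\<dots> = (\<Sum>i\<in>insert (Suc m) {..<Suc m} \<rightarrow>\<^sub>E {..<n}. \<delta> b (i (Suc m)) * (f i * B x (i m) (i (Suc m))))"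
    by (subst sum_PiE_insert) (auto intro!: sum.cong prod.cong simp: f_def)
  also have "insert (Suc m) {..<Suc m} = {..<Suc (Suc m)}" by (simp add: lessThan_Suc)
  finally show ?case by (simp add: f_def mult_ac)
qed

lemma Z_0_walks: "Z 0 (Suc m) x = (1 / sqrt (real n)) ^ Suc m * (\<Sum>i\<in>{..<Suc m} \<rightarrow>\<^sub>E {..<n}. walk_weight (Suc m) i x)"
proof -
  define f where "f i = (\<Prod>j<m. B x (i j) (i (Suc j)))" for i
  have "Z 0 (Suc m) x = (\<Sum>a<n. \<Sum>l<n. \<Sum>i\<in>{..<Suc m} \<rightarrow>\<^sub>E {..<n}. \<delta> a (i 0) * f i * \<delta> l (i m) * B x l a)"
    unfolding Z_def
  proof (intro sum.cong refl)
    fix a assume "a \<in> {..<n}"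
    hence a: "a < n" by simp
    show "V 0 (Suc m) a a x = (\<Sum>l<n. \<Sum>i\<in>{..<Suc m} \<rightarrow>\<^sub>E {..<n}. \<delta> a (i 0) * f i * \<delta> l (i m) * B x l a)"
      by (subst V_0_right_step[OF a a]) (simp add: V_0_paths[OF a] sum_distrib_right f_def)
  qed
  also have "\<dots> = (\<Sum>a<n. \<Sum>i\<in>{..<Suc m} \<rightarrow>\<^sub>E {..<n}. \<Sum>l<n. \<delta> a (i 0) * f i * \<delta> l (i m) * B x l a)"
    by (intro sum.cong refl sum.swap)
  also have "\<dots> = (\<Sum>i\<in>{..<Suc m} \<rightarrow>\<^sub>E {..<n}. \<Sum>a<n. \<Sum>l<n. \<delta> a (i 0) * (\<delta> l (i m) * (f i * B x l a)))"
    by (subst sum.swap) (simp add: mult_ac)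
  also have "\<dots> = (\<Sum>i\<in>{..<Suc m} \<rightarrow>\<^sub>E {..<n}. f i * B x (i m) (i 0))"
  proof (intro sum.cong refl)
    fix i assume "i \<in> {..<Suc m} \<rightarrow>\<^sub>E {..<n}"
    hence "i m < n" "i 0 < n" by auto
    thus "(\<Sum>a<n. \<Sum>l<n. \<delta> a (i 0) * (\<delta> l (i m) * (f i * B x l a))) = f i * B x (i m) (i 0)"
      by (simp flip: sum_distrib_left)
  qed
  also have "\<dots> = (\<Sum>i\<in>{..<Suc m} \<rightarrow>\<^sub>E {..<n}. (1 / sqrt (real n)) ^ Suc m * walk_weight (Suc m) i x)"
  proof (intro sum.cong refl)
    fix i
    have "walk_weight (Suc m) i x = (\<Prod>j<m. entry (i j) (i (Suc j)) x) * entry (i m) (i 0) x"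
      by (simp add: walk_weight_def)
    moreover have "f i = (1 / sqrt (real n)) ^ m * (\<Prod>j<m. entry (i j) (i (Suc j)) x)"
      by (simp add: f_def B_def prod_dividef power_one_over)
    ultimately show "f i * B x (i m) (i 0) = (1 / sqrt (real n)) ^ Suc m * walk_weight (Suc m) i x"
      by (simp add: B_def)
  qed
  finally show ?thesis by (simp only: sum_distrib_left)
qed

text \<open>The Chebyshev polynomial is monic, so to leading order it may be replaced by the pure
  power, whose trace has an expansion into walks.\<close>

lemma deg_lt_V_1_V_0:
  assumes "b < n" shows "a < n \<Longrightarrow> deg_lt (edges n) m (\<lambda>x. V 1 m a b x - V 0 m a b x)"
proof (induction m arbitrary: a rule: induct_nat_012)
  case (ge2 m)
  have "deg_lt (edges n) (Suc (Suc m)) (\<lambda>x. B x a l * (V 1 (Suc m) l b x - V 0 (Suc m) l b x))" if "l < n" for l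
    using deg_lt_mult[OF ge2.IH(2)[OF that] deg_lt_B[OF ge2.prems that]] by (simp add: mult.commute)
  moreover have "deg_lt (edges n) (Suc (Suc m)) (V 1 m a b)"
    by (rule deg_lt_mono[OF deg_lt_V]) (use assms ge2 in auto)
  ultimately have "deg_lt (edges n) (Suc (Suc m)) (\<lambda>x. (\<Sum>l<n. B x a l * (V 1 (Suc m) l b x - V 0 (Suc m) l b x)) - V 1 m a b x)"
    by (intro deg_lt_diff deg_lt_sum) auto
  thus ?case by (simp add: V_simps right_diff_distrib sum_subtractf algebra_simps)
qed (simp_all add: V_simps deg_lt_0)

definition cycle_poly :: "nat \<Rightarrow> (nat \<times> nat \<Rightarrow> real) \<Rightarrow> real" where
  "cycle_poly k x = (1 / sqrt (real n)) ^ k * (\<Sum>i\<in>{i \<in> {..<k} \<rightarrow>\<^sub>E {..<n}. inj_on i {..<k}}. walk_weight k i x)"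

text \<open>Cycles have distinct edges, so each monomial is square-free and lies in the chaos of
  order \<open>k\<close> without any correction.\<close>

lemma chaos_cycle_poly:
  assumes "3 \<le> k"
  shows "chaos (edges n) k (cycle_poly k)"
proof -
  define I where "I = {i \<in> {..<k} \<rightarrow>\<^sub>E {..<n}. inj_on i {..<k}}"
  have ll: "loopless k i" if "i \<in> I" for i using that inj_loopless[of i k] assms by (auto simp: I_def)
  have sub: "set_mset (walk_edges k i) \<subseteq> edges n" if "i \<in> I" for i
    using that walk_edges_subset[of i k n] ll by (auto simp: I_def)
  have C: "cycle_poly k = (\<lambda>x. (1 / sqrt (real n)) ^ k * (\<Sum>i\<in>I. monom_fun (walk_edges k i) x))"
    unfolding cycle_poly_def[abs_def] I_def[symmetric] by (simp add: walk_weight_monom ll cong: sum.cong)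
  have pm: "polyfun (edges n) (monom_fun (walk_edges k i))" if "i \<in> I" for i using sub[OF that] by (rule polyfun_monom_fun)
  have "deg_lt (edges n) (Suc k) (monom_fun (walk_edges k i))" if "i \<in> I" for i
    using deg_lt_monom_fun[OF sub[OF that]] by (simp add: size_walk_edges)
  hence d: "deg_lt (edges n) (Suc k) (cycle_poly k)" unfolding C by (intro deg_lt_cmult deg_lt_sum)
  have om: "OU (edges n) (monom_fun (walk_edges k i)) = (\<lambda>x. - real k * monom_fun (walk_edges k i) x)" if "i \<in> I" for i
    using OU_monom_fun_squarefree[OF finite_edges sub[OF that]] count_walk_edges_inj[of i k] that assms
    by (simp add: I_def size_walk_edges)
  have "OU (edges n) (cycle_poly k) = (\<lambda>x. (1 / sqrt (real n)) ^ k * (\<Sum>i\<in>I. - real k * monom_fun (walk_edges k i) x))"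
    unfolding C by (subst OU_cmult[OF polyfun_sum[OF pm]], assumption, subst OU_sum[OF pm], assumption)
      (simp add: om cong: sum.cong)
  also have "\<dots> = (\<lambda>x. - real k * cycle_poly k x)"
    unfolding C sum_distrib_left[symmetric] by (simp add: mult_ac)
  finally show ?thesis using d by (simp add: chaos_def)
qed

end

text \<open>The top chaos of the difference comes from walks without loops that revisit a vertex.
  Its second moment is bounded by their number times \<open>k! k^k n^(-k)\<close>, hence by order
  \<open>1 / n\<close>; the lower chaoses are covered by \<open>Var_remainder_le\<close>.\<close>

lemma (in large_gaussian_matrix) Var_F_cycle_le:
  assumes k: "k = m + 3"
  shows "Var (\<lambda>x. F (Suc m) x - cycle_poly k x)
     \<le> (fact k * real k ^ k * (real k)\<^sup>2 + 800 * real k ^ 8 * 4 ^ k * K\<^sup>2) / sqrt (real n)"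
proof -
  define c where "c = (1 / sqrt (real n)) ^ k"
  define A where "A = {..<k} \<rightarrow>\<^sub>E {..<n}"
  define W where "W = {i \<in> A. \<not> inj_on i {..<k} \<and> loopless k i}"
  define S where "S x = c * (\<Sum>i\<in>W. monom_fun (walk_edges k i) x)" for x
  have fA: "finite A" unfolding A_def by (intro finite_PiE) auto
  have Z0: "Z 0 k x = cycle_poly k x + S x" for x
  proof -
    have wl: "loopless k i" if "walk_weight k i x \<noteq> 0" for i using that walk_weight_loop by blast
    have "Z 0 k x = c * (\<Sum>i\<in>A. walk_weight k i x)"
    proof -
      have "Suc (m + 2) = k" by (simp add: k)
      from Z_0_walks[of "m + 2" x, unfolded this] show ?thesis by (simp only: c_def A_def)
    qed
    also have "(\<Sum>i\<in>A. walk_weight k i x) = (\<Sum>i\<in>{i \<in> A. inj_on i {..<k}}. walk_weight k i x) + (\<Sum>i\<in>{i \<in> A. \<not> inj_on i {..<k}}. walk_weight k i x)"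
      using fA by (subst sum.union_disjoint[symmetric]) (auto intro!: sum.cong)
    also have "(\<Sum>i\<in>{i \<in> A. \<not> inj_on i {..<k}}. walk_weight k i x) = (\<Sum>i\<in>W. monom_fun (walk_edges k i) x)"
      using fA by (intro sum.mono_neutral_cong_right) (auto simp: W_def walk_weight_monom intro: wl)
    finally show ?thesis by (simp add: cycle_poly_def S_def A_def c_def distrib_left)
  qed
  \<comment> \<open>After removing the expansion of the pure power, there remain the lower terms of
    the Chebyshev polynomial of degree \<open>k\<close> and the trace of the one of degree
    \<open>k - 2\<close>.\<close>
  have low: "deg_lt (edges n) k (\<lambda>x. F (Suc m) x - cycle_poly k x - S x)"
  proof -
    have "deg_lt (edges n) k (\<lambda>x. \<Sum>i<n. V 1 k i i x - V 0 k i i x)"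
      by (intro deg_lt_sum deg_lt_V_1_V_0) auto
    moreover have "deg_lt (edges n) k (Z 1 (Suc m))" by (rule deg_lt_mono[OF deg_lt_Z]) (simp add: k)
    ultimately have "deg_lt (edges n) k (\<lambda>x. (\<Sum>i<n. V 1 k i i x - V 0 k i i x) - Z 1 (Suc m) x)"
      by (rule deg_lt_diff)
    moreover have "(\<lambda>x. F (Suc m) x - cycle_poly k x - S x) = (\<lambda>x. (\<Sum>i<n. V 1 k i i x - V 0 k i i x) - Z 1 (Suc m) x)"
    proof
      fix x
      have "F (Suc m) x - cycle_poly k x - S x = Z 1 k x - Z 1 (Suc m) x - Z 0 k x"
        using Z0[of x] by (simp add: F_def k numeral_3_eq_3)
      thus "F (Suc m) x - cycle_poly k x - S x = (\<Sum>i<n. V 1 k i i x - V 0 k i i x) - Z 1 (Suc m) x"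
        by (simp add: Z_def[of _ k] sum_subtractf)
    qed
    ultimately show ?thesis by simp
  qed
  have F: "deg_lt (edges n) (Suc k) (F (Suc m))" using deg_lt_F[of "Suc m"] by (simp add: k numeral_3_eq_3)
  have T: "chaos (edges n) k (cycle_poly k)" by (rule chaos_cycle_poly) (simp add: k)
  obtain g where g: "chaos (edges n) k g" "deg_lt (edges n) k (\<lambda>x. S x - g x)"
    and Vb: "Var (\<lambda>x. F (Suc m) x - cycle_poly k x) \<le> Ex (\<lambda>x. (g x)\<^sup>2) + Var (\<lambda>x. OU (edges n) (F (Suc m)) x + real k * F (Suc m) x)"
    by (rule Var_le_OU_plus_top[OF F T low]) (use k in auto)
  have r: "1 \<le> sqrt (real n)" "sqrt (real n) \<le> real n" using n_pos
    by (auto intro: real_le_lsqrt simp: power2_eq_square)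
  have "Ex (\<lambda>x. (g x)\<^sup>2) \<le> c\<^sup>2 * fact k * real (k ^ k) * real (card W)"
  proof (rule Ex_top_chaos_square_le)
    show "finite W" using fA by (simp add: W_def)
    show "size (walk_edges k w) = k \<and> set_mset (walk_edges k w) \<subseteq> edges n" if "w \<in> W" for w
      using that walk_edges_subset[of w k n] by (auto simp: W_def A_def size_walk_edges)
    show "card {w' \<in> W. walk_edges k w' = walk_edges k w} \<le> k ^ k" if "w \<in> W" for w
    proof -
      have "card {w' \<in> W. walk_edges k w' = walk_edges k w} \<le> card {w' \<in> A. walk_edges k w' = walk_edges k w}"
        using fA by (intro card_mono) (auto simp: W_def)
      also have "\<dots> \<le> k ^ k" unfolding A_def using that by (intro card_same_edges_le) (auto simp: W_def A_def)
      finally show ?thesis .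
    qed
  qed (use g in \<open>simp_all add: S_def\<close>)
  also have "\<dots> \<le> c\<^sup>2 * fact k * real (k ^ k) * real (k\<^sup>2 * n ^ (k - 1))"
  proof (intro mult_left_mono)
    have "card W \<le> card {i \<in> A. \<not> inj_on i {..<k}}" using fA by (intro card_mono) (auto simp: W_def)
    also have "\<dots> \<le> k\<^sup>2 * n ^ (k - 1)" unfolding A_def by (rule card_noninjective_le)
    finally show "real (card W) \<le> real (k\<^sup>2 * n ^ (k - 1))" by (simp only: of_nat_le_iff)
  qed auto
  also have "\<dots> = fact k * real k ^ k * (real k)\<^sup>2 * (c\<^sup>2 * real n ^ (k - 1))" by simp
  \<comment> \<open>The normalisation squared is \<open>n^(-k)\<close>; the one lost vertex of a
    degenerate walk leaves exactly \<open>1 / n\<close>.\<close>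
  also have "c\<^sup>2 * real n ^ (k - 1) = 1 / real n"
  proof -
    have "c\<^sup>2 = 1 / real n ^ k" by (simp add: c_def power_divide mult.commute[of k] flip: power_mult) (simp add: power_mult)
    moreover have "real n ^ k = real n * real n ^ (k - 1)"
    proof -
      have "Suc (k - 1) = k" using k by simp
      thus ?thesis by (metis power_Suc)
    qed
    ultimately show ?thesis using n_pos by simp
  qed
  also have "fact k * real k ^ k * (real k)\<^sup>2 * (1 / real n) \<le> fact k * real k ^ k * (real k)\<^sup>2 / sqrt (real n)"
    using r by (simp add: divide_left_mono)
  finally have "Ex (\<lambda>x. (g x)\<^sup>2) \<le> fact k * real k ^ k * (real k)\<^sup>2 / sqrt (real n)" .
  with Vb Var_remainder_le[OF k] show ?thesis by (simp add: add_divide_distrib)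
qed

section \<open>Convergence in probability\<close>

text \<open>Integration by parts for a power of one variable, read off from the known moments. For
  \<open>j = 0\<close> the factor \<open>real j\<close> vanishes, so truncation in
  \<open>j - 1\<close> does no harm.\<close>

lemma std_normal_moment_rec:
  "(\<integral>x. std_normal_density x * x ^ Suc j \<partial>lborel) = real j * (\<integral>x. std_normal_density x * x ^ (j - 1) \<partial>lborel)"
proof (cases "even j")
  case True
  then obtain q where "j = 2 * q" by (elim evenE)
  thus ?thesis
    using integral_std_normal_moment_odd[of q] integral_std_normal_moment_odd[of "q - 1"]
    by (cases q) auto
next
  case False
  then obtain q where j: "j = 2 * q + 1" by (elim oddE)
  have "(\<integral>x. std_normal_density x * x ^ (2 * Suc q) \<partial>lborel) = fact (2 * Suc q) / (2 ^ Suc q * fact (Suc q))"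
    by (rule integral_std_normal_moment_even)
  also have "fact (2 * Suc q) = 2 * real (Suc q) * real (2 * q + 1) * (fact (2 * q) :: real)"
    by (simp add: algebra_simps)
  also have "2 * real (Suc q) * real (2 * q + 1) * (fact (2 * q) :: real) / (2 ^ Suc q * fact (Suc q))
     = real (2 * q + 1) * (fact (2 * q) / (2 ^ q * fact q))"
    unfolding fact_Suc power_Suc by (simp del: of_nat_Suc)
  also have "fact (2 * q) / (2 ^ q * fact q) = (\<integral>x. std_normal_density x * x ^ (2 * q) \<partial>lborel)"
    by (rule integral_std_normal_moment_even[symmetric])
  finally show ?thesis by (simp add: j)
qed

text \<open>Exponent vectors instead of multisets: the product over all of \<open>E\<close> has one
  factor per variable, the shape to which independence applies.\<close>

definition pmonom :: "'e set \<Rightarrow> ('e \<Rightarrow> nat) \<Rightarrow> ('e \<Rightarrow> real) \<Rightarrow> real" where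
  "pmonom E \<alpha> x = (\<Prod>e\<in>E. x e ^ \<alpha> e)"

lemma pmonom_split: "finite E \<Longrightarrow> e \<in> E \<Longrightarrow> pmonom E \<alpha> x = x e ^ \<alpha> e * pmonom (E - {e}) \<alpha> x"
  by (simp add: pmonom_def prod.remove)

lemma pmonom_upd: "finite E \<Longrightarrow> e \<in> E \<Longrightarrow> pmonom E (\<alpha>(e := a)) x = x e ^ a * pmonom (E - {e}) \<alpha> x"
  by (simp add: pmonom_split[of E e]) (simp add: pmonom_def)

lemma polyfun_pmonom: "polyfun E (pmonom E \<alpha>)"
  unfolding pmonom_def by (intro polyfun_prod polyfun_power polyfun_coord)

lemma pd_pmonom:
  assumes "finite E" "e \<in> E"
  shows "pd e (pmonom E \<alpha>) = (\<lambda>x. real (\<alpha> e) * pmonom E (\<alpha>(e := \<alpha> e - 1)) x)"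
proof (rule pd_eqI)
  fix x :: "'a \<Rightarrow> real"
  have "pmonom (E - {e}) \<alpha> (x(e := t)) = pmonom (E - {e}) \<alpha> x" for t
    unfolding pmonom_def by (intro prod.cong) auto
  hence "(\<lambda>t. pmonom E \<alpha> (x(e := t))) = (\<lambda>t. t ^ \<alpha> e * pmonom (E - {e}) \<alpha> x)"
    using assms by (simp add: pmonom_split fun_eq_iff)
  moreover have "((\<lambda>t. t ^ \<alpha> e * pmonom (E - {e}) \<alpha> x) has_field_derivative
      (real (\<alpha> e) * x e ^ (\<alpha> e - 1)) * pmonom (E - {e}) \<alpha> x) (at (x e))"
    by (intro DERIV_cmult_right) (auto intro!: derivative_eq_intros)
  ultimately show "((\<lambda>t. pmonom E \<alpha> (x(e := t))) has_field_derivative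
      real (\<alpha> e) * pmonom E (\<alpha>(e := \<alpha> e - 1)) x) (at (x e))"
    using assms by (simp add: pmonom_upd mult.assoc)
qed

section \<open>Independent Gaussian variables provide the expectation functional\<close>

locale gaussian_variables = prob_space M for M :: "'a measure" +
  fixes E :: "'e set" and X :: "'e \<Rightarrow> 'a \<Rightarrow> real"
  assumes fin: "finite E"
    and indep: "indep_vars (\<lambda>_. borel) X E"
    and gauss: "\<And>e. e \<in> E \<Longrightarrow> distributed M lborel (X e) (\<lambda>x. ennreal (std_normal_density x))"
begin

definition Ex :: "(('e \<Rightarrow> real) \<Rightarrow> real) \<Rightarrow> real" where
  "Ex f = expectation (\<lambda>\<omega>. f (\<lambda>e. X e \<omega>))"

definition X_integrable :: "(('e \<Rightarrow> real) \<Rightarrow> real) \<Rightarrow> bool" where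
  "X_integrable f \<longleftrightarrow> integrable M (\<lambda>\<omega>. f (\<lambda>e. X e \<omega>))"

definition moment :: "nat \<Rightarrow> real" where
  "moment j = (\<integral>x. std_normal_density x * x ^ j \<partial>lborel)"

lemma X_power:
  assumes "e \<in> E"
  shows "integrable M (\<lambda>\<omega>. X e \<omega> ^ j)" "expectation (\<lambda>\<omega>. X e \<omega> ^ j) = moment j"
proof -
  show "integrable M (\<lambda>\<omega>. X e \<omega> ^ j)"
    using distributed_integrable[OF gauss[OF assms], of "\<lambda>x. x ^ j"] integrable_std_normal_moment[of j] by simp
  show "expectation (\<lambda>\<omega>. X e \<omega> ^ j) = moment j"
    using distributed_integral[OF gauss[OF assms], of "\<lambda>x. x ^ j"] by (simp add: moment_def)
qed

lemma pmonom_integral: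
  "X_integrable (pmonom E \<alpha>)" "Ex (pmonom E \<alpha>) = (\<Prod>e\<in>E. moment (\<alpha> e))"
proof -
  have "indep_vars (\<lambda>_. borel) (\<lambda>e \<omega>. X e \<omega> ^ \<alpha> e) E"
    by (rule indep_vars_compose2[OF indep]) simp
  note iv = this
  show "X_integrable (pmonom E \<alpha>)" unfolding X_integrable_def pmonom_def
    by (rule indep_vars_integrable[OF fin iv]) (rule X_power)
  show "Ex (pmonom E \<alpha>) = (\<Prod>e\<in>E. moment (\<alpha> e))"
    unfolding Ex_def pmonom_def
    by (subst indep_vars_lebesgue_integral[OF fin iv]) (auto intro: X_power simp: X_power(2))
qed

text \<open>Integrability is bundled with integration by parts, since additivity of the latter
  requires the former.\<close>

definition good :: "(('e \<Rightarrow> real) \<Rightarrow> real) \<Rightarrow> bool" where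
  "good f \<longleftrightarrow> polyfun E f \<and> X_integrable f \<and> (\<forall>e\<in>E. X_integrable (\<lambda>x. x e * f x) \<and> X_integrable (pd e f) \<and> Ex (\<lambda>x. x e * f x) = Ex (pd e f))"

lemma good_pmonom: "good (pmonom E \<alpha>)"
  unfolding good_def
proof (intro conjI ballI polyfun_pmonom pmonom_integral(1))
  fix e assume e: "e \<in> E"
  have up: "(\<lambda>x. x e * pmonom E \<alpha> x) = pmonom E (\<alpha>(e := Suc (\<alpha> e)))"
    using e fin by (simp add: pmonom_upd pmonom_split[of E e \<alpha>] mult.assoc fun_eq_iff)
  show "X_integrable (\<lambda>x. x e * pmonom E \<alpha> x)" unfolding up by (rule pmonom_integral)
  show "X_integrable (pd e (pmonom E \<alpha>))" unfolding pd_pmonom[OF fin e]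
    using pmonom_integral(1) unfolding X_integrable_def by (rule integrable_mult_right)
  have upd: "(\<Prod>e'\<in>E. moment ((\<alpha>(e := a)) e')) = moment a * (\<Prod>e'\<in>E - {e}. moment (\<alpha> e'))" for a
    using fin e by (subst prod.remove[of _ e]) (auto intro!: prod.cong)
  have "Ex (\<lambda>x. x e * pmonom E \<alpha> x) = moment (Suc (\<alpha> e)) * (\<Prod>e'\<in>E - {e}. moment (\<alpha> e'))"
    unfolding up pmonom_integral(2) by (rule upd)
  also have "\<dots> = real (\<alpha> e) * (moment (\<alpha> e - 1) * (\<Prod>e'\<in>E - {e}. moment (\<alpha> e')))"
    unfolding moment_def std_normal_moment_rec by simp
  also have "\<dots> = real (\<alpha> e) * Ex (pmonom E (\<alpha>(e := \<alpha> e - 1)))"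
    unfolding pmonom_integral(2) upd ..
  also have "\<dots> = Ex (pd e (pmonom E \<alpha>))" unfolding pd_pmonom[OF fin e] Ex_def by simp
  finally show "Ex (\<lambda>x. x e * pmonom E \<alpha> x) = Ex (pd e (pmonom E \<alpha>))" .
qed

lemma good_cmult: "good f \<Longrightarrow> good (\<lambda>x. f x * c)"
proof -
  assume f: "good f"
  have "pd e (\<lambda>x. f x * c) = (\<lambda>x. pd e f x * c)" for e
    using pd_cmult[of E f e c] f by (simp add: good_def mult.commute)
  thus ?thesis using f unfolding good_def X_integrable_def Ex_def
    by (auto intro: polyfun_mult polyfun_const simp: mult.assoc[symmetric])
qed

lemma good_add: "good f \<Longrightarrow> good g \<Longrightarrow> good (\<lambda>x. f x + g x)"
  unfolding good_def X_integrable_def Ex_def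
  by (auto simp: pd_add[of E] distrib_left intro: polyfun_add)

text \<open>The claim is strengthened by an arbitrary monomial factor. In the case of a product with
  a variable, that variable is absorbed into the monomial, and the induction hypothesis applies with
  a larger exponent.\<close>

lemma good_polyfun: "polyfun E f \<Longrightarrow> good f"
proof -
  assume "polyfun E f"
  then obtain d where "deg_lt E d f" by (auto simp: polyfun_def)
  hence "good (\<lambda>x. pmonom E \<alpha> x * f x)" for \<alpha>
  proof (induction arbitrary: \<alpha> rule: deg_lt.induct)
    case deg_lt_zero
    show ?case by (rule good_cmult[OF good_pmonom])
  next
    case (deg_lt_const d c)
    show ?case by (rule good_cmult[OF good_pmonom])
  next
    case (deg_lt_var e d f)
    have "(\<lambda>x. pmonom E \<alpha> x * (x e * f x)) = (\<lambda>x. pmonom E (\<alpha>(e := Suc (\<alpha> e))) x * f x)"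
      using deg_lt_var fin by (simp add: pmonom_upd pmonom_split[of E e \<alpha>] mult_ac fun_eq_iff)
    thus ?case using deg_lt_var.IH by simp
  next
    case (deg_lt_add d f g)
    thus ?case by (simp add: distrib_left good_add)
  qed
  from this[of "\<lambda>_. 0"] show ?thesis by (simp add: pmonom_def)
qed

lemma polyfun_integrable: "polyfun E f \<Longrightarrow> integrable M (\<lambda>\<omega>. f (\<lambda>e. X e \<omega>))"
  using good_polyfun[of f] by (simp add: good_def X_integrable_def)

sublocale gaussian_expectation E Ex
proof
  show "finite E" by (rule fin)
  show "Ex (\<lambda>x. 1) = 1" by (simp add: Ex_def prob_space)
  fix f g c e
  assume f: "polyfun E f"
  show "Ex (\<lambda>x. c * f x) = c * Ex f" unfolding Ex_def by simp
  show "0 \<le> Ex f" if "\<And>x. 0 \<le> f x" unfolding Ex_def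
    by (rule Bochner_Integration.integral_nonneg) (rule that)
  show "Ex (\<lambda>x. f x + g x) = Ex f + Ex g" if "polyfun E g"
    unfolding Ex_def using f that by (intro Bochner_Integration.integral_add polyfun_integrable)
  show "Ex (\<lambda>x. x e * f x) = Ex (pd e f)" if "e \<in> E" using good_polyfun[OF f] that by (simp add: good_def)
qed

lemma polyfun_Chebyshev:
  assumes f: "polyfun E f" and "0 < \<epsilon>"
  shows "prob {\<omega> \<in> space M. \<epsilon> \<le> \<bar>f (\<lambda>e. X e \<omega>) - Ex f\<bar>} \<le> Var f / \<epsilon>\<^sup>2"
proof -
  have "variance (\<lambda>\<omega>. f (\<lambda>e. X e \<omega>)) = Var f" unfolding Var_alt[OF f] by (simp add: Ex_def)
  thus ?thesis
    using Chebyshev_inequality[of "\<lambda>\<omega>. f (\<lambda>e. X e \<omega>)" \<epsilon>] polyfun_integrable[OF f]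
      polyfun_integrable[OF polyfun_power[OF f, of 2]] assms(2)
    by (simp add: Ex_def)
qed

end

lemma signed_cycle_eq:
  assumes "0 < n" "2 \<le> k" and A: "A \<in> carrier_mat n n" "transpose_mat A = A"
  shows "signed_cycle n k A = matrix_size.cycle_poly n k (\<lambda>e. A $$ e)"
proof -
  interpret matrix_size n by unfold_locales fact
  have sym: "A $$ (i, j) = A $$ (j, i)" if "i < n" "j < n" for i j
    using arg_cong[OF A(2), of "\<lambda>M. M $$ (i, j)"] A(1) that by simp
  have "(\<Prod>j<k. A $$ (i j, i (Suc j mod k))) = walk_weight k i (\<lambda>e. A $$ e)"
    if i: "i \<in> {..<k} \<rightarrow>\<^sub>E {..<n}" "inj_on i {..<k}" for i
    unfolding walk_weight_def
  proof (intro prod.cong refl)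
    fix j assume j: "j \<in> {..<k}"
    have "i j \<noteq> i (Suc j mod k)" using inj_loopless[OF i(2) assms(2)] j by (simp add: loopless_def)
    moreover have "i j < n" "i (Suc j mod k) < n" using PiE_mem[OF i(1)] j by auto
    ultimately show "A $$ (i j, i (Suc j mod k)) = entry (i j) (i (Suc j mod k)) (\<lambda>e. A $$ e)"
      by (auto simp: entry_def min_def max_def sym)
  qed
  thus ?thesis unfolding signed_cycle_def cycle_poly_def atLeast0LessThan
    by (intro arg_cong2[of _ _ _ _ "(*)"] refl sum.cong) auto
qed

lemma cheb_trace_eq:
  assumes "0 < n" and A: "A \<in> carrier_mat n n" "transpose_mat A = A"
  shows "cheb_trace n (Suc (Suc m)) A = matrix_size.F n m (\<lambda>e. A $$ e)"
proof -
  interpret matrix_size n by unfold_locales fact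
  define x where "x = (\<lambda>e. A $$ e)"
  have sym: "A $$ (i, j) = A $$ (j, i)" if "i < n" "j < n" for i j
    using arg_cong[OF A(2), of "\<lambda>M. M $$ (i, j)"] A(1) that by simp
  obtain lam v where es: "is_eigensystem n (B x) lam v" using eigensystem_B by blast
  have "(1 / sqrt (real n)) \<cdot>\<^sub>m zero_diag A = mat n n (\<lambda>(i, j). B x i j)"
    using A(1) by (intro eq_matI) (auto simp: zero_diag_def B_def entry_def x_def min_def max_def sym)
  hence "cheb_trace n (Suc (Suc m)) A = (\<Sum>l<n. poly (rcheb (Suc (Suc m))) (lam l))"
    unfolding cheb_trace_def by (simp add: spectral_trace_eigensystem[OF es])
  also have "\<dots> = F m x"
    by (simp only: F_def rcheb_tpol sum_subtractf Z_eigen[OF es])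
  finally show ?thesis by (simp add: x_def)
qed

text \<open>A common bound for the threshold on \<open>n\<close> and for the variance constant. Here
  \<open>448 = 4 * 2 * 56\<close> with \<open>56 = 14 * 4\<close> from
  \<open>moment_bound (4 * k)\<close>; the exponent leaves room for \<open>K^2\<close>, the
  factorial and the powers of \<open>k\<close>.\<close>

definition size_factor :: "nat \<Rightarrow> real" where
  "size_factor k = (448 * real k) ^ (20 * k)"

lemma moment_bound_le: "1 \<le> k \<Longrightarrow> moment_bound (4 * k) \<le> (448 * real k) ^ (4 * k)"
proof -
  assume k: "1 \<le> k"
  have "1 + (14 * real (4 * k)) ^ (4 * k) \<le> 2 * (56 * real k) ^ (4 * k)"
  proof -
    have "1 \<le> (56 * real k) ^ (4 * k)" using k by (intro one_le_power) simp
    moreover have "14 * real (4 * k) = 56 * real k" by simp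
    ultimately show ?thesis by (simp only:)
  qed
  also have "\<dots> \<le> 2 ^ (4 * k) * (56 * real k) ^ (4 * k)"
    using k power_increasing[of 1 "4 * k" "2 :: real"] by (intro mult_right_mono) auto
  finally have "moment_bound (4 * k) \<le> 4 ^ (4 * k) * (2 ^ (4 * k) * (56 * real k) ^ (4 * k))"
    unfolding moment_bound_def by (intro mult_left_mono) auto
  also have "\<dots> = (4 * (2 * (56 * real k))) ^ (4 * k)" by (simp only: power_mult_distrib)
  also have "4 * (2 * (56 * real k)) = 448 * real k" by simp
  finally show ?thesis .
qed

lemma size_factor_bounds:
  assumes k: "1 \<le> k"
  defines "K \<equiv> moment_bound (4 * k)"
  shows "38 * real k ^ 4 * K \<le> size_factor k"
    and "fact k * real k ^ k * (real k)\<^sup>2 + 800 * real k ^ 8 * 4 ^ k * K\<^sup>2 \<le> size_factor k"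
proof -
  define a where "a = 448 * real k"
  have a: "1 \<le> a" "real k \<le> a" "4 \<le> a" "38 \<le> a" "448 \<le> a" using k by (simp_all add: a_def)
  have K: "0 \<le> K" "K \<le> a ^ (4 * k)" using moment_bound_le[OF k] moment_bound_ge_1[of "4 * k"] by (simp_all add: K_def a_def)
  have up: "a ^ i \<le> a ^ j" if "i \<le> j" for i j using that a by (intro power_increasing) auto
  have "38 * real k ^ 4 * K \<le> a * a ^ 4 * a ^ (4 * k)"
    using a K by (intro mult_mono power_mono) auto
  also have "a * a ^ 4 = a ^ 5" by (simp add: eval_nat_numeral)
  also have "a ^ 5 * a ^ (4 * k) = a ^ (5 + 4 * k)" by (simp add: power_add)
  also have "\<dots> \<le> a ^ (20 * k)" using k by (intro up) auto
  finally show "38 * real k ^ 4 * K \<le> size_factor k" by (simp add: size_factor_def a_def)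
  have "fact k \<le> real (k ^ k)" by (rule fact_le_power)
  hence "fact k \<le> a ^ k" using power_mono[OF a(2), of k] by simp
  hence "fact k * real k ^ k * (real k)\<^sup>2 \<le> a ^ k * a ^ k * a\<^sup>2"
    using a by (intro mult_mono power_mono) auto
  also have "\<dots> = a ^ (k + k + 2)" by (simp only: power_add)
  also have "\<dots> \<le> a ^ (19 * k)" using k by (intro up) auto
  finally have 1: "fact k * real k ^ k * (real k)\<^sup>2 \<le> a ^ (19 * k)" .
  have "448 * 448 \<le> a * a" using a by (intro mult_mono) auto
  hence "800 * real k ^ 8 * 4 ^ k * K\<^sup>2 \<le> a\<^sup>2 * a ^ 8 * a ^ k * (a ^ (4 * k))\<^sup>2"
    using a K by (intro mult_mono power_mono) (auto simp: power2_eq_square)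
  also have "\<dots> = a ^ (10 + 9 * k)" unfolding power_mult[symmetric] power_add[symmetric]
    by (intro arg_cong[of _ _ "(^) a"]) simp
  also have "\<dots> \<le> a ^ (19 * k)" using k by (intro up) auto
  finally have 2: "800 * real k ^ 8 * 4 ^ k * K\<^sup>2 \<le> a ^ (19 * k)" .
  have "fact k * real k ^ k * (real k)\<^sup>2 + 800 * real k ^ 8 * 4 ^ k * K\<^sup>2 \<le> 2 * a ^ (19 * k)" using 1 2 by simp
  also have "\<dots> \<le> a * a ^ (19 * k)" using a by (intro mult_right_mono) auto
  also have "\<dots> \<le> a ^ (20 * k)" using up[of "Suc (19 * k)" "20 * k"] k by simp
  finally show "fact k * real k ^ k * (real k)\<^sup>2 + 800 * real k ^ 8 * 4 ^ k * K\<^sup>2 \<le> size_factor k"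
    by (simp add: size_factor_def a_def)
qed

text \<open>The logarithm is at most \<open>20 k * 448 k = 8960 k^2\<close>. Taking
  \<open>1 / 200\<close> in the definition of little-o makes this at most
  \<open>8960 / 40000\<close> times \<open>ln n\<close>, below a quarter of it. This is where the
  growth condition on \<open>k\<close> enters.\<close>

lemma size_factor_small:
  assumes k_ge: "\<And>n. n \<ge> 1 \<Longrightarrow> k n \<ge> 3"
    and k_small: "(\<lambda>n. real (k n)) \<in> o(\<lambda>n. sqrt (ln (real n)))"
  shows "\<forall>\<^sub>F n in sequentially. size_factor (k n) \<le> real n powr (1 / 4)"
proof -
  have "\<forall>\<^sub>F n in sequentially. norm (real (k n)) \<le> 1 / 200 * norm (sqrt (ln (real n)))"
    using landau_o.smallD[OF k_small, of "1 / 200"] by simp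
  moreover have "\<forall>\<^sub>F n in sequentially. n \<ge> (1::nat)" by (rule eventually_ge_at_top)
  ultimately show ?thesis
  proof eventually_elim
    case (elim n)
    have k: "k n \<ge> 3" using k_ge elim by simp
    have ln0: "ln (real n) \<ge> 0" using elim by simp
    have "real (k n) \<le> 1 / 200 * sqrt (ln (real n))" using elim ln0 by simp
    hence "(real (k n))\<^sup>2 \<le> (1 / 200 * sqrt (ln (real n)))\<^sup>2" by (intro power_mono) auto
    also have "\<dots> = ln (real n) / 40000" using ln0 by (simp add: power_mult_distrib power_divide)
    finally have k2: "(real (k n))\<^sup>2 \<le> ln (real n) / 40000" .
    have "ln (448 * real (k n)) \<le> 448 * real (k n)" using k by (intro order_trans[OF ln_le_minus_one]) auto
    hence "real (20 * k n) * ln (448 * real (k n)) \<le> real (20 * k n) * (448 * real (k n))" by (intro mult_left_mono) auto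
    also have "\<dots> = 8960 * (real (k n))\<^sup>2" by (simp add: power2_eq_square)
    also have "\<dots> \<le> 1 / 4 * ln (real n)" using k2 ln0 by simp
    finally have "exp (real (20 * k n) * ln (448 * real (k n))) \<le> exp (1 / 4 * ln (real n))" by simp
    moreover have "size_factor (k n) = exp (real (20 * k n) * ln (448 * real (k n)))"
      using k by (simp only: exp_of_nat_mult size_factor_def) simp
    ultimately show ?case using elim by (simp add: powr_def)
  qed
qed

theorem theorem2p2:
  fixes M :: "nat \<Rightarrow> 'a measure"
    and A :: "nat \<Rightarrow> 'a \<Rightarrow> real mat"
    and k :: "nat \<Rightarrow> nat"
  assumes prob: "\<And>n. n \<ge> 1 \<Longrightarrow> prob_space (M n)"
    and dim: "\<And>n \<omega>. n \<ge> 1 \<Longrightarrow> \<omega> \<in> space (M n) \<Longrightarrow> A n \<omega> \<in> carrier_mat n n"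
    and sym: "\<And>n \<omega>. n \<ge> 1 \<Longrightarrow> \<omega> \<in> space (M n) \<Longrightarrow> transpose_mat (A n \<omega>) = A n \<omega>"
    and meas: "\<And>n i j. n \<ge> 1 \<Longrightarrow> i < n \<Longrightarrow> j < n \<Longrightarrow>
                 (\<lambda>\<omega>. A n \<omega> $$ (i, j)) \<in> borel_measurable (M n)"
    and indep: "\<And>n. n \<ge> 1 \<Longrightarrow>
                 prob_space.indep_vars (M n) (\<lambda>_. borel) (\<lambda>(i, j) \<omega>. A n \<omega> $$ (i, j))
                   {(i, j). i < j \<and> j < n}"
    and gauss: "\<And>n i j. n \<ge> 1 \<Longrightarrow> i < j \<Longrightarrow> j < n \<Longrightarrow>
                 distributed (M n) lborel (\<lambda>\<omega>. A n \<omega> $$ (i, j)) (\<lambda>x. ennreal (std_normal_density x))"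
    and k_ge: "\<And>n. n \<ge> 1 \<Longrightarrow> k n \<ge> 3"
    and k_small: "(\<lambda>n. real (k n)) \<in> o(\<lambda>n. sqrt (ln (real n)))"
  shows "tendsto_in_prob M
           (\<lambda>n \<omega>. signed_cycle n (k n) (A n \<omega>) -
              (cheb_trace n (k n) (A n \<omega>) -
               prob_space.expectation (M n) (\<lambda>\<omega>'. cheb_trace n (k n) (A n \<omega>')))) 0"
proof -
  define D where "D n \<omega> = signed_cycle n (k n) (A n \<omega>) - (cheb_trace n (k n) (A n \<omega>) -
               prob_space.expectation (M n) (\<lambda>\<omega>'. cheb_trace n (k n) (A n \<omega>')))" for n \<omega>
  \<comment> \<open>The quantitative estimate at a fixed \<open>n\<close>; the side condition on
    \<open>size_factor\<close> is what makes the large-dimension bounds available.\<close>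
  have key: "D n \<in> borel_measurable (M n) \<and> (\<forall>\<epsilon>>0. size_factor (k n) \<le> real n \<longrightarrow>
      measure (M n) {\<omega> \<in> space (M n). \<bar>D n \<omega>\<bar> > \<epsilon>} \<le> size_factor (k n) / sqrt (real n) / \<epsilon>\<^sup>2)" if n: "n \<ge> 1" for n
  proof -
    define X where "X e \<omega> = A n \<omega> $$ e" for e \<omega>
    interpret prob_space "M n" using n by (rule prob)
    interpret gaussian_variables "M n" "edges n" X
    proof
      show "finite (edges n)" by (rule finite_edges)
      have "X = (\<lambda>(i, j) \<omega>. A n \<omega> $$ (i, j))" by (auto simp: X_def fun_eq_iff)
      thus "indep_vars (\<lambda>_. borel) X (edges n)" using indep[OF n] by (simp add: edges_def)
      show "distributed (M n) lborel (X e) (\<lambda>x. ennreal (std_normal_density x))" if "e \<in> edges n" for e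
        using that gauss[OF n] by (auto simp: edges_def X_def[abs_def])
    qed
    interpret gaussian_matrix n Ex
      by unfold_locales (use n in auto)
    define m where "m = k n - 3"
    have k: "k n = m + 3" using k_ge[OF n] by (simp add: m_def)
    have cyc: "signed_cycle n (k n) (A n \<omega>) = cycle_poly (k n) (\<lambda>e. X e \<omega>)" if "\<omega> \<in> space (M n)" for \<omega>
      using signed_cycle_eq[of n "k n" "A n \<omega>"] n k dim[OF n that] sym[OF n that] by (simp add: X_def)
    have che: "cheb_trace n (k n) (A n \<omega>) = F (Suc m) (\<lambda>e. X e \<omega>)" if "\<omega> \<in> space (M n)" for \<omega>
      using cheb_trace_eq[of n "A n \<omega>" "Suc m"] n dim[OF n that] sym[OF n that] by (simp add: X_def k numeral_3_eq_3)
    define f where "f x = F (Suc m) x - cycle_poly (k n) x" for x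
    have ch: "chaos (edges n) (k n) (cycle_poly (k n))" by (rule chaos_cycle_poly) (simp add: k)
    have pc: "polyfun (edges n) (cycle_poly (k n))" using ch by (rule chaos_polyfun)
    have pf: "polyfun (edges n) f" unfolding f_def by (intro polyfun_diff polyfun_F pc)
    \<comment> \<open>Constants are orthogonal to the chaos of order \<open>k\<close>, hence the
      signed cycle has mean zero. Centring the trace thus centres the whole difference.\<close>
    have "deg_lt (edges n) (k n) (\<lambda>x. 1)" unfolding k by (rule deg_lt_mono[OF deg_lt_const[of _ 0]]) simp
    hence "Ex (cycle_poly (k n)) = 0" using chaos_lower_orthogonal[OF _ ch, of "\<lambda>x. 1"] by simp
    hence Ef: "Ex f = Ex (F (Suc m))" unfolding f_def by (simp add: Ex_diff polyfun_F pc)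
    have "expectation (\<lambda>\<omega>'. cheb_trace n (k n) (A n \<omega>')) = Ex (F (Suc m))"
      unfolding Ex_def by (intro Bochner_Integration.integral_cong refl che)
    hence Df: "D n \<omega> = - (f (\<lambda>e. X e \<omega>) - Ex f)" if "\<omega> \<in> space (M n)" for \<omega>
      using that by (simp add: D_def cyc che f_def Ef)
    note mf0 = borel_measurable_integrable[OF polyfun_integrable[OF pf]]
    have mf: "(\<lambda>\<omega>. - (f (\<lambda>e. X e \<omega>) - Ex f)) \<in> borel_measurable (M n)"
      by (intro borel_measurable_uminus borel_measurable_diff mf0 borel_measurable_const)
    have "D n \<in> borel_measurable (M n)"
      by (rule iffD2[OF measurable_cong[OF Df] mf])
    moreover have "measure (M n) {\<omega> \<in> space (M n). \<bar>D n \<omega>\<bar> > \<epsilon>} \<le> size_factor (k n) / sqrt (real n) / \<epsilon>\<^sup>2"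
      if \<epsilon>: "\<epsilon> > 0" and large: "size_factor (k n) \<le> real n" for \<epsilon>
    proof -
      interpret large_gaussian_matrix n Ex "k n" "moment_bound (4 * k n)"
        by unfold_locales (use k size_factor_bounds(1)[of "k n"] large in auto)
      have "measure (M n) {\<omega> \<in> space (M n). \<bar>D n \<omega>\<bar> > \<epsilon>} \<le> prob {\<omega> \<in> space (M n). \<epsilon> \<le> \<bar>f (\<lambda>e. X e \<omega>) - Ex f\<bar>}"
      proof (rule finite_measure_mono)
        show "{\<omega> \<in> space (M n). \<bar>D n \<omega>\<bar> > \<epsilon>} \<subseteq> {\<omega> \<in> space (M n). \<epsilon> \<le> \<bar>f (\<lambda>e. X e \<omega>) - Ex f\<bar>}"
          using Df by (auto simp: abs_minus_commute)
        show "{\<omega> \<in> space (M n). \<epsilon> \<le> \<bar>f (\<lambda>e. X e \<omega>) - Ex f\<bar>} \<in> sets (M n)"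
          by (intro borel_measurable_le borel_measurable_const borel_measurable_abs borel_measurable_diff mf0)
      qed
      also have "\<dots> \<le> Var f / \<epsilon>\<^sup>2" using pf \<epsilon> by (rule polyfun_Chebyshev)
      also have "Var f \<le> size_factor (k n) / sqrt (real n)"
        unfolding f_def using size_factor_bounds(2)[of "k n"] k
        by (intro order_trans[OF Var_F_cycle_le[OF k]] divide_right_mono) auto
      finally show ?thesis by (simp add: divide_right_mono)
    qed
    ultimately show ?thesis by blast
  qed
  have small: "\<forall>\<^sub>F n in sequentially. size_factor (k n) \<le> real n powr (1 / 4)"
    by (rule size_factor_small[OF k_ge k_small])
  show ?thesis unfolding tendsto_in_prob_def diff_0_right D_def[symmetric]
  proof (intro conjI allI impI)
    show "\<forall>\<^sub>F n in sequentially. D n \<in> borel_measurable (M n)"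
      using eventually_ge_at_top[of "1::nat"] by eventually_elim (use key in blast)
    fix \<epsilon> :: real assume \<epsilon>: "\<epsilon> > 0"
    have ub: "\<forall>\<^sub>F n in sequentially. measure (M n) {\<omega> \<in> space (M n). \<bar>D n \<omega>\<bar> > \<epsilon>} \<le> real n powr (- 1 / 4) / \<epsilon>\<^sup>2"
      using small eventually_ge_at_top[of "1::nat"]
    proof eventually_elim
      case (elim n)
      \<comment> \<open>The bound by \<open>n^(1/4)\<close> serves twice: it lies below
        \<open>n\<close>, so that \<open>key\<close> applies, and divided by the square root of
        \<open>n\<close> it leaves \<open>n^(-1/4)\<close>.\<close>
      have "size_factor (k n) \<le> real n powr 1" using elim by (elim order_trans) (intro powr_mono; simp)
      hence "measure (M n) {\<omega> \<in> space (M n). \<bar>D n \<omega>\<bar> > \<epsilon>} \<le> size_factor (k n) / sqrt (real n) / \<epsilon>\<^sup>2"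
        using key[OF elim(2)] \<epsilon> elim(2) by simp
      also have "\<dots> \<le> real n powr (1 / 4) / sqrt (real n) / \<epsilon>\<^sup>2" using elim by (intro divide_right_mono) auto
      also have "real n powr (1 / 4) / sqrt (real n) = real n powr (- 1 / 4)"
        using elim(2) by (simp add: powr_half_sqrt[symmetric] flip: powr_diff)
      finally show ?case .
    qed
    have lim: "(\<lambda>n. real n powr (- 1 / 4) / \<epsilon>\<^sup>2) \<longlonglongrightarrow> 0"
      using tendsto_divide[OF tendsto_neg_powr[of "- 1 / 4", OF _ filterlim_real_sequentially] tendsto_const, of "\<epsilon>\<^sup>2"] \<epsilon> by simp
    show "(\<lambda>n. measure (M n) {\<omega> \<in> space (M n). \<bar>D n \<omega>\<bar> > \<epsilon>}) \<longlonglongrightarrow> 0"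
      by (rule tendsto_sandwich[OF _ ub tendsto_const lim]) simp
  qed
qed

end
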